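(* Let $K=K^{\mathbf{l}}$ be a scale-irregular Vicsek set such that $\mathbf{l}=(l_n)_{n\ge1}$ satisfies $\sup_{n\ge1}l_n<\infty$, and fix $\beta^*\in(0,\infty)$. Then for each $1<p<\infty$: (1) There exists a constant $\epsilon_p\in(0,1)$, depending only on $\mathbf{l}$ and $p$, such that for every $\beta\in(\epsilon_p\beta^*,\infty)$ we have $B_{p,p}^\beta\subset B_{p,\infty}^\beta\subset C(K)$, and there exists $C\ge1$ such that for all $u\in C(K)$, $$C^{-1}[u]_{B_{p,\infty}^\beta}^p\le\mathcal{E}_{p,\infty}^\beta(u)\le C[u]_{B_{p,\infty}^\beta}^p,\qquad C^{-1}[u]_{B_{p,p}^\beta}^p\le\mathcal{E}_{p,p}^\beta(u)\le C[u]_{B_{p,p}^\beta}^p .$$ In particular, when $\beta=\beta^*$, we have $\mathcal{F}_p=B_{p,\infty}^{\beta^*}$ and there is $C\ge1$ such that $C^{-1}[u]_{B_{p,\infty}^{\beta^*}}^p\le\mathcal{E}_p(u)\le C[u]_{B_{p,\infty}^{\beta^*}}^p$ for all $u\in\mathcal{F}_p$. (2) $\beta^*$ is the critical Besov exponent, that is, $$\beta^*=\max\{\beta\in[0,\infty):\ B_{p,\infty}^\beta\text{ contains non-constant functions}\}.$$ (3) (Weak-monotonicity property) There is a constant $C>0$ such that for all $u\in\mathcal{F}_p=B_{p,\infty}^{\beta^*}$, $$\sup_{r\in(0,\mathrm{diam}(K)]}\Phi_u^{\beta^*}(r)\le C\liminf_{r\to0}\Phi_u^{\beta^*}(r).$$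 (4) (Bourgain-Brezis-Mironescu convergence) There exists $C>1$ such that for all $u\in\mathcal{F}_p=B_{p,\infty}^{\beta^*}$, $$C^{-1}\mathcal{E}_p(u)\le\liminf_{\beta\uparrow\beta^*}(\beta^*-\beta)\mathcal{E}_{p,p}^\beta(u)\le\limsup_{\beta\uparrow\beta^*}(\beta^*-\beta)\mathcal{E}_{p,p}^\beta(u)\le C\,\mathcal{E}_p(u)$$ and $$C^{-1}[u]_{B_{p,\infty}^{\beta^*}}^p\le\liminf_{\beta\uparrow\beta^*}(\beta^*-\beta)[u]_{B_{p,p}^\beta}^p\le\limsup_{\beta\uparrow\beta^*}(\beta^*-\beta)[u]_{B_{p,p}^\beta}^p\le C[u]_{B_{p,\infty}^{\beta^*}}^p .$$
   Context: Scale-irregular Vicsek set. Let $\mathbf{l}=(l_k)_{k\ge1}$ be a sequence of odd integers $l_k\ge3$, and set $l_0:=1$. In the complex plane put $q_0:=0$ and $q_j:=\exp((2j-1)\pi i/4)$ for $1\le j\le4$, and let $K_0$ be the closed (filled) square with vertices $q_1,q_2,q_3,q_4$. For an odd integer $l\ge3$ let $S_l:=\{2nl^{-1}q_j:\ 0\le n\le\frac12(l-1),\ n\in\mathbb{Z},\ 1\le j\le4\}$ (so $\#S_l=2l-1$), and for $w\in S_l$ let $F_w^l(z):=w+l^{-1}z$, $z\in\mathbb{C}$. Let $W_n:=\prod_{k=1}^nS_{l_k}$ for $n\ge1$, and for $w=w_1\cdots w_n\in W_n$ let $F_w:=F_{w_1}^{l_1}\circ\cdots\circ F_{w_n}^{l_n}$.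 The scale-irregular Vicsek set is the compact set $K=K^{\mathbf{l}}:=\bigcap_{n=1}^\infty\bigcup_{w\in W_n}F_w(K_0)$ with the Euclidean metric $d$; $\mathrm{diam}(K)=2$. For $w\in W_n$ write $K_w:=F_w(K_0)\cap K$. The measure $\mu$ is the Borel probability measure on $K$ determined by $\mu(K_w)=(\#W_n)^{-1}=\prod_{k=1}^n(2l_k-1)^{-1}$ for all $n\ge1$, $w\in W_n$. Scale functions. $\rho_n:=2\prod_{k=0}^nl_k^{-1}$ ($n\ge0$). $\psi(r):=\prod_{k=0}^n(2l_k-1)^{-1}$ for $\rho_{n+1}<r\le\rho_n$ ($n\ge0$), $\psi(r):=1$ for $r\ge2$. $\phi(r):=\rho_n^{p-1}\psi(\rho_n)$ for $\rho_{n+1}<r\le\rho_n$ ($n\ge0$), $\phi(r):=2^{p-1}$ for $r\ge2$. Besov-Lipschitz spaces. For $0\le\beta<\infty$, $0<r\le\mathrm{diam}(K)$, $u\in L^p(K,\mu)$, with $B(x,r)$ the metric ball of $K$, $$\Phi_u^\beta(r):=\int_K\frac{1}{\mu(B(x,r))}\int_{B(x,r)}\frac{|u(x)-u(y)|^p}{\phi(r)^{\beta/\beta^*}}\,d\mu(y)\,d\mu(x),$$ $[u]_{B_{p,p}^\beta}:=\big(\int_0^{\mathrm{diam}(K)}\Phi_u^\beta(r)\frac{dr}{r}\big)^{1/p}$, $[u]_{B_{p,\infty}^\beta}:=\sup_{r\in(0,\mathrm{diam}(K)]}\Phi_u^\beta(r)^{1/p}$, and $B_{p,q}^\beta:=\{u\in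 L^p(K,\mu):[u]_{B_{p,q}^\beta}<\infty\}$ for $q\in\{p,\infty\}$. The inclusion of such a space in $C(K)$ means that every element has a continuous $\mu$-version, by which it is then represented. (Elements of $L^p$ are "non-constant" if not $\mu$-a.e. equal to a constant.) Discrete energies. Let $V_0:=\{q_j\}_{j=0}^4$, $V_n:=\bigcup_{w\in W_n}F_w(V_0)$ for $n\ge1$; for $x,y\in V_n$ write $x\sim y$ if $d(x,y)=\prod_{j=0}^nl_j^{-1}$. Let $C(K)$ be the real-valued continuous functions on $K$. For $u\in C(K)$ (sums over ordered pairs, values in $[0,\infty]$): $$\mathcal{E}_n^\beta(u):=\tfrac12\phi(\rho_n)^{-\beta/\beta^*}\psi(\rho_n)\sum_{x,y\in V_n,\,x\sim y}|u(x)-u(y)|^p,\quad \mathcal{E}_{p,\infty}^\beta(u):=\sup_{n\ge0}\mathcal{E}_n^\beta(u),\quad\mathcal{E}_{p,p}^\beta(u):=\sum_{n=0}^\infty\mathcal{E}_n^\beta(u).$$ Also $\mathcal{E}_p(u):=\sup_{n\ge0}\frac12\big(\prod_{j=0}^nl_j^{p-1}\big)\sum_{x,y\in V_n,\,x\sim y}|u(x)-u(y)|^p$ and $\mathcal{F}_p:=\{u\in C(K):\mathcal{E}_p(u)<\infty\}$. *)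

theory Defs
  imports "HOL-Probability.Probability"
begin

definition vicsek_seq :: "(nat \<Rightarrow> nat) \<Rightarrow> bool" where
  "vicsek_seq l \<longleftrightarrow> l 0 = 1 \<and> (\<forall>k\<ge>1. odd (l k) \<and> 3 \<le> l k)"

definition q_pt :: "nat \<Rightarrow> complex" where
  "q_pt j = (if j = 0 then 0 else exp (of_real ((2 * real j - 1) * pi / 4) * \<i>))"

definition K_0 :: "complex set" where
  "K_0 = convex hull (q_pt ` {1..4})"

definition S_set :: "nat \<Rightarrow> complex set" where
  "S_set m = {of_real (2 * real n / real m) * q_pt j | n j. n \<le> (m - 1) div 2 \<and> 1 \<le> j \<and> j \<le> 4}"

definition simil :: "nat \<Rightarrow> complex \<Rightarrow> complex \<Rightarrow> complex" where
  "simil m w z = w + z / of_nat m"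

text \<open>
  A word \<open>w\<^sub>1\<dots>w\<^sub>n\<close> is a list, so its letter \<open>w\<^sub>k\<close> is \<open>w ! (k - 1)\<close>. The empty word is
  admitted, with \<open>F_map l [] = id\<close>.
\<close>

definition W_set :: "(nat \<Rightarrow> nat) \<Rightarrow> nat \<Rightarrow> complex list set" where
  "W_set l n = {w. length w = n \<and> (\<forall>k<n. w ! k \<in> S_set (l (Suc k)))}"

definition F_map :: "(nat \<Rightarrow> nat) \<Rightarrow> complex list \<Rightarrow> complex \<Rightarrow> complex" where
  "F_map l w = foldr (\<lambda>k g. simil (l (Suc k)) (w ! k) \<circ> g) [0..<length w] id"

definition vicsek :: "(nat \<Rightarrow> nat) \<Rightarrow> complex set" where
  "vicsek l = (\<Inter>n\<in>{1..}. \<Union>w\<in>W_set l n. F_map l w ` K_0)"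

definition cell :: "(nat \<Rightarrow> nat) \<Rightarrow> complex list \<Rightarrow> complex set" where
  "cell l w = F_map l w ` K_0 \<inter> vicsek l"

definition vicsek_measure :: "(nat \<Rightarrow> nat) \<Rightarrow> complex measure \<Rightarrow> bool" where
  "vicsek_measure l \<mu> \<longleftrightarrow>
     prob_space \<mu> \<and> sets \<mu> = sets (restrict_space borel (vicsek l)) \<and>
     (\<forall>n\<ge>1. \<forall>w\<in>W_set l n. measure \<mu> (cell l w) = 1 / real (card (W_set l n)))"

definition rho :: "(nat \<Rightarrow> nat) \<Rightarrow> nat \<Rightarrow> real" where
  "rho l n = 2 * (\<Prod>k\<le>n. 1 / real (l k))"

text \<open>The index \<open>n\<close> below exists and is unique for \<open>0 < r \<le> 2\<close>; only \<open>r > 0\<close> is ever used.\<close>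

definition scale_index :: "(nat \<Rightarrow> nat) \<Rightarrow> real \<Rightarrow> nat" where
  "scale_index l r = (THE n. rho l (Suc n) < r \<and> r \<le> rho l n)"

definition psi :: "(nat \<Rightarrow> nat) \<Rightarrow> real \<Rightarrow> real" where
  "psi l r = (if 2 \<le> r then 1 else (\<Prod>k\<le>scale_index l r. 1 / (2 * real (l k) - 1)))"

definition phi :: "(nat \<Rightarrow> nat) \<Rightarrow> real \<Rightarrow> real \<Rightarrow> real" where
  "phi l p r =
     (if 2 \<le> r then 2 powr (p - 1)
      else rho l (scale_index l r) powr (p - 1) * psi l (rho l (scale_index l r)))"

text \<open>
  Functions on \<open>K\<close> are total functions on \<open>complex\<close> of which only the values on \<open>K\<close> matter;
  elements of \<open>L\<^sup>p\<close> and of the Besov spaces are represented by all their \<open>\<mu>\<close>-versions.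
  The argument \<open>bs\<close> is the reference exponent \<open>\<beta>\<^sup>*\<close>.
\<close>

definition Lp :: "real \<Rightarrow> complex measure \<Rightarrow> (complex \<Rightarrow> real) set" where
  "Lp p \<mu> = {u \<in> borel_measurable \<mu>. integrable \<mu> (\<lambda>x. \<bar>u x\<bar> powr p)}"

text \<open>Real power with exponent \<open>a > 0\<close> on \<open>[0,\<infinity>]\<close>.\<close>

definition enn_powr :: "ennreal \<Rightarrow> real \<Rightarrow> ennreal" where
  "enn_powr x a = (if x = \<top> then \<top> else ennreal (enn2real x powr a))"

definition Phi :: "(nat \<Rightarrow> nat) \<Rightarrow> complex measure \<Rightarrow> real \<Rightarrow> real \<Rightarrow> real \<Rightarrow>
    (complex \<Rightarrow> real) \<Rightarrow> real \<Rightarrow> ennreal" where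
  "Phi l \<mu> p bs \<beta> u r =
     (\<integral>\<^sup>+x. (1 / emeasure \<mu> (ball x r \<inter> vicsek l)) *
        (\<integral>\<^sup>+y\<in>ball x r \<inter> vicsek l.
           ennreal (\<bar>u x - u y\<bar> powr p / phi l p r powr (\<beta> / bs)) \<partial>\<mu>) \<partial>\<mu>)"

definition besov_pp :: "(nat \<Rightarrow> nat) \<Rightarrow> complex measure \<Rightarrow> real \<Rightarrow> real \<Rightarrow> real \<Rightarrow>
    (complex \<Rightarrow> real) \<Rightarrow> ennreal" where
  "besov_pp l \<mu> p bs \<beta> u =
     enn_powr (\<integral>\<^sup>+r\<in>{0<..diameter (vicsek l)}. Phi l \<mu> p bs \<beta> u r * ennreal (1 / r) \<partial>lborel)
       (1 / p)"

definition besov_pinf :: "(nat \<Rightarrow> nat) \<Rightarrow> complex measure \<Rightarrow> real \<Rightarrow> real \<Rightarrow> real \<Rightarrow>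
    (complex \<Rightarrow> real) \<Rightarrow> ennreal" where
  "besov_pinf l \<mu> p bs \<beta> u =
     (SUP r\<in>{0<..diameter (vicsek l)}. enn_powr (Phi l \<mu> p bs \<beta> u r) (1 / p))"

definition Bpp :: "(nat \<Rightarrow> nat) \<Rightarrow> complex measure \<Rightarrow> real \<Rightarrow> real \<Rightarrow> real \<Rightarrow>
    (complex \<Rightarrow> real) set" where
  "Bpp l \<mu> p bs \<beta> = {u \<in> Lp p \<mu>. besov_pp l \<mu> p bs \<beta> u < \<infinity>}"

definition Bpinf :: "(nat \<Rightarrow> nat) \<Rightarrow> complex measure \<Rightarrow> real \<Rightarrow> real \<Rightarrow> real \<Rightarrow>
    (complex \<Rightarrow> real) set" where
  "Bpinf l \<mu> p bs \<beta> = {u \<in> Lp p \<mu>. besov_pinf l \<mu> p bs \<beta> u < \<infinity>}"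

definition C_K :: "(nat \<Rightarrow> nat) \<Rightarrow> (complex \<Rightarrow> real) set" where
  "C_K l = {u. continuous_on (vicsek l) u}"

definition included_in_C :: "(nat \<Rightarrow> nat) \<Rightarrow> complex measure \<Rightarrow> (complex \<Rightarrow> real) set \<Rightarrow> bool" where
  "included_in_C l \<mu> B \<longleftrightarrow> (\<forall>u\<in>B. \<exists>v\<in>C_K l. AE x in \<mu>. u x = v x)"

text \<open>
  When \<open>included_in_C l \<mu> B\<close> holds, \<open>cont_versions l \<mu> B\<close> is \<open>B\<close> with its elements represented
  by their continuous versions, hence the set to be compared with subsets of \<open>C(K)\<close>.
\<close>

definition cont_versions ::
    "(nat \<Rightarrow> nat) \<Rightarrow> complex measure \<Rightarrow> (complex \<Rightarrow> real) set \<Rightarrow> (complex \<Rightarrow> real) set" where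
  "cont_versions l \<mu> B = {v \<in> C_K l. \<exists>u\<in>B. AE x in \<mu>. u x = v x}"

definition nonconstant :: "complex measure \<Rightarrow> (complex \<Rightarrow> real) \<Rightarrow> bool" where
  "nonconstant \<mu> u \<longleftrightarrow> \<not> (\<exists>c. AE x in \<mu>. u x = c)"

definition V_set :: "(nat \<Rightarrow> nat) \<Rightarrow> nat \<Rightarrow> complex set" where
  "V_set l n = (\<Union>w\<in>W_set l n. F_map l w ` (q_pt ` {0..4}))"

definition edges :: "(nat \<Rightarrow> nat) \<Rightarrow> nat \<Rightarrow> (complex \<times> complex) set" where
  "edges l n = {(x, y). x \<in> V_set l n \<and> y \<in> V_set l n \<and> dist x y = (\<Prod>j\<le>n. 1 / real (l j))}"

definition E_level :: "(nat \<Rightarrow> nat) \<Rightarrow> real \<Rightarrow> real \<Rightarrow> real \<Rightarrow> nat \<Rightarrow> (complex \<Rightarrow> real) \<Rightarrow> real" where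
  "E_level l p bs \<beta> n u =
     1/2 * phi l p (rho l n) powr (- \<beta> / bs) * psi l (rho l n) *
       (\<Sum>(x, y)\<in>edges l n. \<bar>u x - u y\<bar> powr p)"

definition E_pinf :: "(nat \<Rightarrow> nat) \<Rightarrow> real \<Rightarrow> real \<Rightarrow> real \<Rightarrow> (complex \<Rightarrow> real) \<Rightarrow> ennreal" where
  "E_pinf l p bs \<beta> u = (SUP n. ennreal (E_level l p bs \<beta> n u))"

definition E_pp :: "(nat \<Rightarrow> nat) \<Rightarrow> real \<Rightarrow> real \<Rightarrow> real \<Rightarrow> (complex \<Rightarrow> real) \<Rightarrow> ennreal" where
  "E_pp l p bs \<beta> u = (\<Sum>n. ennreal (E_level l p bs \<beta> n u))"

definition E_p :: "(nat \<Rightarrow> nat) \<Rightarrow> real \<Rightarrow> (complex \<Rightarrow> real) \<Rightarrow> ennreal" where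
  "E_p l p u =
     (SUP n. ennreal (1/2 * (\<Prod>j\<le>n. real (l j) powr (p - 1)) *
        (\<Sum>(x, y)\<in>edges l n. \<bar>u x - u y\<bar> powr p)))"

definition F_p :: "(nat \<Rightarrow> nat) \<Rightarrow> real \<Rightarrow> (complex \<Rightarrow> real) set" where
  "F_p l p = {u \<in> C_K l. E_p l p u < \<infinity>}"

end

theory Submission
  imports Defs
begin

text \<open>
  In coordinates along the two diagonals, \<open>K_0\<close> is the unit ball of the \<open>l\<^sup>1\<close> norm and the centers of
  the level \<open>n\<close> cells lie on a square lattice. Hence two points of the fractal closer than the size
  of a cell lie in cells that share a vertex. Telescoping along the centers of cells shrinking to a
  point bounds \<open>Phi\<close> at scale \<open>\<rho>\<^sub>n\<close> by a geometrically weighted sum of the discrete energies of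
  the levels from \<open>n\<close> on; telescoping along the averages over cells shrinking to a vertex bounds the
  energy of level \<open>n\<close> by a weighted sum of values of \<open>Phi\<close> at smaller scales. Since
  \<open>2 l - 1 \<le> l\<^sup>2\<close>, the weights of the second sum decay once \<open>\<beta> / \<beta>\<^sup>* > 2 / (p + 1)\<close>, which is the choice
  of \<open>\<epsilon>\<close>; the same decay makes averages over cells converge to a continuous version.

  For \<open>\<beta> = \<beta>\<^sup>*\<close> the discrete energies increase with the level, by convexity along the arms of the
  cells. So for \<open>\<beta> > \<beta>\<^sup>*\<close> finite energy forces energy zero; weak monotonicity holds because the energy
  of a fine level is almost the supremum; and the last part follows from
  \<open>\<Sum>n. \<phi>(\<rho>\<^sub>n)\<^sup>s \<approx> 1 / s\<close> as \<open>s\<close> tends to \<open>0\<close>.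
\<close>

section \<open>Plane geometry\<close>

text \<open>Telescoping must not lose powers of the number of steps. Instead of Hoelder's inequality
  along a chain, the increments get weights 1 / lam^j. These weights are a loss that the scaling has
  to pay back: the decay \<open>sig t\<close> per level is split as \<open>lam t * lam t\<close>,
  where one factor cancels the weight and the other stays as a geometric weight on the finer levels.
  Both comparisons thus become convolutions with \<open>lam t ^ j\<close>, a form that suits the
  supremum over the levels as well as the sum. The decay itself is a competition within one
  subdivision: \<open>phi\<close> shrinks by the factor l^(p-1) (2 l - 1), raised to the power
  \<open>\<beta> / bs\<close>, while the number of cells grows by the factor 2 l - 1. The bound on
  \<open>l\<close> allows quantities at neighbouring scales to be exchanged at bounded cost.\<close>

declare One_nat_def [simp del]

text \<open>Coordinates in the orthonormal basis \<open>q_pt 1\<close>, \<open>q_pt 2\<close>.\<close>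

definition crd_x :: "complex \<Rightarrow> real" where "crd_x z = Re (z * cnj (q_pt 1))"
definition crd_y :: "complex \<Rightarrow> real" where "crd_y z = Im (z * cnj (q_pt 1))"
definition norm1 :: "complex \<Rightarrow> real" where "norm1 z = \<bar>crd_x z\<bar> + \<bar>crd_y z\<bar>"
definition dirs :: "complex set" where "dirs = q_pt ` {1..4}"

lemma q_pt_1: "q_pt 1 = Complex (sqrt 2 / 2) (sqrt 2 / 2)"
  using cis_conv_exp[of "pi/4"] by (simp add: q_pt_def mult.commute cis.code cos_45 sin_45)

lemma q_pt_Suc: "1 \<le> j \<Longrightarrow> q_pt (Suc j) = \<i> * q_pt j"
proof -
  assume j: "1 \<le> j"
  have "q_pt (Suc j) = exp (of_real (pi/2) * \<i> + of_real ((2 * real j - 1) * pi / 4) * \<i>)"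
    by (simp add: q_pt_def field_simps)
  also have "\<dots> = exp (of_real (pi/2) * \<i>) * q_pt j"
    using j by (simp add: exp_add q_pt_def)
  also have "exp (of_real (pi/2) * \<i>) = \<i>"
    using cis_conv_exp[of "pi/2"] by (simp add: mult.commute)
  finally show ?thesis .
qed

lemma q_pt_2: "q_pt 2 = \<i> * q_pt 1" using q_pt_Suc[of 1] by simp
lemma q_pt_3: "q_pt 3 = - q_pt 1" using q_pt_Suc[of 2] q_pt_2 by simp
lemma q_pt_4: "q_pt 4 = - q_pt 2" using q_pt_Suc[of 3] q_pt_2 q_pt_3 by simp

lemma q_pt_0: "q_pt 0 = 0" by (simp add: q_pt_def)

lemma q1_norm: "q_pt 1 * cnj (q_pt 1) = 1" "cnj (q_pt 1) * q_pt 1 = 1"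
  by (simp_all add: q_pt_1 complex_eq_iff)

lemma cmod_q1: "cmod (cnj (q_pt 1)) = 1"
  using q1_norm(1) by (metis complex_mod_mult_cnj complex_mod_cnj norm_one power2_eq_1_iff norm_ge_zero
    abs_of_nonneg abs_minus_cancel)

lemma crd_add: "crd_x (a + b) = crd_x a + crd_x b" "crd_y (a + b) = crd_y a + crd_y b"
  and crd_diff: "crd_x (a - b) = crd_x a - crd_x b" "crd_y (a - b) = crd_y a - crd_y b"
  and crd_minus: "crd_x (- a) = - crd_x a" "crd_y (- a) = - crd_y a"
  and crd_0: "crd_x 0 = 0" "crd_y 0 = 0"
  by (simp_all add: crd_x_def crd_y_def algebra_simps)

lemma crd_scale: "crd_x (of_real c * a) = c * crd_x a" "crd_y (of_real c * a) = c * crd_y a"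
  by (simp_all add: crd_x_def crd_y_def algebra_simps)

lemma crd_q: "crd_x (q_pt 1) = 1" "crd_y (q_pt 1) = 0" "crd_x (q_pt 2) = 0" "crd_y (q_pt 2) = 1"
  "crd_x (q_pt 3) = -1" "crd_y (q_pt 3) = 0" "crd_x (q_pt 4) = 0" "crd_y (q_pt 4) = -1"
  unfolding q_pt_2 q_pt_3 q_pt_4 crd_x_def crd_y_def mult.assoc mult_minus_left q1_norm
  by simp_all

lemma cmod_crd: "(cmod z)\<^sup>2 = (crd_x z)\<^sup>2 + (crd_y z)\<^sup>2"
proof -
  have "cmod z = cmod (z * cnj (q_pt 1))" by (simp only: norm_mult cmod_q1 mult_1_right)
  then show ?thesis by (simp only: cmod_power2 crd_x_def crd_y_def)
qed

lemma crd_eqI: "crd_x a = crd_x b \<Longrightarrow> crd_y a = crd_y b \<Longrightarrow> a = b"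
  using cmod_crd[of "a - b"] by (simp add: crd_diff)

lemma norm1_triangle: "norm1 (a + b) \<le> norm1 a + norm1 b"
  by (simp add: norm1_def crd_add)
lemma norm1_scale: "norm1 (of_real c * a) = \<bar>c\<bar> * norm1 a"
  by (simp add: norm1_def crd_scale abs_mult distrib_left)
lemma norm1_minus: "norm1 (a - b) = norm1 (b - a)"
  by (simp add: norm1_def crd_diff abs_minus_commute)
lemma norm1_0[simp]: "norm1 0 = 0" by (simp add: norm1_def crd_0)
lemma norm1_ge0: "0 \<le> norm1 a" by (simp add: norm1_def)

lemma cmod_le_norm1: "cmod z \<le> norm1 z"
proof (rule power2_le_imp_le)
  show "(cmod z)\<^sup>2 \<le> (norm1 z)\<^sup>2"
    unfolding cmod_crd norm1_def power2_sum by simp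
qed (simp add: norm1_ge0)

lemma norm1_le_cmod: "norm1 z \<le> sqrt 2 * cmod z"
proof (rule power2_le_imp_le)
  have "2 * \<bar>crd_x z\<bar> * \<bar>crd_y z\<bar> \<le> (crd_x z)\<^sup>2 + (crd_y z)\<^sup>2"
    using sum_squares_bound[of "\<bar>crd_x z\<bar>" "\<bar>crd_y z\<bar>"] by simp
  then show "(norm1 z)\<^sup>2 \<le> (sqrt 2 * cmod z)\<^sup>2"
    unfolding power_mult_distrib cmod_crd norm1_def power2_sum by simp
qed simp

text \<open>A rational substitute for sqrt 2. Being less than 2, it turns Euclidean distance below
  \<open>h n\<close> into \<open>norm1 (x - y) < 2 * h n\<close>, the hypothesis of the adjacency
  lemmas; distance below \<open>2 * h n\<close> gives that hypothesis one level coarser.\<close>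

lemma norm1_le_cmod2: "norm1 z \<le> 3/2 * cmod z"
proof -
  have "sqrt 2 \<le> 3/2" by (rule real_le_lsqrt) (auto simp: power2_eq_square)
  then show ?thesis using norm1_le_cmod[of z] mult_right_mono[of "sqrt 2" "3/2" "cmod z"] by simp
qed

lemma dirs_eq: "dirs = {q_pt 1, q_pt 2, q_pt 3, q_pt 4}"
proof -
  have "{1..4::nat} = {1,2,3,4}" by auto
  then show ?thesis by (simp add: dirs_def)
qed

lemma dirs_distinct: "q_pt 1 \<noteq> q_pt 2" "q_pt 1 \<noteq> q_pt 3" "q_pt 1 \<noteq> q_pt 4"
  "q_pt 2 \<noteq> q_pt 3" "q_pt 2 \<noteq> q_pt 4" "q_pt 3 \<noteq> q_pt 4"
  using crd_q by (force dest: arg_cong[where f=crd_x] arg_cong[where f=crd_y])+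

lemma dirs_card: "finite dirs" "card dirs = 4"
  using dirs_distinct by (simp_all add: dirs_eq)

lemma dirs_minus: "e \<in> dirs \<Longrightarrow> - e \<in> dirs"
  by (auto simp: dirs_eq q_pt_3 q_pt_4)

lemma dirs_crd: "e \<in> dirs \<longleftrightarrow> (crd_x e, crd_y e) \<in> {(1,0),(0,1),(-1,0),(0,-1)}"
proof
  assume "e \<in> dirs" then show "(crd_x e, crd_y e) \<in> {(1,0),(0,1),(-1,0),(0,-1)}"
    unfolding dirs_eq using crd_q by auto
next
  assume "(crd_x e, crd_y e) \<in> {(1,0),(0,1),(-1,0),(0,-1)}"
  then have "e = q_pt 1 \<or> e = q_pt 2 \<or> e = q_pt 3 \<or> e = q_pt 4"
    using crd_q by (auto intro: crd_eqI)
  then show "e \<in> dirs" by (auto simp: dirs_eq)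
qed

lemma dirs_norm: "e \<in> dirs \<Longrightarrow> norm1 e = 1" "e \<in> dirs \<Longrightarrow> cmod e = 1"
proof -
  assume "e \<in> dirs"
  then show "norm1 e = 1" by (auto simp: dirs_crd norm1_def)
  have "(cmod e)\<^sup>2 = 1" using \<open>e \<in> dirs\<close> by (auto simp: dirs_crd cmod_crd)
  then show "cmod e = 1" by (simp add: power2_eq_1_iff) (smt (verit) norm_ge_zero)
qed

lemma dirs_nonzero: "e \<in> dirs \<Longrightarrow> e \<noteq> 0"
  using dirs_norm by fastforce

text \<open>The scalar product with \<open>e\<close>. For \<open>e\<close> in \<open>dirs\<close> it
  is a supporting functional of the l1 ball: bounded by \<open>norm1\<close> and equal to 1 at
  \<open>e\<close>.\<close>

definition along :: "complex \<Rightarrow> complex \<Rightarrow> real" where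
  "along e z = crd_x e * crd_x z + crd_y e * crd_y z"

lemma along_add: "along e (a + b) = along e a + along e b"
  and along_diff: "along e (a - b) = along e a - along e b"
  by (simp_all add: along_def crd_add crd_diff algebra_simps)

lemma along_scale: "along e (of_real c * a) = c * along e a"
  by (simp add: along_def crd_scale distrib_left)

lemma along_self: "e \<in> dirs \<Longrightarrow> along e e = 1"
  by (auto simp: along_def dirs_crd)
lemma along_le: "e \<in> dirs \<Longrightarrow> \<bar>along e z\<bar> \<le> norm1 z"
  by (auto simp: along_def dirs_crd norm1_def)
lemma along_minus_e: "along (- e) z = - along e z"
  by (simp add: along_def crd_minus)

lemma K_0_eq: "K_0 = {z. norm1 z \<le> 1}"
proof
  have cvx: "convex {z. norm1 z \<le> 1}"
  proof (rule convexI)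
    fix x y :: complex and u v :: real
    assume *: "x \<in> {z. norm1 z \<le> 1}" "y \<in> {z. norm1 z \<le> 1}" "0 \<le> u" "0 \<le> v" "u + v = 1"
    have "norm1 (u *\<^sub>R x + v *\<^sub>R y) \<le> u * norm1 x + v * norm1 y"
      using norm1_triangle[of "of_real u * x" "of_real v * y"] *
      by (simp add: norm1_scale scaleR_conv_of_real)
    also have "\<dots> \<le> u * 1 + v * 1" using * by (intro add_mono mult_left_mono) auto
    finally show "u *\<^sub>R x + v *\<^sub>R y \<in> {z. norm1 z \<le> 1}" using * by simp
  qed
  have "q_pt ` {1..4} \<subseteq> {z. norm1 z \<le> 1}"
    using dirs_norm(1) unfolding dirs_def by (metis (mono_tags, lifting) mem_Collect_eq order_refl subsetI)
  then show "K_0 \<subseteq> {z. norm1 z \<le> 1}" unfolding K_0_def using cvx by (rule hull_minimal)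
next
  show "{z. norm1 z \<le> 1} \<subseteq> K_0"
  proof
    fix z assume "z \<in> {z. norm1 z \<le> 1}"
    then have z: "\<bar>crd_x z\<bar> + \<bar>crd_y z\<bar> \<le> 1" by (simp add: norm1_def)
    \<comment> \<open>The positive and negative parts of the coordinates are the weights of the four
      corners. The missing mass is spread evenly as \<open>s\<close>, which opposite corners
      cancel.\<close>
    define s where "s = (1 - \<bar>crd_x z\<bar> - \<bar>crd_y z\<bar>) / 4"
    define w where "w = (\<lambda>e. if e = q_pt 1 then max (crd_x z) 0 + s else
      if e = q_pt 3 then max (- crd_x z) 0 + s else
      if e = q_pt 2 then max (crd_y z) 0 + s else max (- crd_y z) 0 + s)"
    have w: "w (q_pt 1) = max (crd_x z) 0 + s" "w (q_pt 3) = max (- crd_x z) 0 + s"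
      "w (q_pt 2) = max (crd_y z) 0 + s" "w (q_pt 4) = max (- crd_y z) 0 + s"
      using dirs_distinct by (auto simp: w_def)
    have s0: "0 \<le> s" using z by (simp add: s_def)
    have "(\<Sum>e\<in>dirs. w e) = 1"
    proof -
      have "(\<Sum>e\<in>dirs. w e) = w (q_pt 1) + w (q_pt 2) + w (q_pt 3) + w (q_pt 4)"
        using dirs_distinct unfolding dirs_eq by simp
      also have "\<dots> = (max (crd_x z) 0 + max (- crd_x z) 0) + (max (crd_y z) 0 + max (- crd_y z) 0) + 4 * s"
        unfolding w by simp
      also have "\<dots> = \<bar>crd_x z\<bar> + \<bar>crd_y z\<bar> + 4 * s" by (simp add: max_def abs_if)
      also have "4 * s = 1 - \<bar>crd_x z\<bar> - \<bar>crd_y z\<bar>" unfolding s_def by simp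
      finally show ?thesis by simp
    qed
    moreover have "(\<Sum>e\<in>dirs. w e *\<^sub>R e) = z"
    proof -
      have "(\<Sum>e\<in>dirs. w e *\<^sub>R e) = of_real (w (q_pt 1)) * q_pt 1 + of_real (w (q_pt 2)) * q_pt 2
        + of_real (w (q_pt 3)) * q_pt 3 + of_real (w (q_pt 4)) * q_pt 4"
        using dirs_distinct unfolding dirs_eq by (simp add: scaleR_conv_of_real)
      also have "\<dots> = z"
        by (rule crd_eqI) (simp_all only: crd_add crd_scale crd_q w, auto simp: max_def)
      finally show ?thesis .
    qed
    moreover have "\<forall>e\<in>dirs. 0 \<le> w e" using s0 by (auto simp: w_def)
    ultimately show "z \<in> K_0"
      unfolding K_0_def dirs_def[symmetric] convex_hull_finite[OF dirs_card(1)] by blast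
  qed
qed

section \<open>Letters of one subdivision step\<close>

lemma S_set_dirs: "S_set m = {of_real (2 * real n / real m) * e | n e. n \<le> (m - 1) div 2 \<and> e \<in> dirs}"
  unfolding S_set_def dirs_def by force

lemma S_setI: "n \<le> (m - 1) div 2 \<Longrightarrow> e \<in> dirs \<Longrightarrow> of_real (2 * real n / real m) * e \<in> S_set m"
  unfolding S_set_dirs by blast

lemma S_set_0: "0 \<in> S_set m" using S_setI[of 0 m "q_pt 1"] by (simp add: dirs_eq)

lemma S_set_end: 
  assumes "odd m" "e \<in> dirs" shows "of_real (1 - 1 / real m) * e \<in> S_set m"
proof -
  have "2 * real ((m - 1) div 2) / real m = 1 - 1 / real m"
    using assms(1) by (auto elim!: oddE simp: field_simps)
  then show ?thesis using S_setI[of "(m-1) div 2" m e] assms by simp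
qed

lemma S_set_lattice:
  assumes "s \<in> S_set m"
  obtains a b :: int where "crd_x s = 2 / real m * a" "crd_y s = 2 / real m * b"
proof -
  obtain n e where s: "s = of_real (2 * real n / real m) * e" "e \<in> dirs"
    using assms by (auto simp: S_set_dirs)
  have c: "crd_x s = 2 * real n / real m * crd_x e" "crd_y s = 2 * real n / real m * crd_y e"
    unfolding s(1) crd_scale by (rule refl)+
  consider "crd_x e = 1 \<and> crd_y e = 0" | "crd_x e = 0 \<and> crd_y e = 1"
    | "crd_x e = -1 \<and> crd_y e = 0" | "crd_x e = 0 \<and> crd_y e = -1"
    using s by (auto simp: dirs_crd)
  then show ?thesis
  proof cases
    case 1 then show ?thesis using c by (intro that[of "int n" 0]) auto
  next
    case 2 then show ?thesis using c by (intro that[of 0 "int n"]) auto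
  next
    case 3 then show ?thesis using c by (intro that[of "- int n" 0]) auto
  next
    case 4 then show ?thesis using c by (intro that[of 0 "- int n"]) auto
  qed
qed

text \<open>This leaves room 1 / m to the boundary of the unit ball, which is the radius of a child;
  hence cells are nested.\<close>

lemma S_set_norm1: 
  assumes "odd m" "s \<in> S_set m" shows "norm1 s \<le> 1 - 1 / real m"
proof -
  obtain n e where s: "s = of_real (2 * real n / real m) * e" "e \<in> dirs" "n \<le> (m-1) div 2"
    using assms by (auto simp: S_set_dirs)
  have "2 * n + 1 \<le> m" using s(3) assms(1) by (auto elim!: oddE)
  then have "real (2 * n + 1) \<le> real m" by (rule of_nat_mono)
  then have "2 * real n \<le> real m - 1" by simp
  then have "2 * real n / real m \<le> (real m - 1)/real m" by (intro divide_right_mono) auto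
  also have "\<dots> = 1 - 1 / real m" using assms(1) odd_pos by (auto simp: field_simps)
  finally show ?thesis using s by (simp only: norm1_scale dirs_norm) simp
qed

text \<open>Among the letters only the end letter of the arm \<open>e\<close> has its cell touching the corner \<open>e\<close>.\<close>

lemma S_set_along_end:
  assumes "odd m" "s \<in> S_set m" "e \<in> dirs" "s \<noteq> of_real (1 - 1 / real m) * e"
  shows "along e s \<le> 1 - 3 / real m"
proof -
  obtain n f where s: "s = of_real (2 * real n / real m) * f" "f \<in> dirs" "n \<le> (m-1) div 2"
    using assms by (auto simp: S_set_dirs)
  have m: "2 * ((m-1) div 2) = m - 1" "m \<ge> 1" using assms(1) by (auto elim: oddE)
  show ?thesis
  proof (cases "f = e")
    case True
    have "n \<noteq> (m-1) div 2"
    proof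
      assume "n = (m-1) div 2"
      then have "2 * real n = real m - 1" using m by (metis of_nat_1 of_nat_diff of_nat_mult of_nat_numeral)
      then have "2 * real n / real m = 1 - 1 / real m" using m by (auto simp: field_simps)
      then show False using assms(4) s True by simp
    qed
    then have "2 * n + 2 \<le> m - 1" using s(3) m(1) by linarith
    then have "2 * n + 3 \<le> m" using m by linarith
    then have "real (2 * n + 3) \<le> real m" by (rule of_nat_mono)
    then have "2 * real n \<le> real m - 3" by simp
    then have "2 * real n / real m \<le> (real m - 3)/real m" by (intro divide_right_mono) auto
    also have "\<dots> = 1 - 3 / real m" using m by (auto simp: field_simps)
    finally show ?thesis unfolding s(1) along_scale True using along_self[OF assms(3)] by simp
  next
    case False
    \<comment> \<open>For \<open>m = 1\<close> the only letter is 0, which is the excluded end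
      letter. For larger \<open>m\<close> a letter on another arm has no positive component along
      \<open>e\<close>.\<close>
    have "m = 1 \<or> m \<ge> 3" using assms(1) by (auto elim!: oddE)
    moreover have "along e f \<le> 0" using False s(2) assms(3)
      by (auto simp: dirs_crd along_def intro: crd_eqI)
    moreover have ?thesis if "m = 1"
    proof -
      have "n = 0" using s that by simp
      then have "s = 0" using s by simp
      then show ?thesis using assms(4) that by simp
    qed
    moreover have ?thesis if "m \<ge> 3" "along e f \<le> 0"
    proof -
      have "along e s \<le> 0" using that unfolding s(1) along_scale by (intro mult_nonneg_nonpos) auto
      also have "0 \<le> 1 - 3 / real m" using that by (simp add: field_simps)
      finally show ?thesis .
    qed
    ultimately show ?thesis by blast
  qed
qed

text \<open>Position on an arm and direction determine a letter uniquely, except for 0, which lies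
  on all four arms and is split off.\<close>

lemma S_set_eq: "S_set m = insert 0 ((\<lambda>(k, e). of_real (2 * real k / real m) * e) ` ({1..(m-1) div 2} \<times> dirs))"
  (is "_ = ?R")
proof
  show "S_set m \<subseteq> ?R"
  proof
    fix s assume "s \<in> S_set m"
    then obtain n f where s: "s = of_real (2 * real n / real m) * f" "f \<in> dirs" "n \<le> (m-1) div 2"
      by (auto simp: S_set_dirs)
    show "s \<in> ?R"
    proof (cases "n = 0")
      case False
      then have "(n, f) \<in> {1..(m-1) div 2} \<times> dirs" using s by auto
      then show ?thesis using s(1) by force
    qed (use s in simp)
  qed
  show "?R \<subseteq> S_set m" using S_set_0 S_setI by auto
qed

lemma S_set_inj:
  assumes "0 < m"
  shows "inj_on (\<lambda>(k, e). of_real (2 * real k / real m) * e) ({1..(m-1) div 2} \<times> dirs)"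
proof (rule inj_onI, clarify)
  fix k e k' e' assume *: "k \<in> {1..(m-1) div 2}" "k' \<in> {1..(m-1) div 2}" "e \<in> dirs" "e' \<in> dirs"
    and eq: "complex_of_real (2 * real k / real m) * e = of_real (2 * real k' / real m) * e'"
  from eq have "norm1 (complex_of_real (2 * real k / real m) * e) = norm1 (of_real (2 * real k' / real m) * e')"
    by (rule arg_cong)
  then have "k = k'" unfolding norm1_scale using * assms by (simp add: dirs_norm)
  moreover have "2 * real k / real m \<noteq> 0" using * assms by auto
  ultimately show "k = k' \<and> e = e'" using eq by simp
qed

lemma sum_S_set:
  fixes f :: "complex \<Rightarrow> real"
  assumes "0 < m"
  shows "(\<Sum>s\<in>S_set m. f s) = f 0 + (\<Sum>e\<in>dirs. \<Sum>k=1..(m-1) div 2. f (of_real (2 * real k / real m) * e))"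
proof -
  let ?g = "\<lambda>(k, e). complex_of_real (2 * real k / real m) * e"
  have nz: "0 \<notin> ?g ` ({1..(m-1) div 2} \<times> dirs)"
    using assms dirs_nonzero by auto
  have "(\<Sum>s\<in>S_set m. f s) = f 0 + (\<Sum>s\<in>?g ` ({1..(m-1) div 2} \<times> dirs). f s)"
    unfolding S_set_eq by (rule sum.insert[OF _ nz])
      (intro finite_imageI finite_cartesian_product, simp_all add: dirs_card)
  also have "(\<Sum>s\<in>?g ` ({1..(m-1) div 2} \<times> dirs). f s) = (\<Sum>(k,e)\<in>{1..(m-1) div 2} \<times> dirs. f (?g (k,e)))"
    by (subst sum.reindex[OF S_set_inj[OF assms]]) (auto simp: case_prod_beta intro: sum.cong)
  also have "\<dots> = (\<Sum>k=1..(m-1) div 2. \<Sum>e\<in>dirs. f (of_real (2 * real k / real m) * e))"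
    by (subst sum.cartesian_product) (auto intro!: sum.cong)
  finally show ?thesis by (subst sum.swap) simp
qed

lemma finite_S_set: "finite (S_set m)"
  unfolding S_set_eq by (auto simp: dirs_card)

lemma card_S_set: assumes "odd m" shows "real (card (S_set m)) = 2 * real m - 1"
proof -
  have "real (card (S_set m)) = (\<Sum>s\<in>S_set m. 1)" by simp
  also have "\<dots> = 1 + 4 * real ((m - 1) div 2)"
    using assms odd_pos by (subst sum_S_set) (auto simp: dirs_card)
  also have "\<dots> = 2 * real m - 1" using assms by (auto elim!: oddE)
  finally show ?thesis .
qed

section \<open>Words and cells\<close>

locale vicsek_scales =
  fixes l :: "nat \<Rightarrow> nat"
  assumes vicsek_seq: "vicsek_seq l"
begin

text \<open>\<open>h n\<close> is half the diagonal of a level \<open>n\<close> cell, so that \<open>rho l n = 2 * h n\<close>; \<open>ps n\<close> and, below,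
  \<open>ph n\<close> are \<open>psi\<close> and \<open>phi\<close> at \<open>rho l n\<close>.\<close>

definition h :: "nat \<Rightarrow> real" where "h n = (\<Prod>k\<le>n. 1 / real (l k))"
definition ps :: "nat \<Rightarrow> real" where "ps n = (\<Prod>k\<le>n. 1 / (2 * real (l k) - 1))"
definition ctr :: "complex list \<Rightarrow> complex" where "ctr w = F_map l w 0"
definition box :: "complex list \<Rightarrow> complex set" where "box w = {z. norm1 (z - ctr w) \<le> h (length w)}"
abbreviation "W \<equiv> W_set l"
abbreviation "K \<equiv> vicsek l"

lemma l_0: "l 0 = 1" and l_odd: "odd (l (Suc n))" and l_ge3: "3 \<le> l (Suc n)"
  using vicsek_seq by (auto simp: vicsek_seq_def)

lemma l_pos: "0 < l n" using l_0 l_ge3 by (cases n) (auto simp: Suc_le_eq intro: less_le_trans[of 0 3])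

lemma h_0: "h 0 = 1" by (simp add: h_def l_0)
lemma h_Suc: "h (Suc n) = h n / real (l (Suc n))" by (simp add: h_def)
lemma h_pos: "0 < h n" using l_pos by (auto simp: h_def intro!: prod_pos)
lemma h_Suc_l: "h (Suc n) * real (l (Suc n)) = h n" using l_pos[of "Suc n"] by (simp add: h_Suc)
lemma h_Suc_le: "3 * h (Suc n) \<le> h n"
proof -
  have "3 * h (Suc n) \<le> real (l (Suc n)) * h (Suc n)"
    using l_ge3[of n] h_pos[of "Suc n"] by (intro mult_right_mono) auto
  then show ?thesis using h_Suc_l[of n] by (simp only: mult.commute)
qed
lemma h_decseq: "m \<le> n \<Longrightarrow> h n \<le> h m"
  by (rule lift_Suc_antimono_le[where f=h]) (use h_Suc_le h_pos in \<open>smt (verit)\<close>, simp)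
lemma h_le_power: "h n \<le> (1/3) ^ n"
proof (induction n)
  case (Suc n) then show ?case using h_Suc_le[of n] by simp
qed (simp add: h_0)
lemma h_tendsto_0: "h \<longlonglongrightarrow> 0"
  by (rule real_tendsto_sandwich[OF _ _ tendsto_const LIMSEQ_power_zero[of "1/3::real"]])
    (use h_le_power h_pos in \<open>auto intro!: always_eventually less_imp_le\<close>)

lemma ps_0: "ps 0 = 1" by (simp add: ps_def l_0)
lemma ps_Suc: "ps (Suc n) = ps n / (2 * real (l (Suc n)) - 1)" by (simp add: ps_def)
lemma two_l: "5 \<le> 2 * real (l (Suc n)) - 1" using l_ge3[of n] by simp
lemma ps_pos: "0 < ps n"
proof (induction n)
  case (Suc n) then show ?case using two_l[of n] by (simp add: ps_Suc)
qed (simp add: ps_0)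

text \<open>Words are extended at the end, while \<open>F_map\<close> folds with the first letter
  outermost; so the innermost map has to be pulled out of the fold.\<close>

lemma foldr_comp_id: "foldr (\<lambda>k g. A k \<circ> g) xs f = foldr (\<lambda>k g. A k \<circ> g) xs id \<circ> f"
  by (induction xs) (auto simp: fun_eq_iff)

lemma F_map_Nil: "F_map l [] = id" by (simp add: F_map_def)

lemma F_map_snoc: "F_map l (w @ [s]) z = F_map l w (s + z / of_nat (l (Suc (length w))))"
proof -
  have "F_map l (w @ [s]) = foldr (\<lambda>k g. simil (l (Suc k)) ((w @ [s]) ! k) \<circ> g) [0..<length w]
      (simil (l (Suc (length w))) s)"
    by (simp add: F_map_def)
  also have "\<dots> = foldr (\<lambda>k g. simil (l (Suc k)) (w ! k) \<circ> g) [0..<length w]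
      (simil (l (Suc (length w))) s)"
    by (rule foldr_cong) (auto simp: nth_append)
  also have "\<dots> = F_map l w \<circ> simil (l (Suc (length w))) s"
    unfolding F_map_def by (rule foldr_comp_id)
  finally show ?thesis by (simp add: simil_def)
qed

lemma F_map_affine: "F_map l w z = ctr w + of_real (h (length w)) * z"
proof (induction w arbitrary: z rule: rev_induct)
  case Nil then show ?case by (simp add: ctr_def F_map_Nil h_0)
next
  case (snoc s w)
  show ?case unfolding ctr_def[of "w @ [s]"] F_map_snoc snoc by (simp add: h_Suc distrib_left)
qed

lemma ctr_Nil: "ctr [] = 0" by (simp add: ctr_def F_map_Nil)
lemma ctr_snoc: "ctr (w @ [s]) = ctr w + of_real (h (length w)) * s"
  unfolding ctr_def[of "w @ [s]"] F_map_snoc by (simp add: F_map_affine)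

lemma W_0: "W 0 = {[]}" by (auto simp: W_set_def)
lemma W_Suc: "W (Suc n) = (\<lambda>(w, s). w @ [s]) ` (W n \<times> S_set (l (Suc n)))"
proof
  show "W (Suc n) \<subseteq> (\<lambda>(w, s). w @ [s]) ` (W n \<times> S_set (l (Suc n)))"
  proof
    fix w assume w: "w \<in> W (Suc n)"
    then have len: "length w = Suc n" and lts: "\<forall>k<Suc n. w ! k \<in> S_set (l (Suc k))" by (auto simp: W_set_def)
    then have eq: "w = butlast w @ [last w]" by (intro append_butlast_last_id[symmetric]) auto
    have "butlast w \<in> W n" using len lts by (auto simp: W_set_def nth_butlast)
    moreover have "last w \<in> S_set (l (Suc n))"
      using len lts by (subst last_conv_nth) auto
    ultimately show "w \<in> (\<lambda>(w, s). w @ [s]) ` (W n \<times> S_set (l (Suc n)))" using eq by force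
  qed
qed (auto simp: W_set_def nth_append less_Suc_eq)

lemma W_SucE:
  assumes "w \<in> W (Suc n)" obtains v s where "w = v @ [s]" "v \<in> W n" "s \<in> S_set (l (Suc n))"
  using assms by (auto simp: W_Suc)
lemma W_snoc: "v \<in> W n \<Longrightarrow> s \<in> S_set (l (Suc n)) \<Longrightarrow> v @ [s] \<in> W (Suc n)"
  by (auto simp: W_Suc)
lemma W_length: "w \<in> W n \<Longrightarrow> length w = n" by (simp add: W_set_def)
lemma finite_W: "finite (W n)"
  by (induction n) (auto simp: W_0 W_Suc finite_S_set)

lemma sum_W_Suc:
  fixes f :: "_ \<Rightarrow> 'b :: comm_monoid_add"
  shows "(\<Sum>w\<in>W (Suc n). f w) = (\<Sum>w\<in>W n. \<Sum>s\<in>S_set (l (Suc n)). f (w @ [s]))"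
proof -
  have "inj_on (\<lambda>(w, s). w @ [s]) (W n \<times> S_set (l (Suc n)))" by (auto simp: inj_on_def)
  then show ?thesis unfolding W_Suc
    by (subst sum.reindex) (auto simp: sum.cartesian_product case_prod_beta)
qed

lemma card_W: "real (card (W n)) = 1 / ps n"
proof (induction n)
  case (Suc n)
  have "real (card (W (Suc n))) = (\<Sum>w\<in>W (Suc n). 1)" by simp
  also have "\<dots> = real (card (W n)) * (2 * real (l (Suc n)) - 1)"
    unfolding sum_W_Suc using card_S_set[OF l_odd[of n]] by simp
  finally show ?case using Suc by (simp add: ps_Suc)
qed (simp add: W_0 ps_0)

lemma image_K_0: "F_map l w ` K_0 = box w"
proof
  show "F_map l w ` K_0 \<subseteq> box w"
    using h_pos[of "length w"] by (auto simp: K_0_eq box_def F_map_affine norm1_scale)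
  show "box w \<subseteq> F_map l w ` K_0"
  proof
    fix z assume z: "z \<in> box w"
    let ?y = "of_real (1 / h (length w)) * (z - ctr w)"
    have "norm1 ?y \<le> 1" using z h_pos[of "length w"] unfolding norm1_scale by (simp add: box_def)
    moreover have "F_map l w ?y = z" using h_pos[of "length w"] by (simp add: F_map_affine)
    ultimately show "z \<in> F_map l w ` K_0" unfolding K_0_eq by force
  qed
qed

lemma cell_eq: "cell l w = box w \<inter> K" by (simp add: cell_def image_K_0)

lemma box_snoc_subset:
  assumes "v \<in> W n" "s \<in> S_set (l (Suc n))" shows "box (v @ [s]) \<subseteq> box v"
proof
  fix z assume z: "z \<in> box (v @ [s])"
  have len: "length v = n" using assms W_length by simp
  have "norm1 (z - ctr v) \<le> norm1 (z - ctr (v @ [s])) + norm1 (of_real (h n) * s)"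
    using norm1_triangle[of "z - ctr (v @ [s])" "of_real (h n) * s"] by (simp add: ctr_snoc len)
  also have "\<dots> \<le> h (Suc n) + h n * (1 - 1 / real (l (Suc n)))"
    using z S_set_norm1[OF l_odd assms(2)] h_pos[of n] unfolding norm1_scale
    by (intro add_mono) (auto simp: box_def len)
  also have "\<dots> = h n" using l_pos[of "Suc n"] by (simp add: h_Suc field_simps)
  finally show "z \<in> box v" by (simp add: box_def len)
qed

text \<open>Since \<open>h n\<close> is an integer multiple of \<open>h (Suc n)\<close>, the lattice
  of one level is contained in that of the next, and a letter displaces the center by a vector of
  the finer lattice.\<close>

lemma ctr_lattice:
  assumes "w \<in> W n"
  obtains a b :: int where "crd_x (ctr w) = 2 * h n * a" "crd_y (ctr w) = 2 * h n * b"
proof -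
  have "\<exists>(a::int) (b::int). crd_x (ctr w) = 2 * h n * a \<and> crd_y (ctr w) = 2 * h n * b"
    using assms
  proof (induction n arbitrary: w)
    case 0 then show ?case by (auto simp: W_0 ctr_Nil crd_0 intro!: exI[of _ 0])
  next
    case (Suc n)
    then obtain v s where w: "w = v @ [s]" "v \<in> W n" "s \<in> S_set (l (Suc n))" by (auto elim: W_SucE)
    obtain a b :: int where ab: "crd_x (ctr v) = 2 * h n * a" "crd_y (ctr v) = 2 * h n * b"
      using Suc.IH[OF w(2)] by blast
    obtain c d :: int where cd: "crd_x s = 2 / real (l (Suc n)) * c" "crd_y s = 2 / real (l (Suc n)) * d"
      using S_set_lattice[OF w(3)] by blast
    have "crd_x (ctr w) = 2 * h (Suc n) * of_int (int (l (Suc n)) * a + c)"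
      "crd_y (ctr w) = 2 * h (Suc n) * of_int (int (l (Suc n)) * b + d)"
      unfolding w(1) ctr_snoc crd_add crd_scale W_length[OF w(2)] ab cd
      using l_pos[of "Suc n"] by (simp_all add: h_Suc field_simps)
    then show ?case by blast
  qed
  then show ?thesis using that by blast
qed

section \<open>Adjacency of cells\<close>

lemma int_dirs:
  fixes a b :: int
  assumes "\<bar>a\<bar> + \<bar>b\<bar> = 1" shows "of_real (of_int a) * q_pt 1 + of_real (of_int b) * q_pt 2 \<in> dirs"
proof -
  have "(a, b) \<in> {(1,0),(0,1),(-1,0),(0,-1)}" using assms by auto
  then show ?thesis by (auto simp: dirs_eq q_pt_3 q_pt_4)
qed

text \<open>If two cells are adjacent along \<open>e\<close>, then only their extreme children in that direction are
  close to each other.\<close>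

lemma near_children:
  assumes v: "v \<in> W n" "v' \<in> W n" and st: "s \<in> S_set (l (Suc n))" "t \<in> S_set (l (Suc n))"
    and e: "e \<in> dirs" "ctr v' = ctr v + of_real (2 * h n) * e"
    and xy: "x \<in> box (v @ [s])" "y \<in> box (v' @ [t])" "norm1 (x - y) < 2 * h (Suc n)"
  shows "s = of_real (1 - 1 / real (l (Suc n))) * e" "t = of_real (1 - 1 / real (l (Suc n))) * (- e)"
    "ctr (v' @ [t]) = ctr (v @ [s]) + of_real (2 * h (Suc n)) * e"
proof -
  define m where "m = real (l (Suc n))"
  have m: "m > 0" "h (Suc n) = h n / m" using l_pos[of "Suc n"] by (auto simp: m_def h_Suc)
  have len: "length v = n" "length v' = n" using v W_length by auto
  have bx: "norm1 (x - ctr (v @ [s])) \<le> h (Suc n)" "norm1 (y - ctr (v' @ [t])) \<le> h (Suc n)"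
    using xy len by (auto simp: box_def)
  have me: "- e \<in> dirs" by (rule dirs_minus[OF e(1)])
  have d: "ctr (v' @ [t]) - ctr (v @ [s]) = of_real (2 * h n) * e + of_real (h n) * (t - s)"
    by (simp add: e(2) ctr_snoc len algebra_simps)
  have along_st: "along e s \<le> 1 - 1 / m" "along (-e) t \<le> 1 - 1 / m"
    using along_le[OF e(1), of s] along_le[OF me, of t] S_set_norm1[OF l_odd st(1)]
      S_set_norm1[OF l_odd st(2)] by (auto simp: m_def)
  have "along e (y - x) \<le> norm1 (x - y)" using along_le[OF e(1), of "y - x"] norm1_minus[of y x] by simp
  then have "along e (y - x) < 2 * h (Suc n)" using xy by simp
  moreover have "along e (y - x) = along e (y - ctr (v' @ [t])) + along e (ctr (v' @ [t]) - ctr (v @ [s])) - along e (x - ctr (v @ [s]))"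
    by (simp add: along_diff)
  moreover have "\<bar>along e (y - ctr (v' @ [t]))\<bar> \<le> h (Suc n)" "\<bar>along e (x - ctr (v @ [s]))\<bar> \<le> h (Suc n)"
    using along_le[OF e(1)] bx order_trans by blast+
  \<comment> \<open>Both boxes have radius \<open>h (Suc n)\<close>, which gives the bound
    \<open>4 * h (Suc n)\<close>. Two end letters facing each other put the centers
    \<open>2 * h (Suc n)\<close> apart along \<open>e\<close>; a single other letter already makes
    this at least \<open>4 * h (Suc n)\<close>.\<close>
  ultimately have "along e (ctr (v' @ [t]) - ctr (v @ [s])) < 4 * h (Suc n)" by linarith
  then have "2 * h n + h n * (along e t - along e s) < h n * (4 / m)"
    unfolding d along_add along_scale along_diff along_self[OF e(1)] m by (simp add: mult.commute)
  then have "h n * (2 + along e t - along e s) < h n * (4 / m)" by (simp add: algebra_simps)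
  then have "2 + along e t - along e s < 4 / m"
    using h_pos[of n] by (simp only: mult_less_cancel_left_pos)
  then have lt: "2 - along (-e) t - along e s < 4 / m" by (simp add: along_minus_e)
  have r: "3 / m = 3 * (1 / m)" "4 / m = 4 * (1 / m)" by simp_all
  show s: "s = of_real (1 - 1 / real (l (Suc n))) * e"
  proof (rule ccontr)
    assume "s \<noteq> of_real (1 - 1 / real (l (Suc n))) * e"
    then have "along e s \<le> 1 - 3 / m"
      using S_set_along_end[OF l_odd st(1) e(1)] by (simp add: m_def)
    then show False using lt along_st r by linarith
  qed
  show t: "t = of_real (1 - 1 / real (l (Suc n))) * (-e)"
  proof (rule ccontr)
    assume "t \<noteq> of_real (1 - 1 / real (l (Suc n))) * (-e)"
    then have "along (-e) t \<le> 1 - 3 / m"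
      using S_set_along_end[OF l_odd st(2) me] by (simp add: m_def)
    then show False using lt along_st r by linarith
  qed
  have ts: "t - s = of_real (- 2 * (1 - 1 / m)) * e"
    unfolding s t m_def by (simp add: algebra_simps)
  have "ctr (v' @ [t]) - ctr (v @ [s]) = of_real (2 * h (Suc n)) * e"
    unfolding d ts m(2) using m(1) by (simp add: field_simps)
  then show "ctr (v' @ [t]) = ctr (v @ [s]) + of_real (2 * h (Suc n)) * e" by (simp add: algebra_simps)
qed

text \<open>By induction: two cells of the same parent are equal, adjacent or well separated, and for
  adjacent parents the previous lemma applies.\<close>

lemma near_cells:
  assumes "w \<in> W n" "w' \<in> W n" "x \<in> box w" "y \<in> box w'" "n = 0 \<or> norm1 (x - y) < 2 * h n"
  shows "w = w' \<or> (\<exists>e\<in>dirs. ctr w' = ctr w + of_real (2 * h n) * e)"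
  using assms
proof (induction n arbitrary: w w')
  case 0 then show ?case by (auto simp: W_0)
next
  case (Suc n)
  obtain v s where w: "w = v @ [s]" "v \<in> W n" "s \<in> S_set (l (Suc n))"
    using Suc.prems(1) by (auto elim: W_SucE)
  obtain v' t where w': "w' = v' @ [t]" "v' \<in> W n" "t \<in> S_set (l (Suc n))"
    using Suc.prems(2) by (auto elim: W_SucE)
  define m where "m = real (l (Suc n))"
  have m: "m > 0" "h (Suc n) = h n / m" using l_pos[of "Suc n"] by (auto simp: m_def h_Suc)
  have len: "length v = n" "length v' = n" using w w' W_length by auto
  have xy: "norm1 (x - y) < 2 * h (Suc n)" using Suc.prems(5) by simp
  have bx: "norm1 (x - ctr w) \<le> h (Suc n)" "norm1 (y - ctr w') \<le> h (Suc n)"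
    using Suc.prems W_length[OF Suc.prems(1)] W_length[OF Suc.prems(2)] by (auto simp: box_def)
  have "x \<in> box v" "y \<in> box v'" using box_snoc_subset w w' Suc.prems by blast+
  moreover have "norm1 (x - y) < 2 * h n" using xy h_Suc_le[of n] h_pos[of "Suc n"] by simp
  ultimately consider "v = v'" | e where "e \<in> dirs" "ctr v' = ctr v + of_real (2 * h n) * e"
    using Suc.IH[OF w(2) w'(2)] by blast
  then show ?case
  proof cases
    case 1
    have d: "ctr w' - ctr w = of_real (h n) * (t - s)"
      by (simp add: w(1) w'(1) 1 ctr_snoc len algebra_simps)
    obtain a b :: int where ab: "crd_x s = 2 / m * a" "crd_y s = 2 / m * b"
      using S_set_lattice[OF w(3)] by (auto simp: m_def)
    obtain c d :: int where cd: "crd_x t = 2 / m * c" "crd_y t = 2 / m * d"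
      using S_set_lattice[OF w'(3)] by (auto simp: m_def)
    have ts: "crd_x (t - s) = 2 / m * of_int (c - a)" "crd_y (t - s) = 2 / m * of_int (d - b)"
      by (simp_all add: crd_diff ab cd algebra_simps diff_divide_distrib)
    \<comment> \<open>Siblings differ by a lattice vector. If its l1 length is 2 or more, the
      centers are \<open>4 * h (Suc n)\<close> apart, too far for two radii and a gap below
      \<open>2 * h (Suc n)\<close>.\<close>
    consider "c = a \<and> d = b" | "\<bar>c - a\<bar> + \<bar>d - b\<bar> = 1" | "\<bar>c - a\<bar> + \<bar>d - b\<bar> \<ge> 2" by linarith
    then show ?thesis
    proof cases
      case A: 1
      then have "s = t" using ab cd by (intro crd_eqI) auto
      then show ?thesis using w(1) w'(1) 1 by simp
    next
      case 2
      define e where "e = of_real (of_int (c - a)) * q_pt 1 + of_real (of_int (d - b)) * q_pt 2"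
      have e: "e \<in> dirs" unfolding e_def by (rule int_dirs[OF 2])
      have "t - s = of_real (2 / m) * e"
        unfolding e_def by (rule crd_eqI) (simp_all only: ts crd_scale crd_add crd_q, simp_all)
      then have "ctr w' - ctr w = of_real (2 * h (Suc n)) * e" unfolding d m by simp
      then have "ctr w' = ctr w + of_real (2 * h (Suc n)) * e" by (simp add: algebra_simps)
      then show ?thesis using e by blast
    next
      case 3
      have "norm1 (t - s) = 2 / m * of_int (\<bar>c - a\<bar> + \<bar>d - b\<bar>)"
        using m(1) by (simp only: norm1_def ts abs_mult abs_divide abs_numeral abs_of_pos of_int_add of_int_abs distrib_left)
      also have "\<dots> \<ge> 2 / m * 2" using 3 m
        by (intro mult_left_mono) (metis of_int_le_iff of_int_numeral, simp)
      finally have "4 / m \<le> norm1 (t - s)" by simp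
      then have "h n * (4 / m) \<le> h n * norm1 (t - s)" using h_pos[of n] by (intro mult_left_mono) auto
      then have "4 * h (Suc n) \<le> norm1 (ctr w' - ctr w)"
        unfolding d norm1_scale m using h_pos[of n] by (simp add: mult.commute)
      moreover have "norm1 (ctr w' - ctr w) \<le> norm1 (y - ctr w') + norm1 (x - y) + norm1 (x - ctr w)"
        using norm1_triangle[of "ctr w' - y" "(y - x) + (x - ctr w)"] norm1_triangle[of "y - x" "x - ctr w"]
          norm1_minus[of "ctr w'" y] norm1_minus[of y x] by simp
      ultimately show ?thesis using xy bx by simp
    qed
  next
    case (2 e)
    then show ?thesis
      using near_children[OF w(2) w'(2) w(3) w'(3) 2] Suc.prems(3,4) xy
      unfolding w(1) w'(1) by blast
  qed
qed

lemma ctr_in_box: "ctr w \<in> box w"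
  using h_pos[of "length w"] by (simp add: box_def)

lemma corner_in_box: "e \<in> dirs \<Longrightarrow> ctr w + of_real (h (length w)) * e \<in> box w"
  using h_pos[of "length w"] dirs_norm(1) by (simp add: box_def norm1_scale)

text \<open>A common center lies in both boxes, so the cells are equal or adjacent, and adjacent
  cells have different centers. This allows cells to be counted by lattice points.\<close>

lemma ctr_inj: "inj_on ctr (W n)"
proof (rule inj_onI)
  fix w w' assume *: "w \<in> W n" "w' \<in> W n" "ctr w = ctr w'"
  have "w = w' \<or> (\<exists>e\<in>dirs. ctr w' = ctr w + of_real (2 * h n) * e)"
    by (rule near_cells[OF *(1,2) ctr_in_box ctr_in_box]) (use * h_pos in simp)
  then show "w = w'" using *(3) h_pos[of n] dirs_nonzero by auto
qed

definition verts :: "complex list \<Rightarrow> complex set" where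
  "verts w = insert (ctr w) ((\<lambda>e. ctr w + of_real (h (length w)) * e) ` dirs)"

lemma near_cells_common_vertex:
  assumes "w \<in> W n" "w' \<in> W n" "x \<in> box w" "y \<in> box w'" "n = 0 \<or> norm1 (x - y) < 2 * h n"
  obtains z where "z \<in> verts w" "z \<in> verts w'"
proof -
  consider "w = w'" | e where "e \<in> dirs" "ctr w' = ctr w + of_real (2 * h n) * e"
    using near_cells[OF assms] by blast
  then show ?thesis
  proof cases
    case 1 then show ?thesis using that[of "ctr w"] by (simp add: verts_def)
  next
    case (2 e)
    have len: "length w = n" "length w' = n" using assms W_length by auto
    have "ctr w + of_real (h n) * e \<in> verts w" using 2 by (auto simp: verts_def len)
    moreover have "ctr w' + of_real (h n) * (- e) \<in> verts w'"
      unfolding verts_def len by (rule insertI2, rule image_eqI[OF refl dirs_minus[OF 2(1)]])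
    moreover have "ctr w' + of_real (h n) * (- e) = ctr w + of_real (h n) * e" using 2 by simp
    ultimately show ?thesis using that by metis
  qed
qed

section \<open>Points and vertices of the fractal\<close>

lemma in_K_iff: "x \<in> K \<longleftrightarrow> (\<forall>n. \<exists>w\<in>W n. x \<in> box w)"
proof
  assume x: "x \<in> K"
  have pos: "\<exists>w\<in>W n. x \<in> box w" if "n \<ge> 1" for n
    using x that unfolding vicsek_def image_K_0 by auto
  show "\<forall>n. \<exists>w\<in>W n. x \<in> box w"
  proof
    fix n show "\<exists>w\<in>W n. x \<in> box w"
    proof (cases n)
      \<comment> \<open>The intersection defining \<open>K\<close> starts at level 1; level 0 is
        recovered because its box contains every box of level 1.\<close>
      case 0
      obtain w where w: "w \<in> W (Suc 0)" "x \<in> box w" using pos[of "Suc 0"] by auto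
      then obtain v s where "w = v @ [s]" "v \<in> W 0" "s \<in> S_set (l (Suc 0))" by (auto elim: W_SucE)
      then show ?thesis using box_snoc_subset w 0 by blast
    qed (use pos in auto)
  qed
qed (auto simp: vicsek_def image_K_0)

lemma box_down:
  assumes "w \<in> W n" "z \<in> box w" "m \<le> n" shows "\<exists>v\<in>W m. z \<in> box v"
  using assms(3,1,2)
proof (induction arbitrary: w rule: dec_induct)
  case base then show ?case by blast
next
  case (step n)
  then obtain v s where "w = v @ [s]" "v \<in> W n" "s \<in> S_set (l (Suc n))" by (auto elim: W_SucE)
  then show ?case using box_snoc_subset step by blast
qed

lemma center_refine:
  assumes "w \<in> W n" "n \<le> k" shows "\<exists>v\<in>W k. ctr v = ctr w"
  using assms(2,1)
proof (induction arbitrary: w rule: dec_induct)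
  case (step k)
  then obtain v where "v \<in> W k" "ctr v = ctr w" by blast
  then show ?case by (intro bexI[of _ "v @ [0]"]) (auto simp: ctr_snoc intro: W_snoc S_set_0)
qed blast

lemma corner_snoc:
  assumes "w \<in> W n"
  shows "ctr (w @ [of_real (1 - 1 / real (l (Suc n))) * e]) + of_real (h (Suc n)) * e = ctr w + of_real (h n) * e"
proof -
  have "h n * (1 - 1 / real (l (Suc n))) + h (Suc n) = h n"
    using l_pos[of "Suc n"] by (simp add: h_Suc field_simps)
  then have "of_real (h n) * (of_real (1 - 1 / real (l (Suc n))) * e) + of_real (h (Suc n)) * e = of_real (h n) * e"
    by (metis (no_types, lifting) mult.assoc distrib_right of_real_add of_real_mult)
  then show ?thesis by (simp add: ctr_snoc W_length[OF assms] add.assoc)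
qed

lemma corner_refine:
  assumes "w \<in> W n" "n \<le> k" "e \<in> dirs"
  shows "\<exists>v\<in>W k. ctr v + of_real (h k) * e = ctr w + of_real (h n) * e"
  using assms(2,1)
proof (induction arbitrary: w rule: dec_induct)
  case (step k)
  then obtain v where v: "v \<in> W k" "ctr v + of_real (h k) * e = ctr w + of_real (h n) * e" by blast
  then have "v @ [of_real (1 - 1 / real (l (Suc k))) * e] \<in> W (Suc k)"
    using W_snoc[OF v(1) S_set_end[OF l_odd assms(3)]] by simp
  then show ?case using corner_snoc[OF v(1), of e] v(2) by metis
qed blast

text \<open>Appending 0 preserves the center, and appending the end letter of an arm preserves the
  corner of that arm. So a vertex lies in a box of every finer level, and nesting gives the coarser
  ones.\<close>

lemma verts_in_K: assumes "w \<in> W n" shows "verts w \<subseteq> K"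
proof
  fix z assume z: "z \<in> verts w"
  have "\<exists>v\<in>W k. z \<in> box v" if "n \<le> k" for k
    using z center_refine[OF assms that] corner_refine[OF assms that] ctr_in_box corner_in_box W_length
    unfolding verts_def W_length[OF assms] by (smt (verit, ccfv_threshold) image_iff insert_iff)
  then have "\<exists>v\<in>W k. z \<in> box v" for k
    using box_down[of _ "max n k" z k] by (meson max.cobounded1 max.cobounded2)
  then show "z \<in> K" by (simp add: in_K_iff)
qed

lemma V_set_verts: "V_set l n = (\<Union>w\<in>W n. verts w)"
proof -
  have "{0..4::nat} = insert 0 {1..4}" by auto
  then have "q_pt ` {0..4} = insert 0 dirs" by (simp add: dirs_def q_pt_0)
  then have "F_map l w ` (q_pt ` {0..4}) = verts w" for w
    by (auto simp: verts_def F_map_affine)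
  then show ?thesis by (simp add: V_set_def)
qed

text \<open>In units of \<open>2 * h n\<close> the centers have integer coordinates, and each
  coordinate is confined to a window of four integers, hence 16 = 4 * 4. That the count is uniform
  in \<open>n\<close> and \<open>x\<close> controls the mass of balls.\<close>

lemma card_near_cells:
  "card {w\<in>W n. \<bar>crd_x (ctr w - x)\<bar> < 3 * h n \<and> \<bar>crd_y (ctr w - x)\<bar> < 3 * h n} \<le> 16" (is "card ?A \<le> 16")
proof -
  define t where "t = (\<lambda>y. \<lfloor>y / (2 * h n)\<rfloor>)"
  let ?R = "\<lambda>y. {t y - 1 .. t y + 2}"
  let ?g = "\<lambda>w. (\<lfloor>crd_x (ctr w) / (2 * h n)\<rfloor>, \<lfloor>crd_y (ctr w) / (2 * h n)\<rfloor>)"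
  have key: "a \<in> ?R y" if "\<bar>2 * h n * of_int a - y\<bar> < 3 * h n" for a :: int and y :: real
  proof -
    have "\<bar>of_int a - y / (2 * h n)\<bar> * (2 * h n) = \<bar>2 * h n * of_int a - y\<bar>"
      using h_pos[of n] by (simp add: abs_mult_pos' algebra_simps flip: abs_mult_pos)
    then have "\<bar>of_int a - y / (2 * h n)\<bar> * (2 * h n) < (3/2) * (2 * h n)" using that by simp
    then have "\<bar>of_int a - y / (2 * h n)\<bar> < 3/2" using h_pos[of n] by simp
    then have "of_int a < y / (2 * h n) + 3/2" "y / (2 * h n) - 3/2 < of_int a" by linarith+
    then show ?thesis unfolding t_def atLeastAtMost_iff by linarith
  qed
  have gx: "?g w = (a, b)" if "crd_x (ctr w) = 2 * h n * a" "crd_y (ctr w) = 2 * h n * b" for w a b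
    using that h_pos[of n] by simp
  have "inj_on ?g ?A"
  proof (rule inj_onI)
    fix w w' assume *: "w \<in> ?A" "w' \<in> ?A" "?g w = ?g w'"
    obtain a b :: int where ab: "crd_x (ctr w) = 2 * h n * a" "crd_y (ctr w) = 2 * h n * b"
      using ctr_lattice * by blast
    obtain c d :: int where cd: "crd_x (ctr w') = 2 * h n * c" "crd_y (ctr w') = 2 * h n * d"
      using ctr_lattice * by blast
    have "ctr w = ctr w'" using *(3) gx[OF ab] gx[OF cd] ab cd by (intro crd_eqI) auto
    then show "w = w'" using ctr_inj[of n] * by (auto dest: inj_onD)
  qed
  moreover have "?g ` ?A \<subseteq> ?R (crd_x x) \<times> ?R (crd_y x)"
  proof
    fix y assume "y \<in> ?g ` ?A"
    then obtain w where w: "w \<in> ?A" "y = ?g w" by blast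
    obtain a b :: int where ab: "crd_x (ctr w) = 2 * h n * a" "crd_y (ctr w) = 2 * h n * b"
      using ctr_lattice w by blast
    have "a \<in> ?R (crd_x x)" "b \<in> ?R (crd_y x)"
      using w(1) ab by (auto simp only: mem_Collect_eq crd_diff intro!: key)
    then show "y \<in> ?R (crd_x x) \<times> ?R (crd_y x)" using gx[OF ab] w(2) by simp
  qed
  ultimately have "card ?A \<le> card (?R (crd_x x) \<times> ?R (crd_y x))"
    by (intro card_inj_on_le) auto
  also have "\<dots> = 16" by (simp add: card_cartesian_product)
  finally show ?thesis .
qed

lemma continuous_norm1: "continuous_on UNIV norm1"
  unfolding norm1_def crd_x_def crd_y_def by (intro continuous_intros)

lemma closed_box: "closed (box w)"
proof -
  have "closed {z. norm1 (z - ctr w) \<le> h (length w)}"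
    by (intro closed_Collect_le continuous_intros continuous_on_compose2[OF continuous_norm1]) auto
  then show ?thesis by (simp add: box_def)
qed

lemma K_subset: "K \<subseteq> cball 0 1"
proof
  fix x assume "x \<in> K"
  then have "\<exists>w\<in>W 0. x \<in> box w" using in_K_iff[of x] by blast
  then have "x \<in> box []" by (simp add: W_0)
  then have "norm1 x \<le> 1" by (simp add: box_def ctr_Nil h_0)
  then show "x \<in> cball 0 1" using cmod_le_norm1[of x] by simp
qed

lemma compact_K: "compact K"
proof -
  have "K = (\<Inter>n. \<Union>w\<in>W n. box w)" using in_K_iff by auto
  then have "closed K" using finite_W closed_box by (auto intro!: closed_INT closed_UN)
  then show ?thesis using K_subset bounded_cball bounded_subset compact_eq_bounded_closed by blast
qed

lemma diameter_K: "diameter K = 2"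
proof (rule antisym)
  show "diameter K \<le> 2"
  proof (rule diameter_le)
    show "cmod (x - y) \<le> 2" if "x \<in> K" "y \<in> K" for x y
    proof -
      have "cmod x \<le> 1" "cmod y \<le> 1" using that K_subset by auto
      then show ?thesis using norm_triangle_ineq4[of x y] by simp
    qed
    show "K \<noteq> {} \<or> (0::real) \<le> 2" by simp
  qed
  have "q_pt 1 \<in> K" "- q_pt 1 \<in> K"
    using verts_in_K[of "[]" 0] by (auto simp: W_0 verts_def ctr_Nil h_0 dirs_eq q_pt_3)
  then have "dist (q_pt 1) (- q_pt 1) \<le> diameter K"
    using diameter_bounded_bound compact_imp_bounded[OF compact_K] by blast
  moreover have "dist (q_pt 1) (- q_pt 1) = 2"
    using dirs_norm(2)[of "q_pt 1"] by (simp add: dist_norm dirs_eq)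
  ultimately show "2 \<le> diameter K" by simp
qed

lemma box_dist: 
  assumes "x \<in> box w" "y \<in> box w" shows "dist x y \<le> 2 * h (length w)"
proof -
  have "norm1 (x - y) \<le> norm1 (x - ctr w) + norm1 (y - ctr w)"
    using norm1_triangle[of "x - ctr w" "ctr w - y"] norm1_minus[of y "ctr w"] by simp
  then show ?thesis using assms cmod_le_norm1[of "x - y"] by (simp add: dist_norm box_def)
qed

lemma neighbour_box_dist: 
  assumes "x \<in> box w" "y \<in> box w'" "ctr w' = ctr w + of_real (2 * h n) * e" "e \<in> dirs" "length w = n" "length w' = n"
  shows "dist x y \<le> 4 * h n"
proof -
  have "norm1 (ctr w - ctr w') = 2 * h n" 
  proof -
    have "ctr w - ctr w' = of_real (2 * h n) * (- e)" using assms(3) by simp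
    then show ?thesis using h_pos[of n] dirs_norm(1)[OF dirs_minus[OF assms(4)]] by (simp only: norm1_scale)
  qed
  moreover have "norm1 (x - y) \<le> norm1 (x - ctr w) + norm1 (ctr w - ctr w') + norm1 (y - ctr w')"
    using norm1_triangle[of "x - ctr w" "ctr w - y"] norm1_triangle[of "ctr w - ctr w'" "ctr w' - y"] norm1_minus[of y "ctr w'"] by simp
  ultimately show ?thesis using assms cmod_le_norm1[of "x - y"] by (simp add: dist_norm box_def)
qed

end

section \<open>Discrete energies\<close>

text \<open>Jensen's inequality, applied to the positive terms only and then weakened from the
  number of these terms to \<open>N\<close>.\<close>

lemma power_mean_sum:
  fixes a :: "'i \<Rightarrow> real"
  assumes "finite I" "\<And>i. i \<in> I \<Longrightarrow> 0 \<le> a i" "1 \<le> p" "real (card I) \<le> N"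
  shows "(\<Sum>i\<in>I. a i) powr p \<le> N powr (p - 1) * (\<Sum>i\<in>I. a i powr p)"
proof -
  define J where "J = {i\<in>I. a i > 0}"
  have J: "finite J" "J \<subseteq> I" using assms(1) by (auto simp: J_def)
  have sI: "(\<Sum>i\<in>I. a i) = (\<Sum>i\<in>J. a i)"
    by (rule sum.mono_neutral_right) (use assms J in \<open>auto simp: J_def less_le\<close>)
  show ?thesis
  proof (cases "J = {}")
    case True
    then show ?thesis unfolding sI by (simp add: sum_nonneg)
  next
    case False
    define n where "n = real (card J)"
    have n: "n > 0" using False J by (simp add: n_def card_gt_0_iff)
    have "(\<Sum>i\<in>J. (1/n) *\<^sub>R a i) powr p \<le> (\<Sum>i\<in>J. (1/n) * a i powr p)"
      by (rule convex_on_sum[OF J(1) False powr_convex[OF assms(3)]]) (use n in \<open>auto simp: n_def J_def\<close>)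
    then have *: "((\<Sum>i\<in>J. a i) / n) powr p \<le> (\<Sum>i\<in>J. a i powr p) / n"
      by (simp add: sum_divide_distrib[symmetric] flip: sum_distrib_left)
    have nonneg: "0 \<le> (\<Sum>i\<in>J. a i)" by (rule sum_nonneg) (simp add: J_def)
    have "(\<Sum>i\<in>J. a i) powr p = n powr p * ((\<Sum>i\<in>J. a i) / n) powr p"
      using n nonneg by (simp add: powr_mult[symmetric])
    also have "\<dots> \<le> n powr p * ((\<Sum>i\<in>J. a i powr p) / n)"
      by (rule mult_left_mono[OF *]) simp
    also have "\<dots> = n powr (p - 1) * (\<Sum>i\<in>J. a i powr p)"
      using n by (simp add: powr_diff)
    also have "\<dots> \<le> N powr (p - 1) * (\<Sum>i\<in>I. a i powr p)"
    proof (rule mult_mono)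
      have "n \<le> N" using card_mono[OF assms(1) J(2)] assms(4) by (simp add: n_def)
      then show "n powr (p - 1) \<le> N powr (p - 1)" using n assms(3) by (intro powr_mono2) auto
      show "(\<Sum>i\<in>J. a i powr p) \<le> (\<Sum>i\<in>I. a i powr p)" using J assms(1) by (intro sum_mono2) auto
    qed (auto intro: sum_nonneg)
    finally show ?thesis unfolding sI .
  qed
qed

text \<open>An arm consists of an odd number of steps. The first one belongs to the central child,
  and the others pair up into the two steps on either side of the center of the \<open>k\<close>-th
  child.\<close>

lemma sum_odd_split:
  fixes f :: "nat \<Rightarrow> real"
  shows "(\<Sum>i<Suc (2*M). f i) = f 0 + (\<Sum>k=1..M. f (2*k-1) + f (2*k))"
proof (induction M)
  case (Suc M)
  then show ?case by simp
qed simp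

locale vicsek_energy = vicsek_scales +
  fixes p L :: real
  assumes p: "1 < p" and l_le: "\<And>n. real (l n) \<le> L"
begin

lemma L_ge3: "3 \<le> L" using l_le[of "Suc 0"] l_ge3[of 0] by simp

text \<open>\<open>eW u w\<close> is the energy on the four edges of the cell \<open>w\<close>, \<open>GW u w\<close> that on the edges of its
  children, and \<open>en u n\<close> the total over level \<open>n\<close>, which is half of the sum over ordered edges.\<close>

definition eW :: "(complex \<Rightarrow> real) \<Rightarrow> complex list \<Rightarrow> real" where
  "eW u w = (\<Sum>e\<in>dirs. \<bar>u (ctr w) - u (ctr w + of_real (h (length w)) * e)\<bar> powr p)"
definition GW :: "(complex \<Rightarrow> real) \<Rightarrow> complex list \<Rightarrow> real" where
  "GW u w = (\<Sum>s\<in>S_set (l (Suc (length w))). eW u (w @ [s]))"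
definition en :: "(complex \<Rightarrow> real) \<Rightarrow> nat \<Rightarrow> real" where
  "en u n = (\<Sum>w\<in>W n. eW u w)"

lemma eW_nonneg: "0 \<le> eW u w" by (simp add: eW_def sum_nonneg)
lemma GW_nonneg: "0 \<le> GW u w" by (simp add: GW_def sum_nonneg eW_nonneg)
lemma en_nonneg: "0 \<le> en u w" by (simp add: en_def sum_nonneg eW_nonneg)

lemma en_Suc: "en u (Suc n) = (\<Sum>w\<in>W n. GW u w)"
  unfolding en_def sum_W_Suc by (rule sum.cong) (auto simp: GW_def W_length)

text \<open>A parity argument: in units of \<open>h n\<close> a center has two even coordinates, and
  a corner differs from it by one unit in one of them. So the parity of \<open>i + j\<close> tells
  centers from corners, whichever cell the vertex is viewed from.\<close>

lemma verts_lattice: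
  assumes "w \<in> W n" "z \<in> verts w"
  obtains i j :: int where "crd_x z = h n * i" "crd_y z = h n * j" "even (i + j) \<Longrightarrow> z = ctr w"
    "z = ctr w \<Longrightarrow> even (i + j)"
proof -
  obtain a b :: int where ab: "crd_x (ctr w) = 2 * h n * a" "crd_y (ctr w) = 2 * h n * b"
    using ctr_lattice[OF assms(1)] by blast
  consider "z = ctr w" | e where "e \<in> dirs" "z = ctr w + of_real (h n) * e"
    using assms by (auto simp: verts_def W_length)
  then show ?thesis
  proof cases
    case 1
    show ?thesis by (rule that[of "2 * a" "2 * b"]) (use ab 1 in auto)
  next
    case (2 e)
    have ne: "z \<noteq> ctr w" using 2 h_pos[of n] dirs_nonzero by auto
    have c: "crd_x z = h n * (2 * a + crd_x e)" "crd_y z = h n * (2 * b + crd_y e)"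
      unfolding 2(2) crd_add crd_scale ab by (simp_all add: algebra_simps)
    have "\<exists>i j::int. crd_x e = i \<and> crd_y e = j \<and> odd (i + j)"
    proof -
      have "\<lfloor>- 1 :: real\<rfloor> = - 1" by linarith
      then show ?thesis
        using 2(1) by (intro exI[of _ "\<lfloor>crd_x e\<rfloor>"] exI[of _ "\<lfloor>crd_y e\<rfloor>"]) (auto simp: dirs_crd)
    qed
    then obtain i j :: int where ij: "crd_x e = i" "crd_y e = j" "odd (i + j)" by blast
    show ?thesis by (rule that[of "2 * a + i" "2 * b + j"]) (use c ij ne in auto)
  qed
qed

text \<open>Edges are defined by distance alone. Distance \<open>h n\<close> means a change of one
  unit in one lattice coordinate, hence a change of parity; so exactly one end is a center, and the
  edge is an arm of its cell.\<close>

lemma edges_eq: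
  "edges l n = (\<lambda>(w, e). (ctr w, ctr w + of_real (h n) * e)) ` (W n \<times> dirs) \<union>
     (\<lambda>(w, e). (ctr w + of_real (h n) * e, ctr w)) ` (W n \<times> dirs)" (is "_ = ?A \<union> ?B")
proof
  show "?A \<union> ?B \<subseteq> edges l n"
    using h_pos[of n] unfolding edges_def V_set_verts h_def[symmetric]
    by (auto simp: verts_def W_length dist_norm norm_mult dirs_norm)
  show "edges l n \<subseteq> ?A \<union> ?B"
  proof (clarify)
    fix x y assume "(x, y) \<in> edges l n" and nB: "(x, y) \<notin> ?B"
    then obtain w w' where w: "w \<in> W n" "x \<in> verts w" "w' \<in> W n" "y \<in> verts w'" and d: "dist x y = h n"
      by (auto simp: edges_def V_set_verts h_def)
    obtain i j :: int where ij: "crd_x x = h n * i" "crd_y x = h n * j" "even (i + j) \<Longrightarrow> x = ctr w"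
      using verts_lattice[OF w(1,2)] by blast
    obtain i' j' :: int where ij': "crd_x y = h n * i'" "crd_y y = h n * j'" "even (i' + j') \<Longrightarrow> y = ctr w'"
      using verts_lattice[OF w(3,4)] by blast
    have "(h n)\<^sup>2 * 1 = (cmod (y - x))\<^sup>2" using d by (simp add: dist_norm norm_minus_commute)
    also have "\<dots> = (h n)\<^sup>2 * of_int ((i' - i)\<^sup>2 + (j' - j)\<^sup>2)"
      unfolding cmod_crd crd_diff ij ij' by (simp add: power2_eq_square algebra_simps)
    finally have "of_int ((i' - i)\<^sup>2 + (j' - j)\<^sup>2) = (1::real)" using h_pos[of n] by simp
    then have sq: "(i' - i)\<^sup>2 + (j' - j)\<^sup>2 = 1" by linarith
    have "\<bar>k\<bar> \<le> k\<^sup>2" for k :: int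
    proof -
      have "1 * \<bar>k\<bar> \<le> \<bar>k\<bar> * \<bar>k\<bar>" if "k \<noteq> 0" using that by (intro mult_right_mono) linarith+
      then show ?thesis by (cases "k = 0") (simp_all add: power2_eq_square)
    qed
    from this[of "i' - i"] this[of "j' - j"] have "\<bar>i' - i\<bar> + \<bar>j' - j\<bar> \<le> 1" using sq by linarith
    moreover have "i' \<noteq> i \<or> j' \<noteq> j" using sq by auto
    ultimately have ab: "\<bar>i' - i\<bar> + \<bar>j' - j\<bar> = 1" by linarith
    define f where "f = of_real (of_int (i' - i)) * q_pt 1 + of_real (of_int (j' - j)) * q_pt 2"
    have f: "f \<in> dirs" unfolding f_def by (rule int_dirs[OF ab])
    have yx: "y = x + of_real (h n) * f"
      unfolding f_def by (rule crd_eqI) (simp_all only: crd_scale crd_add crd_q ij ij', simp_all add: algebra_simps)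
    show "(x, y) \<in> ?A"
    proof (cases "even (i + j)")
      case True
      then have "(x, y) = (\<lambda>(w, e). (ctr w, ctr w + of_real (h n) * e)) (w, f)" using yx ij by simp
      then show ?thesis using w f by blast
    next
      case False
      then have "even (i' + j')" using ab by (auto simp: abs_if split: if_splits) presburger+
      then have "(x, y) = (\<lambda>(w, e). (ctr w + of_real (h n) * e, ctr w)) (w', - f)" using yx ij' by simp
      then show ?thesis using nB w dirs_minus[OF f] by blast
    qed
  qed
qed

text \<open>By parity no center is a corner, so the two orientations of the arms are disjoint
  families with equal sums.\<close>

lemma sum_edges: "(\<Sum>(x, y)\<in>edges l n. \<bar>u x - u y\<bar> powr p) = 2 * en u n"
proof -
  let ?a = "\<lambda>(w, e). (ctr w, ctr w + of_real (h n) * e)"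
  let ?b = "\<lambda>(w, e). (ctr w + of_real (h n) * e, ctr w)"
  let ?f = "\<lambda>(x, y). \<bar>u x - u y\<bar> powr p"
  have inj: "inj_on ?a (W n \<times> dirs)" "inj_on ?b (W n \<times> dirs)"
    using ctr_inj[of n] h_pos[of n] by (auto simp: inj_on_def)
  have fin: "finite (W n \<times> dirs)" using finite_W dirs_card by simp
  have "?a ` (W n \<times> dirs) \<inter> ?b ` (W n \<times> dirs) = {}"
  proof (rule ccontr)
    assume "\<not> ?thesis"
    then obtain w e w' e' where *: "w \<in> W n" "w' \<in> W n" "e \<in> dirs" "e' \<in> dirs"
      "ctr w = ctr w' + of_real (h n) * e'" by auto
    then have v: "ctr w \<in> verts w" "ctr w \<in> verts w'" by (auto simp: verts_def W_length)
    obtain i j :: int where ij: "crd_x (ctr w) = h n * i" "crd_y (ctr w) = h n * j" "even (i + j)"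
      using verts_lattice[OF *(1) v(1)] by blast
    obtain i' j' :: int where ij': "crd_x (ctr w) = h n * i'" "crd_y (ctr w) = h n * j'" "even (i' + j') \<Longrightarrow> ctr w = ctr w'"
      using verts_lattice[OF *(2) v(2)] by blast
    have "i = i'" "j = j'" using ij ij' h_pos[of n] by auto
    then show False using ij ij' * h_pos[of n] dirs_nonzero by auto
  qed
  then have "(\<Sum>z\<in>edges l n. ?f z) = (\<Sum>z\<in>?a ` (W n \<times> dirs). ?f z) + (\<Sum>z\<in>?b ` (W n \<times> dirs). ?f z)"
    unfolding edges_eq using fin by (intro sum.union_disjoint) auto
  also have "(\<Sum>z\<in>?a ` (W n \<times> dirs). ?f z) = (\<Sum>(w, e)\<in>W n \<times> dirs. \<bar>u (ctr w) - u (ctr w + of_real (h n) * e)\<bar> powr p)"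
    by (subst sum.reindex[OF inj(1)]) (auto intro!: sum.cong)
  also have "(\<Sum>z\<in>?b ` (W n \<times> dirs). ?f z) = (\<Sum>(w, e)\<in>W n \<times> dirs. \<bar>u (ctr w) - u (ctr w + of_real (h n) * e)\<bar> powr p)"
    by (subst sum.reindex[OF inj(2)]) (auto intro!: sum.cong simp: abs_minus_commute)
  also have "(\<Sum>(w, e)\<in>W n \<times> dirs. \<bar>u (ctr w) - u (ctr w + of_real (h n) * e)\<bar> powr p) = en u n"
    unfolding en_def sum.cartesian_product[symmetric] by (intro sum.cong) (auto simp: eW_def W_length)
  finally show ?thesis by simp
qed

text \<open>The points \<open>x i\<close> lead along the arm from the center (\<open>i = 0\<close>)
  to the corner (\<open>i = m\<close>). Those with even index are centers of children; the steps
  \<open>2 * k - 1\<close> and \<open>2 * k\<close> are the edges of the \<open>k\<close>-th child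
  in the directions \<open>- e\<close> and \<open>e\<close>. The second claim is the power mean
  inequality for the telescoped path.\<close>

lemma arm_path:
  fixes u :: "complex \<Rightarrow> real" and w e
  defines "m \<equiv> l (Suc (length w))"
  defines "x \<equiv> \<lambda>i::nat. ctr w + of_real (h (Suc (length w)) * real i) * e"
  defines "f \<equiv> \<lambda>i::nat. \<bar>u (x (Suc i)) - u (x i)\<bar> powr p"
  assumes e: "e \<in> dirs"
  shows "(\<Sum>i<m. f i) \<le> \<bar>u (ctr (w @ [0])) - u (ctr (w @ [0]) + of_real (h (Suc (length w))) * e)\<bar> powr p
      + (\<Sum>k=1..(m - 1) div 2. eW u (w @ [of_real (2 * real k / real m) * e]))"
    and "j \<le> m \<Longrightarrow> \<bar>u (x j) - u (ctr w)\<bar> powr p \<le> real m powr (p - 1) * (\<Sum>i<m. f i)"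
proof -
  let ?M = "(m - 1) div 2"
  let ?v = "\<lambda>k::nat. w @ [of_real (2 * real k / real m) * e]"
  have m: "m = Suc (2 * ?M)" "m > 0" unfolding m_def using l_odd[of "length w"] by (auto elim: oddE)
  have hm: "h (length w) = h (Suc (length w)) * real m" using h_Suc_l by (simp add: m_def)
  have cv: "ctr (?v k) = x (2 * k)" for k
    unfolding ctr_snoc x_def hm mult.assoc[symmetric] of_real_mult[symmetric] using m(2) by simp
  have ne: "e \<noteq> - e" using dirs_nonzero[OF e] by auto
  have pair: "f (2 * k - 1) + f (2 * k) \<le> eW u (?v k)" if "k \<ge> 1" for k
  proof -
    have x1: "x (2 * k) + of_real (h (Suc (length w))) * e = x (Suc (2 * k))"
      by (simp add: x_def algebra_simps)
    have x2: "x (2 * k) + of_real (h (Suc (length w))) * (- e) = x (2 * k - 1)"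
      using that by (simp add: x_def of_nat_diff algebra_simps)
    have "Suc (2 * k - 1) = 2 * k" using that by simp
    then have "f (2 * k - 1) + f (2 * k) = (\<Sum>e'\<in>{-e, e}. \<bar>u (x (2*k)) - u (x (2*k) + of_real (h (Suc (length w))) * e')\<bar> powr p)"
      using ne x1 x2 by (simp add: f_def abs_minus_commute)
    also have "\<dots> \<le> (\<Sum>e'\<in>dirs. \<bar>u (x (2*k)) - u (x (2*k) + of_real (h (Suc (length w))) * e')\<bar> powr p)"
      using e dirs_minus dirs_card by (intro sum_mono2) auto
    also have "\<dots> = eW u (?v k)" by (simp only: eW_def cv) simp
    finally show ?thesis .
  qed
  have "(\<Sum>i<m. f i) = f 0 + (\<Sum>k=1..?M. f (2*k-1) + f (2*k))"
    using sum_odd_split[of f ?M] m(1) by simp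
  also have "\<dots> \<le> f 0 + (\<Sum>k=1..?M. eW u (?v k))"
    using pair by (intro add_left_mono sum_mono) auto
  also have "f 0 = \<bar>u (ctr (w @ [0])) - u (ctr (w @ [0]) + of_real (h (Suc (length w))) * e)\<bar> powr p"
    by (simp add: f_def x_def ctr_snoc abs_minus_commute)
  finally show "(\<Sum>i<m. f i) \<le> \<bar>u (ctr (w @ [0])) - u (ctr (w @ [0]) + of_real (h (Suc (length w))) * e)\<bar> powr p
      + (\<Sum>k=1..(m - 1) div 2. eW u (?v k))" .
  assume j: "j \<le> m"
  have "u (x j) - u (ctr w) = (\<Sum>i<j. u (x (Suc i)) - u (x i))"
    by (subst sum_lessThan_telescope) (simp add: x_def)
  then have "\<bar>u (x j) - u (ctr w)\<bar> \<le> (\<Sum>i<j. \<bar>u (x (Suc i)) - u (x i)\<bar>)" by (simp only: sum_abs)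
  also have "\<dots> \<le> (\<Sum>i<m. \<bar>u (x (Suc i)) - u (x i)\<bar>)" using j by (intro sum_mono2) auto
  finally have "\<bar>u (x j) - u (ctr w)\<bar> powr p \<le> (\<Sum>i<m. \<bar>u (x (Suc i)) - u (x i)\<bar>) powr p"
    using p by (intro powr_mono2) auto
  also have "\<dots> \<le> real m powr (p - 1) * (\<Sum>i<m. f i)"
    unfolding f_def using p by (intro power_mean_sum) auto
  finally show "\<bar>u (x j) - u (ctr w)\<bar> powr p \<le> real m powr (p - 1) * (\<Sum>i<m. f i)" .
qed

text \<open>Over the four arms the first steps add up to the energy of the central child. Of the
  other children only the two edges along the arm occur on the left.\<close>

lemma arm_path_sum:
  fixes u :: "complex \<Rightarrow> real" and w
  defines "m \<equiv> l (Suc (length w))"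
  defines "f \<equiv> \<lambda>e (i::nat). \<bar>u (ctr w + of_real (h (Suc (length w)) * real (Suc i)) * e) -
    u (ctr w + of_real (h (Suc (length w)) * real i) * e)\<bar> powr p"
  shows "(\<Sum>e\<in>dirs. \<Sum>i<m. f e i) \<le> GW u w"
proof -
  have "(\<Sum>e\<in>dirs. \<Sum>i<m. f e i) \<le> (\<Sum>e\<in>dirs. \<bar>u (ctr (w @ [0])) - u (ctr (w @ [0]) + of_real (h (Suc (length w))) * e)\<bar> powr p
      + (\<Sum>k=1..(m - 1) div 2. eW u (w @ [of_real (2 * real k / real m) * e])))"
    unfolding f_def m_def by (rule sum_mono) (rule arm_path(1))
  also have "\<dots> = eW u (w @ [0]) + (\<Sum>e\<in>dirs. \<Sum>k=1..(m - 1) div 2. eW u (w @ [of_real (2 * real k / real m) * e]))"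
    unfolding sum.distrib by (simp add: eW_def)
  also have "\<dots> = GW u w"
    unfolding GW_def m_def by (rule sum_S_set[symmetric]) (rule l_pos)
  finally show ?thesis .
qed

text \<open>The path inequality at the corner, \<open>j = m\<close>. The factor is exactly the
  growth of \<open>h n powr (1 - p)\<close> in one step, which is what makes the critical energies
  monotone in the level.\<close>

lemma eW_le_GW: "eW u w \<le> real (l (Suc (length w))) powr (p - 1) * GW u w"
proof -
  let ?m = "l (Suc (length w))"
  let ?f = "\<lambda>e (i::nat). \<bar>u (ctr w + of_real (h (Suc (length w)) * real (Suc i)) * e) -
    u (ctr w + of_real (h (Suc (length w)) * real i) * e)\<bar> powr p"
  have "eW u w \<le> (\<Sum>e\<in>dirs. real ?m powr (p - 1) * (\<Sum>i<?m. ?f e i))"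
    unfolding eW_def
  proof (rule sum_mono)
    fix e assume "e \<in> dirs"
    from arm_path(2)[OF this order_refl, of u w]
    show "\<bar>u (ctr w) - u (ctr w + of_real (h (length w)) * e)\<bar> powr p \<le> real ?m powr (p - 1) * (\<Sum>i<?m. ?f e i)"
      by (simp add: h_Suc_l abs_minus_commute[of "u (ctr w)"])
  qed
  also have "\<dots> \<le> real ?m powr (p - 1) * GW u w"
    unfolding sum_distrib_left[symmetric] by (intro mult_left_mono arm_path_sum) simp
  finally show ?thesis .
qed

lemma letter_le_GW:
  assumes "s \<in> S_set (l (Suc (length w)))"
  shows "\<bar>u (ctr (w @ [s])) - u (ctr w)\<bar> powr p \<le> real (l (Suc (length w))) powr (p - 1) * GW u w"
proof -
  let ?m = "l (Suc (length w))"
  let ?f = "\<lambda>e (i::nat). \<bar>u (ctr w + of_real (h (Suc (length w)) * real (Suc i)) * e) -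
    u (ctr w + of_real (h (Suc (length w)) * real i) * e)\<bar> powr p"
  obtain k e where s: "s = of_real (2 * real k / real ?m) * e" "k \<le> (?m - 1) div 2" "e \<in> dirs"
    using assms by (auto simp: S_set_dirs)
  have k: "2 * k \<le> ?m" using s(2) by auto
  have "ctr (w @ [s]) = ctr w + of_real (h (Suc (length w)) * real (2 * k)) * e"
    unfolding s(1) ctr_snoc h_Suc_l[of "length w", symmetric] mult.assoc[symmetric] of_real_mult[symmetric]
    using l_pos[of "Suc (length w)"] by simp
  then have "\<bar>u (ctr (w @ [s])) - u (ctr w)\<bar> powr p \<le> real ?m powr (p - 1) * (\<Sum>i<?m. ?f e i)"
    using arm_path(2)[OF s(3) k, of u] by simp
  also have "(\<Sum>i<?m. ?f e i) \<le> (\<Sum>e\<in>dirs. \<Sum>i<?m. ?f e i)"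
    using s(3) dirs_card by (intro member_le_sum sum_nonneg) auto
  also have "\<dots> \<le> GW u w" by (rule arm_path_sum)
  finally show ?thesis by (simp add: mult_left_mono)
qed

lemma en_le_Suc: "en u n \<le> real (l (Suc n)) powr (p - 1) * en u (Suc n)"
proof -
  have "en u n \<le> (\<Sum>w\<in>W n. real (l (Suc n)) powr (p - 1) * GW u w)"
    unfolding en_def using eW_le_GW[of u] by (intro sum_mono) (metis W_length)
  then show ?thesis by (simp add: en_Suc sum_distrib_left)
qed

end

section \<open>Pointwise bounds by discrete energies\<close>

lemma add_powr_le:
  fixes a b c p :: real
  assumes "0 \<le> p" "\<bar>a\<bar> \<le> \<bar>b\<bar> + \<bar>c\<bar>"
  shows "\<bar>a\<bar> powr p \<le> 2 powr p * (\<bar>b\<bar> powr p + \<bar>c\<bar> powr p)"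
proof -
  have "\<bar>a\<bar> powr p \<le> (2 * max \<bar>b\<bar> \<bar>c\<bar>) powr p" using assms by (intro powr_mono2) auto
  also have "\<dots> = 2 powr p * max \<bar>b\<bar> \<bar>c\<bar> powr p" by (simp add: powr_mult)
  also have "\<dots> \<le> 2 powr p * (\<bar>b\<bar> powr p + \<bar>c\<bar> powr p)" by (intro mult_left_mono) (auto simp: max_def)
  finally show ?thesis .
qed

text \<open>Each increment is at most \<open>(M lam\<^sup>j)\<^bsup>1/p\<^esup>\<close>, where \<open>M\<close> is the sum on the right, and these
  bounds form a geometric series.\<close>

lemma weighted_powr_sum_limit:
  fixes f :: "nat \<Rightarrow> real"
  assumes lam: "0 < lam" "lam < 1" and p: "0 < p" and lim: "f \<longlonglongrightarrow> F"
  shows "ennreal (\<bar>F - f 0\<bar> powr p) \<le> ennreal ((1 / (1 - lam powr (1/p))) powr p) *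
    (\<Sum>j. ennreal (\<bar>f (Suc j) - f j\<bar> powr p / lam ^ j))" (is "_ \<le> ennreal ?C * ?S")
proof -
  define q where "q = lam powr (1/p)"
  have q: "0 < q" "q < 1" using lam p powr_less_mono2[of "1/p" lam 1] by (auto simp: q_def)
  have C: "0 < ?C" using q by (simp add: q_def)
  show ?thesis
  proof (cases "?S = \<top>")
    case True then show ?thesis using C by (simp add: ennreal_mult_top)
  next
    case False
    then obtain M where M: "?S = ennreal M" "0 \<le> M" by (cases ?S) auto
    have t: "\<bar>f (Suc j) - f j\<bar> \<le> M powr (1/p) * q ^ j" for j
    proof -
      have "ennreal (\<bar>f (Suc j) - f j\<bar> powr p / lam ^ j) \<le> ?S"
        using sum_le_suminf[of "\<lambda>j. ennreal (\<bar>f (Suc j) - f j\<bar> powr p / lam ^ j)" "{j}"] by simp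
      then have "\<bar>f (Suc j) - f j\<bar> powr p \<le> M * lam ^ j"
        using M lam by (simp add: ennreal_le_iff pos_divide_le_eq)
      then have "(\<bar>f (Suc j) - f j\<bar> powr p) powr (1/p) \<le> (M * lam ^ j) powr (1/p)"
        using p by (intro powr_mono2) auto
      also have "(M * lam ^ j) powr (1/p) = M powr (1/p) * q ^ j"
        using M lam by (simp add: powr_mult q_def powr_powr powr_realpow[symmetric] mult.commute)
      finally show ?thesis using p by (simp add: powr_powr)
    qed
    have "\<bar>f N - f 0\<bar> \<le> M powr (1/p) * (1 / (1 - q))" for N
    proof -
      have "f N - f 0 = (\<Sum>j<N. f (Suc j) - f j)" by (simp add: sum_lessThan_telescope)
      then have "\<bar>f N - f 0\<bar> \<le> (\<Sum>j<N. \<bar>f (Suc j) - f j\<bar>)" by (simp only: sum_abs)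
      also have "\<dots> \<le> (\<Sum>j<N. M powr (1/p) * q ^ j)" by (intro sum_mono t)
      also have "\<dots> = M powr (1/p) * (\<Sum>j<N. q ^ j)" by (simp add: sum_distrib_left)
      also have "\<dots> \<le> M powr (1/p) * (1 / (1 - q))"
      proof (rule mult_left_mono)
        have "(\<Sum>j<N. q ^ j) = (1 - q ^ N) / (1 - q)" using q by (simp add: sum_gp_strict)
        also have "\<dots> \<le> 1 / (1 - q)" using q by (intro divide_right_mono) auto
        finally show "(\<Sum>j<N. q ^ j) \<le> 1 / (1 - q)" .
      qed simp
      finally show ?thesis .
    qed
    moreover have "(\<lambda>N. \<bar>f N - f 0\<bar>) \<longlonglongrightarrow> \<bar>F - f 0\<bar>"
      by (intro tendsto_intros lim)
    ultimately have "\<bar>F - f 0\<bar> \<le> M powr (1/p) * (1 / (1 - q))"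
      by (intro LIMSEQ_le_const2) auto
    then have "\<bar>F - f 0\<bar> powr p \<le> (M powr (1/p) * (1 / (1 - q))) powr p"
      using p by (intro powr_mono2) auto
    also have "\<dots> = ?C * M"
    proof -
      have "(M powr (1/p)) powr p = M" using M p by (simp add: powr_powr)
      then show ?thesis by (simp only: powr_mult q_def mult.commute)
    qed
    finally have "ennreal (\<bar>F - f 0\<bar> powr p) \<le> ennreal (?C * M)" by (rule ennreal_leI)
    then show ?thesis using C M by (simp add: ennreal_mult)
  qed
qed

context vicsek_energy
begin

text \<open>A shared vertex collects the energy of every cell that contains it, so an estimate by
  \<open>Gam\<close> holds for any choice of the cell around \<open>x\<close>.\<close>

definition Gam :: "(complex \<Rightarrow> real) \<Rightarrow> nat \<Rightarrow> complex \<Rightarrow> real" where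
  "Gam u n x = (\<Sum>w\<in>W n. GW u w * indicator (box w \<inter> K) x)"
definition Tm :: "real \<Rightarrow> (complex \<Rightarrow> real) \<Rightarrow> nat \<Rightarrow> complex \<Rightarrow> ennreal" where
  "Tm lam u m x = (\<Sum>j. ennreal (Gam u (m + j) x / lam ^ j))"

lemma GW_le_Gam: "w \<in> W n \<Longrightarrow> x \<in> box w \<Longrightarrow> x \<in> K \<Longrightarrow> GW u w \<le> Gam u n x"
  unfolding Gam_def using finite_W GW_nonneg
  by (rule_tac order_trans[OF _ member_le_sum[of w]]) auto

lemma Gam_nonneg: "0 \<le> Gam u n x"
  unfolding Gam_def by (intro sum_nonneg mult_nonneg_nonneg GW_nonneg) auto

lemma l_powr_le: "real (l n) powr (p - 1) \<le> L powr (p - 1)"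
  using l_le p by (intro powr_mono2) auto

lemma vertex_le_GW:
  assumes "w \<in> W n" "z \<in> verts w"
  shows "\<bar>u z - u (ctr w)\<bar> powr p \<le> L powr (p - 1) * GW u w"
proof -
  have "\<bar>u z - u (ctr w)\<bar> powr p \<le> eW u w"
  proof (cases "z = ctr w")
    case True then show ?thesis using eW_nonneg p by simp
  next
    case False
    then obtain e where "e \<in> dirs" "z = ctr w + of_real (h (length w)) * e"
      using assms by (auto simp: verts_def)
    then show ?thesis unfolding eW_def using dirs_card(1)
      by (subst abs_minus_commute) (auto intro!: member_le_sum[where f="\<lambda>e. \<bar>u (ctr w) - u (ctr w + complex_of_real (h (length w)) * e)\<bar> powr p"])
  qed
  also have "\<dots> \<le> real (l (Suc (length w))) powr (p - 1) * GW u w" by (rule eW_le_GW)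
  also have "\<dots> \<le> L powr (p - 1) * GW u w" by (intro mult_right_mono l_powr_le GW_nonneg)
  finally show ?thesis .
qed

lemma child_le_GW:
  assumes "w \<in> W n" "s \<in> S_set (l (Suc n))"
  shows "\<bar>u (ctr (w @ [s])) - u (ctr w)\<bar> powr p \<le> L powr (p - 1) * GW u w"
  using letter_le_GW[of s w u] assms
    mult_right_mono[OF l_powr_le GW_nonneg, of "Suc n" u w] by (simp add: W_length)

text \<open>The cell \<open>v\<close> need not be a child of \<open>w\<close>. Its parent
  \<open>w'\<close> contains \<open>x\<close> as well and so has a vertex \<open>z\<close> in common
  with \<open>w\<close>; the path from \<open>ctr v\<close> over \<open>ctr w'\<close> and
  \<open>z\<close> to \<open>ctr w\<close> is controlled by the energies of the children of
  \<open>w\<close> and \<open>w'\<close>.\<close>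

lemma center_step_le_Gam:
  assumes "w \<in> W n" "v \<in> W (Suc n)" "x \<in> box w" "x \<in> box v" "x \<in> K"
  shows "\<bar>u (ctr v) - u (ctr w)\<bar> powr p \<le> 3 * 4 powr p * L powr (p - 1) * Gam u n x"
proof -
  obtain w' s where v: "v = w' @ [s]" "w' \<in> W n" "s \<in> S_set (l (Suc n))"
    using assms(2) by (auto elim: W_SucE)
  have xw': "x \<in> box w'" using box_snoc_subset[OF v(2,3)] assms v by auto
  obtain z where z: "z \<in> verts w" "z \<in> verts w'"
    using near_cells_common_vertex[OF assms(1) v(2) assms(3) xw'] h_pos[of n] by auto
  let ?B = "L powr (p - 1) * Gam u n x"
  have *: "L powr (p - 1) * GW u w \<le> ?B" "L powr (p - 1) * GW u w' \<le> ?B"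
    using GW_le_Gam[of _ n x u] assms v xw' by (auto intro: mult_left_mono)
  have b: "\<bar>u (ctr v) - u (ctr w')\<bar> powr p \<le> ?B" "\<bar>u z - u (ctr w')\<bar> powr p \<le> ?B" "\<bar>u z - u (ctr w)\<bar> powr p \<le> ?B"
    using child_le_GW[OF v(2,3), of u] vertex_le_GW[OF v(2) z(2), of u] vertex_le_GW[OF assms(1) z(1), of u] * v(1) by auto
  have B0: "0 \<le> ?B" using Gam_nonneg by simp
  have "\<bar>u (ctr v) - u (ctr w)\<bar> powr p \<le> 2 powr p * (\<bar>u (ctr v) - u (ctr w')\<bar> powr p + \<bar>u (ctr w') - u (ctr w)\<bar> powr p)"
    using p by (intro add_powr_le) auto
  also have "\<dots> \<le> 2 powr p * (?B + 2 powr p * (?B + ?B))"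
  proof (intro mult_left_mono add_mono b)
    have "\<bar>u (ctr w') - u (ctr w)\<bar> powr p \<le> 2 powr p * (\<bar>u z - u (ctr w')\<bar> powr p + \<bar>u z - u (ctr w)\<bar> powr p)"
      using p by (intro add_powr_le) auto
    also have "\<dots> \<le> 2 powr p * (?B + ?B)" by (intro mult_left_mono add_mono b) simp
    finally show "\<bar>u (ctr w') - u (ctr w)\<bar> powr p \<le> 2 powr p * (?B + ?B)" .
  qed simp
  also have "\<dots> = 2 powr p * ?B + 2 * (2 powr p * 2 powr p * ?B)" by (simp add: algebra_simps)
  also have "\<dots> \<le> 4 powr p * ?B + 2 * (4 powr p * ?B)"
  proof -
    have "2 powr p * 2 powr p = 4 powr p" by (simp flip: powr_mult)
    moreover have "2 powr p \<le> 4 powr p" using p by (intro powr_mono2) auto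
    ultimately have "2 powr p * ?B \<le> 4 powr p * ?B" "2 powr p * 2 powr p * ?B = 4 powr p * ?B"
      using B0 by (auto intro: mult_right_mono simp only:)
    then show ?thesis by linarith
  qed
  finally show ?thesis by (simp add: mult_ac)
qed

definition C_pt :: "real \<Rightarrow> real" where
  "C_pt lam = 2 powr p * (((1 / (1 - lam powr (1/p))) powr p) * (3 * 4 powr p * L powr (p - 1)) + L powr (p - 1))"

lemma C_pt_nonneg: "0 \<le> C_pt lam"
  using L_ge3 by (simp add: C_pt_def)

lemma Gam_le_Tm: "ennreal (Gam u m x) \<le> Tm lam u m x"
  unfolding Tm_def
  using sum_le_suminf[of "\<lambda>j. ennreal (Gam u (m + j) x / lam ^ j)" "{0}"] by simp

lemma point_vertex_le:
  assumes lam: "0 < lam" "lam < 1" and u: "continuous_on K u"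
    and w: "w \<in> W m" "x \<in> box w" "x \<in> K" "z \<in> verts w"
  shows "ennreal (\<bar>u x - u z\<bar> powr p) \<le> ennreal (C_pt lam) * Tm lam u m x"
proof -
  \<comment> \<open>The cells around \<open>x\<close> are chosen level by level without being
    nested; only the first one is prescribed.\<close>
  have "\<exists>v. v \<in> W (m + j) \<and> x \<in> box v \<and> (j = 0 \<longrightarrow> v = w)" for j
    using w in_K_iff[of x] by (cases "j = 0") auto
  then obtain v where v: "\<And>j. v j \<in> W (m + j)" "\<And>j. x \<in> box (v j)" "v 0 = w" by metis
  define f where "f = (\<lambda>j. u (ctr (v j)))"
  have cK: "ctr (v j) \<in> K" for j using verts_in_K[OF v(1)[of j]] by (auto simp: verts_def)
  have "(\<lambda>j. ctr (v j)) \<longlonglongrightarrow> x"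
  proof (rule metric_tendsto_imp_tendsto)
    show "(\<lambda>j. h (m + j)) \<longlonglongrightarrow> 0"
      using LIMSEQ_ignore_initial_segment[OF h_tendsto_0, of m] by (simp add: add.commute)
    show "\<forall>\<^sub>F j in sequentially. dist (ctr (v j)) x \<le> dist (h (m + j)) 0"
    proof (rule always_eventually, rule allI)
      fix j
      have "dist (ctr (v j)) x \<le> norm1 (x - ctr (v j))"
        using cmod_le_norm1[of "x - ctr (v j)"] by (simp add: dist_norm norm_minus_commute)
      also have "\<dots> \<le> h (m + j)" using v(2)[of j] W_length[OF v(1)[of j]] by (simp add: box_def)
      finally show "dist (ctr (v j)) x \<le> dist (h (m + j)) 0" by simp
    qed
  qed
  then have lim: "f \<longlonglongrightarrow> u x"
    unfolding f_def using cK w by (intro continuous_on_tendsto_compose[OF u]) auto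
  define D where "D = 3 * 4 powr p * L powr (p - 1)"
  define A where "A = (1 / (1 - lam powr (1/p))) powr p"
  have D0: "0 \<le> D" "0 \<le> A" by (auto simp: D_def A_def)
  have "(\<Sum>j. ennreal (\<bar>f (Suc j) - f j\<bar> powr p / lam ^ j)) \<le> (\<Sum>j. ennreal D * ennreal (Gam u (m + j) x / lam ^ j))"
  proof (rule suminf_le)
    fix j
    have "\<bar>f (Suc j) - f j\<bar> powr p \<le> D * Gam u (m + j) x"
      unfolding f_def D_def using center_step_le_Gam[OF v(1)[of j] _ v(2)[of j] v(2)[of "Suc j"] w(3)] v(1)[of "Suc j"] by simp
    then have "\<bar>f (Suc j) - f j\<bar> powr p / lam ^ j \<le> D * (Gam u (m + j) x / lam ^ j)"
      using lam by (simp add: divide_right_mono)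
    then show "ennreal (\<bar>f (Suc j) - f j\<bar> powr p / lam ^ j) \<le> ennreal D * ennreal (Gam u (m + j) x / lam ^ j)"
      using D0 Gam_nonneg lam by (simp add: ennreal_leI flip: ennreal_mult)
  qed auto
  also have "\<dots> = ennreal D * Tm lam u m x" by (simp add: Tm_def)
  finally have S: "(\<Sum>j. ennreal (\<bar>f (Suc j) - f j\<bar> powr p / lam ^ j)) \<le> ennreal D * Tm lam u m x" .
  have p0: "0 < p" using p by simp
  have "ennreal (\<bar>u x - u (ctr w)\<bar> powr p) \<le> ennreal A * (\<Sum>j. ennreal (\<bar>f (Suc j) - f j\<bar> powr p / lam ^ j))"
    using weighted_powr_sum_limit[OF lam p0 lim] by (simp add: f_def v(3) A_def)
  also have "\<dots> \<le> ennreal A * (ennreal D * Tm lam u m x)" by (intro mult_left_mono S) simp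
  finally have 1: "ennreal (\<bar>u x - u (ctr w)\<bar> powr p) \<le> ennreal (A * D) * Tm lam u m x"
    using D0 by (simp add: ennreal_mult mult.assoc)
  have "\<bar>u z - u (ctr w)\<bar> powr p \<le> L powr (p - 1) * Gam u m x"
    using vertex_le_GW[OF w(1) w(4), of u] mult_left_mono[OF GW_le_Gam[OF w(1-3), of u], of "L powr (p - 1)"] by simp
  then have "ennreal (\<bar>u z - u (ctr w)\<bar> powr p) \<le> ennreal (L powr (p - 1)) * ennreal (Gam u m x)"
    by (simp add: ennreal_leI Gam_nonneg flip: ennreal_mult)
  also have "\<dots> \<le> ennreal (L powr (p - 1)) * Tm lam u m x" by (intro mult_left_mono Gam_le_Tm) simp
  finally have 2: "ennreal (\<bar>u z - u (ctr w)\<bar> powr p) \<le> ennreal (L powr (p - 1)) * Tm lam u m x" .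
  have "\<bar>u x - u z\<bar> powr p \<le> 2 powr p * (\<bar>u x - u (ctr w)\<bar> powr p + \<bar>u z - u (ctr w)\<bar> powr p)"
    using p by (intro add_powr_le) auto
  then have "ennreal (\<bar>u x - u z\<bar> powr p) \<le> ennreal (2 powr p) * (ennreal (\<bar>u x - u (ctr w)\<bar> powr p) + ennreal (\<bar>u z - u (ctr w)\<bar> powr p))"
    by (simp add: ennreal_leI flip: ennreal_mult ennreal_plus)
  also have "\<dots> \<le> ennreal (2 powr p) * (ennreal (A * D) * Tm lam u m x + ennreal (L powr (p - 1)) * Tm lam u m x)"
    by (intro mult_left_mono add_mono 1 2) simp
  also have "\<dots> = ennreal (C_pt lam) * Tm lam u m x"
    unfolding C_pt_def D_def[symmetric] A_def[symmetric] using D0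
    by (simp add: ennreal_mult ennreal_plus distrib_right mult.assoc)
  finally show ?thesis .
qed

lemma near_points_le:
  assumes lam: "0 < lam" "lam < 1" and u: "continuous_on K u"
    and xy: "x \<in> K" "y \<in> K" "m = 0 \<or> norm1 (x - y) < 2 * h m"
  shows "ennreal (\<bar>u x - u y\<bar> powr p) \<le> ennreal (2 powr p * C_pt lam) * (Tm lam u m x + Tm lam u m y)"
proof -
  obtain w w' where w: "w \<in> W m" "x \<in> box w" "w' \<in> W m" "y \<in> box w'"
    using xy in_K_iff by meson
  obtain z where z: "z \<in> verts w" "z \<in> verts w'"
    using near_cells_common_vertex[OF w(1,3,2,4) xy(3)] by blast
  have "\<bar>u x - u y\<bar> powr p \<le> 2 powr p * (\<bar>u x - u z\<bar> powr p + \<bar>u y - u z\<bar> powr p)"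
    using p by (intro add_powr_le) auto
  then have "ennreal (\<bar>u x - u y\<bar> powr p) \<le> ennreal (2 powr p) * (ennreal (\<bar>u x - u z\<bar> powr p) + ennreal (\<bar>u y - u z\<bar> powr p))"
    by (simp add: ennreal_leI flip: ennreal_mult ennreal_plus)
  also have "\<dots> \<le> ennreal (2 powr p) * (ennreal (C_pt lam) * Tm lam u m x + ennreal (C_pt lam) * Tm lam u m y)"
    using point_vertex_le[OF lam u] w z xy by (intro mult_left_mono add_mono) auto
  also have "\<dots> = ennreal (2 powr p * C_pt lam) * (Tm lam u m x + Tm lam u m y)"
    using C_pt_nonneg by (simp add: ennreal_mult mult.assoc distrib_left)
  finally show ?thesis .
qed

end

section \<open>The measure\<close>

text \<open>Jensen's inequality up to a constant, from \<open>t \<le> s + t\<^sup>p s\<^bsup>1-p\<^esup>\<close> with an optimal \<open>s\<close>.\<close>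

lemma (in prob_space) powr_average_le:
  fixes u :: "'a \<Rightarrow> real"
  assumes u: "integrable M u" and A[measurable]: "A \<in> sets M" "0 < measure M A" and p: "1 < p"
  shows "ennreal (\<bar>c - (\<integral>x. indicator A x * u x \<partial>M) / measure M A\<bar> powr p)
    \<le> ennreal (2 powr p / measure M A) * (\<integral>\<^sup>+x. ennreal (\<bar>c - u x\<bar> powr p) * indicator A x \<partial>M)"
    (is "ennreal (?D powr p) \<le> _ * ?I")
proof (cases "?I = \<top>")
  case True then show ?thesis using A by (simp add: ennreal_mult_top)
next
  case False
  let ?a = "measure M A"
  note [measurable] = borel_measurable_integrable[OF u]
  obtain I where I: "?I = ennreal I" "0 \<le> I" using False by (cases ?I) auto
  have int: "integrable M (\<lambda>x. indicator A x * (c - u x))" "integrable M (\<lambda>x. indicator A x * u x)"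
    using u by (auto intro!: integrable_real_mult_indicator simp: mult.commute[of "indicator A _ :: real"])
  have D: "?D \<le> s + s powr (1 - p) * (I / ?a)" if s: "s > 0" for s
  proof -
    have pt: "t \<le> s + t powr p * s powr (1 - p)" if "0 \<le> t" for t
    proof (cases "t \<le> s")
      case True then show ?thesis by (simp add: add_increasing2)
    next
      case False
      then have "t * 1 \<le> t * (t / s) powr (p - 1)" using s p that
        by (intro mult_left_mono ge_one_powr_ge_zero) auto
      also have "\<dots> = t powr p * s powr (1 - p)"
        using False s p by (simp add: powr_divide powr_diff powr_minus_divide[of s "p - 1", symmetric])
      finally show ?thesis using s by simp
    qed
    have "(\<integral>x. indicator A x * (c - u x) \<partial>M) = c * ?a - (\<integral>x. indicator A x * u x \<partial>M)"
      using int(2) by (simp add: right_diff_distrib mult.commute[of "indicator A _ :: real" c] less_top[symmetric])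
    then have "c - (\<integral>x. indicator A x * u x \<partial>M) / ?a = (\<integral>x. indicator A x * (c - u x) \<partial>M) / ?a"
      using A by (simp add: field_simps)
    then have "?D * ?a = \<bar>\<integral>x. indicator A x * (c - u x) \<partial>M\<bar>" using A by simp
    also have "\<dots> \<le> (\<integral>x. \<bar>indicator A x * (c - u x)\<bar> \<partial>M)"
      using integral_norm_bound[of M "\<lambda>x. indicator A x * (c - u x)"] by simp
    finally have "ennreal (?D * ?a) \<le> ennreal (\<integral>x. \<bar>indicator A x * (c - u x)\<bar> \<partial>M)" by (rule ennreal_leI)
    also have "\<dots> = (\<integral>\<^sup>+x. ennreal \<bar>indicator A x * (c - u x)\<bar> \<partial>M)"
      using int by (intro nn_integral_eq_integral[symmetric]) auto
    also have "\<dots> \<le> (\<integral>\<^sup>+x. ennreal s * indicator A x + ennreal (s powr (1 - p)) * (ennreal (\<bar>c - u x\<bar> powr p) * indicator A x) \<partial>M)"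
    proof (rule nn_integral_mono)
      fix x show "ennreal \<bar>indicator A x * (c - u x)\<bar> \<le> ennreal s * indicator A x +
          ennreal (s powr (1 - p)) * (ennreal (\<bar>c - u x\<bar> powr p) * indicator A x)"
        using pt[of "\<bar>c - u x\<bar>"] s
        by (cases "x \<in> A") (auto simp: mult.commute[of "s powr (1 - p)"] ennreal_leI simp flip: ennreal_mult ennreal_plus)
    qed
    also have "\<dots> = ennreal s * ennreal ?a + ennreal (s powr (1 - p)) * ?I"
      by (simp add: nn_integral_add nn_integral_cmult nn_integral_cmult_indicator emeasure_eq_measure)
    also have "\<dots> = ennreal (s * ?a + s powr (1 - p) * I)"
      using s I by (simp add: ennreal_mult ennreal_plus)
    finally have "?D * ?a \<le> s * ?a + s powr (1 - p) * I" using s I by (subst (asm) ennreal_le_iff) auto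
    then show ?thesis using A by (simp add: field_simps)
  qed
  have "?D powr p \<le> 2 powr p * (I / ?a)"
  proof (cases "I = 0")
    case True
    then have "?D \<le> 0" using D field_le_epsilon[of ?D 0] by auto
    then show ?thesis using True by simp
  next
    case False
    define m where "m = I / ?a"
    have m: "m > 0" using False I A by (simp add: m_def)
    \<comment> \<open>The choice \<open>s = m powr (1/p)\<close> makes the two terms equal.\<close>
    have "?D \<le> m powr (1/p) + (m powr (1/p)) powr (1 - p) * m" 
    proof -
      have "0 < m powr (1/p)" using m by simp
      from D[OF this] show ?thesis unfolding m_def .
    qed
    also have "(m powr (1/p)) powr (1 - p) * m = m powr (1/p * (1 - p)) * m powr 1"
      using m by (simp add: powr_powr)
    also have "\<dots> = m powr (1/p * (1 - p) + 1)" by (rule powr_add[symmetric])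
    also have "1/p * (1 - p) + 1 = 1/p" using p by (simp add: field_simps)
    finally have "?D \<le> 2 * m powr (1/p)" by simp
    then have "?D powr p \<le> (2 * m powr (1/p)) powr p" using p by (intro powr_mono2) auto
    also have "\<dots> = 2 powr p * m" using m p by (simp add: powr_mult powr_powr)
    finally show ?thesis by (simp add: m_def)
  qed
  then have "ennreal (?D powr p) \<le> ennreal (2 powr p / ?a * I)" by (intro ennreal_leI) simp
  also have "\<dots> = ennreal (2 powr p / ?a) * ?I" unfolding I(1) by (rule ennreal_mult) (use I in auto)
  finally show ?thesis .
qed

context vicsek_energy
begin

section \<open>Scale functions at the scales of the cells\<close>

definition ph :: "nat \<Rightarrow> real" where "ph n = (2 * h n) powr (p - 1) * ps n"

lemma ph_pos: "0 < ph n" using h_pos[of n] ps_pos[of n] by (simp add: ph_def)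
lemma rho_eq: "rho l n = 2 * h n" by (simp add: rho_def h_def)

lemma scale_index_eq:
  assumes "2 * h (Suc n) < r" "r \<le> 2 * h n" shows "scale_index l r = n"
  unfolding scale_index_def rho_eq
proof (rule the_equality)
  fix m assume m: "2 * h (Suc m) < r \<and> r \<le> 2 * h m"
  have "\<not> m < n" using h_decseq[of "Suc m" n] m assms by auto
  moreover have "\<not> n < m" using h_decseq[of "Suc n" m] m assms by auto
  ultimately show "m = n" by simp
qed (use assms in simp)

lemma h_lt_1: "0 < n \<Longrightarrow> h n < 1"
  using h_le_power[of n] power_strict_decreasing[of 0 n "1/3::real"] by simp

text \<open>The separate branch of \<open>phi\<close> for \<open>2 \<le> r\<close> is met here only
  at \<open>r = 2\<close>, that is at level 0, where it has the same value.\<close>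

lemma phi_eq:
  assumes "2 * h (Suc n) < r" "r \<le> 2 * h n" shows "phi l p r = ph n"
proof (cases "2 \<le> r")
  case True
  then have "n = 0" using assms h_lt_1[of n] by (cases "n = 0") auto
  then show ?thesis using True by (simp add: phi_def ph_def h_0 ps_0)
next
  case False
  have s: "scale_index l (2 * h n) = n" using h_Suc_le[of n] h_pos[of "Suc n"] by (intro scale_index_eq) auto
  have "psi l (2 * h n) = ps n"
  proof (cases "2 \<le> 2 * h n")
    case True
    then have "n = 0" using h_lt_1[of n] by (cases "n = 0") auto
    then show ?thesis by (simp add: psi_def h_0 ps_0)
  qed (simp add: psi_def s ps_def)
  then show ?thesis using False by (simp add: phi_def scale_index_eq[OF assms] rho_eq ph_def)
qed

lemma phi_rho: "phi l p (rho l n) = ph n" and psi_rho: "psi l (rho l n) = ps n"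
proof -
  have *: "2 * h (Suc n) < 2 * h n" using h_Suc_le[of n] h_pos[of "Suc n"] by simp
  show "phi l p (rho l n) = ph n" unfolding rho_eq by (rule phi_eq[OF *]) simp
  have s: "scale_index l (2 * h n) = n" by (rule scale_index_eq[OF *]) simp
  show "psi l (rho l n) = ps n" unfolding rho_eq
  proof (cases "2 \<le> 2 * h n")
    case True
    then have "n = 0" using h_lt_1[of n] by (cases "n = 0") auto
    then show "psi l (2 * h n) = ps n" by (simp add: psi_def h_0 ps_0)
  qed (simp add: psi_def s ps_def)
qed

lemma scale_exists:
  assumes "0 < r" "r \<le> 2" obtains n where "2 * h (Suc n) < r" "r \<le> 2 * h n"
proof -
  obtain N where "2 * h N < r"
    using order_tendstoD(2)[OF h_tendsto_0, of "r/2"] assms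
    by (auto dest!: eventually_happens'[OF sequentially_bot] simp: mult.commute)
  then have ex: "\<exists>n. 2 * h n < r" ..
  define m where "m = (LEAST n. 2 * h n < r)"
  have m: "2 * h m < r" unfolding m_def by (rule LeastI_ex[OF ex])
  then obtain n where n: "m = Suc n" using assms by (cases m) (auto simp: h_0)
  have "\<not> 2 * h n < r" using not_less_Least[of n "\<lambda>n. 2 * h n < r"] n by (simp add: m_def[symmetric])
  then show ?thesis using that m n by simp
qed

lemma E_level_eq: "E_level l p bs \<beta> n u = ph n powr (- \<beta> / bs) * ps n * en u n"
  unfolding E_level_def phi_rho psi_rho sum_edges by simp

end

section \<open>Mass of cells and balls\<close>

locale vicsek_space = vicsek_energy +
  fixes \<mu> :: "complex measure"
  assumes vicsek_measure: "vicsek_measure l \<mu>"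
begin

sublocale prob_space \<mu> using vicsek_measure by (simp add: vicsek_measure_def)
sublocale PP: pair_sigma_finite \<mu> \<mu> ..

lemma K_borel: "K \<in> sets borel" using compact_K by (simp add: borel_compact)

lemma sets_mu: "A \<in> sets \<mu> \<longleftrightarrow> A \<subseteq> K \<and> A \<in> sets borel"
  using vicsek_measure K_borel by (simp add: vicsek_measure_def sets_restrict_space_iff)

lemma space_mu: "space \<mu> = K"
proof -
  have s: "sets \<mu> = sets (restrict_space borel K)" using vicsek_measure by (simp add: vicsek_measure_def)
  from sets_eq_imp_space_eq[OF this] show ?thesis by (simp add: space_restrict_space)
qed

lemma measurable_from_borel:
  assumes "f \<in> borel \<rightarrow>\<^sub>M N" shows "f \<in> \<mu> \<rightarrow>\<^sub>M N"
proof -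
  have s: "sets \<mu> = sets (restrict_space borel K)" using vicsek_measure by (simp add: vicsek_measure_def)
  show ?thesis using measurable_restrict_space1[OF assms] unfolding measurable_cong_sets[OF s refl, of N] .
qed

lemma continuous_measurable: "continuous_on K (u :: complex \<Rightarrow> real) \<Longrightarrow> u \<in> borel_measurable \<mu>"
proof -
  assume "continuous_on K u"
  then have "u \<in> borel_measurable (restrict_space borel K)" by (rule borel_measurable_continuous_on_restrict)
  moreover have s: "sets \<mu> = sets (restrict_space borel K)" using vicsek_measure by (simp add: vicsek_measure_def)
  ultimately show ?thesis unfolding measurable_cong_sets[OF s refl, of borel] by simp
qed

lemma mu_into_borel:
  assumes f: "f \<in> N \<rightarrow>\<^sub>M \<mu>" shows "f \<in> borel_measurable N"
proof -
  have "(\<lambda>x. x) \<in> borel_measurable \<mu>" by (rule measurable_from_borel) simp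
  from measurable_compose[OF f this] show ?thesis .
qed

lemma dist_measurable[measurable]:
  "f \<in> N \<rightarrow>\<^sub>M \<mu> \<Longrightarrow> g \<in> N \<rightarrow>\<^sub>M \<mu> \<Longrightarrow> (\<lambda>x. dist (f x) (g x)) \<in> borel_measurable N"
  by (intro borel_measurable_dist mu_into_borel)

abbreviation "cl w \<equiv> box w \<inter> K"

lemma cl_sets[measurable]: "cl w \<in> sets \<mu>"
  using closed_box[of w] K_borel by (auto simp: sets_mu)

lemma emeasure_cl: assumes "w \<in> W n" shows "emeasure \<mu> (cl w) = ennreal (ps n)"
proof (cases "n = 0")
  case True
  then have "w = []" using assms by (simp add: W_0)
  moreover have "K \<subseteq> box []" using in_K_iff W_0 by (metis singletonD subsetI)
  ultimately have "cl w = space \<mu>" by (auto simp: space_mu)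
  then show ?thesis using True emeasure_space_1 by (simp add: ps_0)
next
  case False
  then have "measure \<mu> (cell l w) = 1 / real (card (W n))"
    using vicsek_measure assms by (auto simp: vicsek_measure_def)
  then show ?thesis by (simp add: emeasure_eq_measure cell_eq card_W)
qed

lemma measure_cl: "w \<in> W n \<Longrightarrow> measure \<mu> (cl w) = ps n"
  using emeasure_cl[of w n] ps_pos[of n] by (simp add: emeasure_eq_measure)

text \<open>Cells may overlap in shared vertices. They cover \<open>K\<close>, and their masses add
  up to 1, the mass of \<open>K\<close>; so the multiplicity exceeds 1 only on a null set.\<close>

lemma AE_cells: "AE x in \<mu>. (\<Sum>w\<in>W n. indicator (cl w) x) = (1 :: ennreal)"
proof -
  let ?f = "\<lambda>x. (\<Sum>w\<in>W n. indicator (cl w) x) :: ennreal"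
  have "integral\<^sup>N \<mu> ?f = (\<Sum>w\<in>W n. emeasure \<mu> (cl w))"
    by (subst nn_integral_sum) auto
  also have "\<dots> = (\<Sum>w\<in>W n. ennreal (ps n))" by (intro sum.cong emeasure_cl) auto
  also have "\<dots> = ennreal (\<Sum>w\<in>W n. ps n)" using ps_pos[of n] by (intro sum_ennreal) simp
  also have "(\<Sum>w\<in>W n. ps n) = 1" using card_W[of n] ps_pos[of n] by simp
  finally have int: "integral\<^sup>N \<mu> ?f = 1" by simp
  have ge: "1 \<le> ?f x" if "x \<in> K" for x
  proof -
    obtain w where w: "w \<in> W n" "x \<in> box w" using in_K_iff \<open>x \<in> K\<close> by blast
    then have "1 = (indicator (cl w) x :: ennreal)" using that by simp
    also have "\<dots> \<le> ?f x" using finite_W w by (intro member_le_sum) auto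
    finally show ?thesis .
  qed
  have "(\<integral>\<^sup>+x. (?f x - 1) \<partial>\<mu>) = integral\<^sup>N \<mu> ?f - (\<integral>\<^sup>+x. 1 \<partial>\<mu>)"
    by (rule nn_integral_diff) (use ge in \<open>auto simp: emeasure_space_1 space_mu\<close>)
  also have "\<dots> = 0" using int by (simp add: emeasure_space_1)
  finally have "AE x in \<mu>. ?f x - 1 = 0" by (subst (asm) nn_integral_0_iff_AE) auto
  then show ?thesis using AE_space
  proof (eventually_elim)
    case (elim x)
    have "?f x \<noteq> \<top>" by (simp add: finite_W indicator_def)
    then have "?f x \<le> 1" using elim(1) by (simp only: diff_eq_0_iff_ennreal)
    then show ?case using ge[of x] elim(2) by (intro antisym) (simp_all only: space_mu)
  qed
qed

lemma nn_integral_cells: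
  assumes [measurable]: "g \<in> borel_measurable \<mu>"
  shows "(\<Sum>w\<in>W n. \<integral>\<^sup>+x. g x * indicator (cl w) x \<partial>\<mu>) = integral\<^sup>N \<mu> g"
proof -
  have "(\<Sum>w\<in>W n. \<integral>\<^sup>+x. g x * indicator (cl w) x \<partial>\<mu>) = (\<integral>\<^sup>+x. (\<Sum>w\<in>W n. g x * indicator (cl w) x) \<partial>\<mu>)"
    by (subst nn_integral_sum) auto
  also have "\<dots> = integral\<^sup>N \<mu> g"
  proof (rule nn_integral_cong_AE)
    show "AE x in \<mu>. (\<Sum>w\<in>W n. g x * indicator (cl w) x) = g x"
      using AE_cells[of n] by eventually_elim (simp add: sum_distrib_left[symmetric])
  qed
  finally show ?thesis .
qed

lemma ball_sets[measurable]: "ball x r \<inter> K \<in> sets \<mu>"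
  using K_borel by (auto simp: sets_mu)

text \<open>A point of the ball lies in a cell whose center is within \<open>3 * h n\<close> of
  \<open>x\<close> in each coordinate: \<open>h n\<close> inside the cell and \<open>2 * h n\<close>
  within the ball.\<close>

lemma measure_ball_le:
  assumes "r \<le> 2 * h n" shows "measure \<mu> (ball x r \<inter> K) \<le> 16 * ps n"
proof -
  let ?A = "{w\<in>W n. \<bar>crd_x (ctr w - x)\<bar> < 3 * h n \<and> \<bar>crd_y (ctr w - x)\<bar> < 3 * h n}"
  have sub: "ball x r \<inter> K \<subseteq> (\<Union>w\<in>?A. cl w)"
  proof
    fix y assume y: "y \<in> ball x r \<inter> K"
    then obtain w where w: "w \<in> W n" "y \<in> box w" using in_K_iff by blast
    have "norm1 (y - ctr w) \<le> h n" using w W_length by (simp add: box_def)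
    then have c: "\<bar>crd_x (y - ctr w)\<bar> \<le> h n" "\<bar>crd_y (y - ctr w)\<bar> \<le> h n" by (auto simp: norm1_def)
    have "cmod (x - y) < 2 * h n" using y assms by (simp add: dist_norm)
    then have "(cmod (x - y))\<^sup>2 < (2 * h n)\<^sup>2" by (intro power_strict_mono) auto
    then have "(crd_x (x - y))\<^sup>2 < (2 * h n)\<^sup>2" "(crd_y (x - y))\<^sup>2 < (2 * h n)\<^sup>2"
      unfolding cmod_crd by (smt (verit) zero_le_power2)+
    then have "\<bar>crd_x (x - y)\<bar> < 2 * h n" "\<bar>crd_y (x - y)\<bar> < 2 * h n"
      using h_pos[of n] by (auto intro!: power2_less_imp_less[of "\<bar>_\<bar>"])
    then have "w \<in> ?A" using w c unfolding crd_diff by auto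
    then show "y \<in> (\<Union>w\<in>?A. cl w)" using w y by blast
  qed
  have fin: "finite ?A" using finite_W by auto
  have "measure \<mu> (ball x r \<inter> K) \<le> measure \<mu> (\<Union>w\<in>?A. cl w)"
    by (intro finite_measure_mono sub sets.finite_UN fin cl_sets)
  also have "\<dots> \<le> (\<Sum>w\<in>?A. measure \<mu> (cl w))"
    using fin by (intro measure_UNION_le) auto
  also have "\<dots> = (\<Sum>w\<in>?A. ps n)" by (rule sum.cong) (auto simp: measure_cl)
  also have "\<dots> = real (card ?A) * ps n" by simp
  also have "\<dots> \<le> 16 * ps n"
  proof (rule mult_right_mono)
    show "real (card ?A) \<le> 16" using card_near_cells[of n x] by linarith
  qed (use ps_pos[of n] in simp)
  finally show ?thesis .
qed

lemma measure_ball_ge: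
  assumes "2 * h n < r" "x \<in> K" shows "ps n \<le> measure \<mu> (ball x r \<inter> K)"
proof -
  obtain w where w: "w \<in> W n" "x \<in> box w" using in_K_iff assms by blast
  have "cl w \<subseteq> ball x r \<inter> K"
    using box_dist[OF w(2)] W_length[OF w(1)] assms(1) by fastforce
  then have "measure \<mu> (cl w) \<le> measure \<mu> (ball x r \<inter> K)" by (intro finite_measure_mono) auto
  then show ?thesis using measure_cl w by simp
qed

lemma inverse_measure_ball:
  assumes "2 * h (Suc n) < r" "r \<le> 2 * h n" "x \<in> K"
  shows "1 / emeasure \<mu> (ball x r \<inter> K) \<le> ennreal (1 / ps (Suc n))"
    "ennreal (1 / (16 * ps n)) \<le> 1 / emeasure \<mu> (ball x r \<inter> K)"
proof -
  let ?b = "measure \<mu> (ball x r \<inter> K)"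
  have b: "ps (Suc n) \<le> ?b" "?b \<le> 16 * ps n" "0 < ?b"
    using measure_ball_le measure_ball_ge assms ps_pos[of "Suc n"] by (auto intro: less_le_trans)
  have "1 / emeasure \<mu> (ball x r \<inter> K) = ennreal (1 / ?b)"
    using divide_ennreal[of 1 ?b] b by (simp add: emeasure_eq_measure)
  moreover have "1 / ?b \<le> 1 / ps (Suc n)" "1 / (16 * ps n) \<le> 1 / ?b"
    using b ps_pos by (auto intro!: divide_left_mono mult_pos_pos)
  ultimately show "1 / emeasure \<mu> (ball x r \<inter> K) \<le> ennreal (1 / ps (Suc n))"
    "ennreal (1 / (16 * ps n)) \<le> 1 / emeasure \<mu> (ball x r \<inter> K)" by (auto intro: ennreal_leI)
qed

text \<open>\<open>Phi\<close> without its normalising factors and with closed balls. It is monotone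
  in the radius, which makes different scales directly comparable.\<close>

definition dd :: "(complex \<Rightarrow> real) \<Rightarrow> real \<Rightarrow> ennreal" where
  "dd u r = (\<integral>\<^sup>+x. \<integral>\<^sup>+y. (if dist x y \<le> r then ennreal (\<bar>u x - u y\<bar> powr p) else 0) \<partial>\<mu> \<partial>\<mu>)"

lemma dd_mono: "r \<le> s \<Longrightarrow> dd u r \<le> dd u s"
  unfolding dd_def by (intro nn_integral_mono) auto

lemma dd_cells:
  assumes [measurable]: "u \<in> borel_measurable \<mu>"
  shows "(\<Sum>w\<in>W n. \<integral>\<^sup>+x. (\<integral>\<^sup>+y. ennreal (\<bar>u x - u y\<bar> powr p) * indicator (cl w) y \<partial>\<mu>) * indicator (cl w) x \<partial>\<mu>)
    \<le> dd u (2 * h n)"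
proof -
  let ?g = "\<lambda>x. \<integral>\<^sup>+y. (if dist x y \<le> 2 * h n then ennreal (\<bar>u x - u y\<bar> powr p) else 0) \<partial>\<mu>"
  have [measurable]: "?g \<in> borel_measurable \<mu>" by measurable
  have "(\<Sum>w\<in>W n. \<integral>\<^sup>+x. (\<integral>\<^sup>+y. ennreal (\<bar>u x - u y\<bar> powr p) * indicator (cl w) y \<partial>\<mu>) * indicator (cl w) x \<partial>\<mu>)
    \<le> (\<Sum>w\<in>W n. \<integral>\<^sup>+x. ?g x * indicator (cl w) x \<partial>\<mu>)"
  proof (intro sum_mono nn_integral_mono)
    fix w x assume w: "w \<in> W n"
    show "(\<integral>\<^sup>+y. ennreal (\<bar>u x - u y\<bar> powr p) * indicator (cl w) y \<partial>\<mu>) * indicator (cl w) x \<le> ?g x * indicator (cl w) x"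
    proof (cases "x \<in> cl w")
      case True
      have "(\<integral>\<^sup>+y. ennreal (\<bar>u x - u y\<bar> powr p) * indicator (cl w) y \<partial>\<mu>) \<le> ?g x"
        using True box_dist[of x w] W_length[OF w] by (intro nn_integral_mono) (auto split: split_indicator)
      then show ?thesis using True by simp
    qed simp
  qed
  also have "\<dots> = dd u (2 * h n)" by (simp add: nn_integral_cells dd_def)
  finally show ?thesis .
qed

text \<open>Points of equal or adjacent cells are at most \<open>4 * h n\<close> apart, which is
  where the radius \<open>4 * h n\<close> of the later estimates comes from. The subsets
  \<open>A\<close> and \<open>B\<close> allow a child in place of its parent.\<close>

lemma neighbour_dd:
  assumes [measurable]: "u \<in> borel_measurable \<mu>"
    and w: "w \<in> W n" "w' \<in> W n" and near: "w = w' \<or> (\<exists>e\<in>dirs. ctr w' = ctr w + of_real (2 * h n) * e)"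
    and A: "A \<subseteq> cl w" "B \<subseteq> cl w'"
  shows "(\<integral>\<^sup>+x. (\<integral>\<^sup>+y. ennreal (\<bar>u x - u y\<bar> powr p) * indicator B y \<partial>\<mu>) * indicator A x \<partial>\<mu>) \<le> dd u (4 * h n)"
proof -
  have "dist x y \<le> 4 * h n" if "x \<in> box w" "y \<in> box w'" for x y
    using near
  proof
    assume "w = w'" then show ?thesis using box_dist[of x w y] that W_length[OF w(1)] h_pos[of n] by simp
  next
    assume "\<exists>e\<in>dirs. ctr w' = ctr w + of_real (2 * h n) * e"
    then show ?thesis using neighbour_box_dist[OF that] w W_length by blast
  qed
  note d = this
  have "ennreal (\<bar>u x - u y\<bar> powr p) * indicator B y \<le> (if dist x y \<le> 4 * h n then ennreal (\<bar>u x - u y\<bar> powr p) else 0)"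
    if "x \<in> A" for x y
    using d[of x y] that A by (auto split: split_indicator)
  then show ?thesis unfolding dd_def
    by (intro nn_integral_mono) (auto split: split_indicator intro!: nn_integral_mono)
qed

lemma Phi_inner:
  assumes [measurable]: "u \<in> borel_measurable \<mu>" and r: "2 * h (Suc n) < r" "r \<le> 2 * h n" and x: "x \<in> K"
  shows "(\<integral>\<^sup>+y\<in>ball x r \<inter> K. ennreal (\<bar>u x - u y\<bar> powr p / phi l p r powr \<theta>) \<partial>\<mu>) =
    ennreal (ph n powr (- \<theta>)) * (\<integral>\<^sup>+y. (if dist x y < r then ennreal (\<bar>u x - u y\<bar> powr p) else 0) \<partial>\<mu>)"
proof -
  have [measurable]: "(\<lambda>y. dist x y) \<in> borel_measurable \<mu>"
    using x by (intro measurable_from_borel) auto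
  have "(\<integral>\<^sup>+y\<in>ball x r \<inter> K. ennreal (\<bar>u x - u y\<bar> powr p / phi l p r powr \<theta>) \<partial>\<mu>) =
    (\<integral>\<^sup>+y. ennreal (ph n powr (- \<theta>)) * (if dist x y < r then ennreal (\<bar>u x - u y\<bar> powr p) else 0) \<partial>\<mu>)"
  proof (rule nn_integral_cong)
    fix y assume y: "y \<in> space \<mu>"
    have "\<bar>u x - u y\<bar> powr p / phi l p r powr \<theta> = ph n powr (- \<theta>) * \<bar>u x - u y\<bar> powr p"
      unfolding phi_eq[OF r] using ph_pos[of n] by (simp add: powr_minus_divide)
    then show "ennreal (\<bar>u x - u y\<bar> powr p / phi l p r powr \<theta>) * indicator (ball x r \<inter> K) y =
        ennreal (ph n powr (- \<theta>)) * (if dist x y < r then ennreal (\<bar>u x - u y\<bar> powr p) else 0)"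
      using y by (auto simp: space_mu ennreal_mult)
  qed
  also have "\<dots> = ennreal (ph n powr (- \<theta>)) * (\<integral>\<^sup>+y. (if dist x y < r then ennreal (\<bar>u x - u y\<bar> powr p) else 0) \<partial>\<mu>)"
    by (rule nn_integral_cmult) measurable
  finally show ?thesis .
qed

lemma Phi_ge:
  assumes u[measurable]: "u \<in> borel_measurable \<mu>" and r: "2 * h (Suc n) < r" "r \<le> 2 * h n"
  shows "ennreal (ph n powr (- (\<beta>/bs)) / (16 * ps n)) * dd u (4 * h (n + 2)) \<le> Phi l \<mu> p bs \<beta> u r"
proof -
  \<comment> \<open>The factor 4 exceeds the 2 in the definition of the scales. Going down one more
    level compensates for this, since \<open>3 * h (n + 2)\<close> is at most
    \<open>h (n + 1)\<close>.\<close>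
  have hr: "4 * h (n + 2) < r" using h_Suc_le[of "Suc n"] h_pos[of "n + 2"] r by simp
  have "ennreal (ph n powr (- (\<beta>/bs)) / (16 * ps n)) * dd u (4 * h (n + 2)) =
    (\<integral>\<^sup>+x. ennreal (ph n powr (- (\<beta>/bs)) / (16 * ps n)) *
      (\<integral>\<^sup>+y. (if dist x y \<le> 4 * h (n + 2) then ennreal (\<bar>u x - u y\<bar> powr p) else 0) \<partial>\<mu>) \<partial>\<mu>)"
    unfolding dd_def by (rule nn_integral_cmult[symmetric]) measurable
  also have "\<dots> \<le> Phi l \<mu> p bs \<beta> u r"
    unfolding Phi_def
  proof (rule nn_integral_mono)
    fix x assume "x \<in> space \<mu>"
    then have x: "x \<in> K" by (simp add: space_mu)
    let ?g = "\<integral>\<^sup>+y. (if dist x y < r then ennreal (\<bar>u x - u y\<bar> powr p) else 0) \<partial>\<mu>"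
    have "ennreal (ph n powr (- (\<beta>/bs)) / (16 * ps n)) *
      (\<integral>\<^sup>+y. (if dist x y \<le> 4 * h (n + 2) then ennreal (\<bar>u x - u y\<bar> powr p) else 0) \<partial>\<mu>)
      \<le> ennreal (ph n powr (- (\<beta>/bs)) / (16 * ps n)) * ?g"
      using hr by (intro mult_left_mono nn_integral_mono) auto
    also have "\<dots> = ennreal (1 / (16 * ps n)) * (ennreal (ph n powr (- (\<beta>/bs))) * ?g)"
      using ps_pos[of n] by (subst mult.assoc[symmetric], subst ennreal_mult[symmetric]) auto
    also have "\<dots> \<le> 1 / emeasure \<mu> (ball x r \<inter> K) *
        (\<integral>\<^sup>+y\<in>ball x r \<inter> K. ennreal (\<bar>u x - u y\<bar> powr p / phi l p r powr (\<beta> / bs)) \<partial>\<mu>)"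
      unfolding Phi_inner[OF u r x] by (intro mult_right_mono inverse_measure_ball(2)[OF r x]) simp
    finally show "ennreal (ph n powr (- (\<beta>/bs)) / (16 * ps n)) *
      (\<integral>\<^sup>+y. (if dist x y \<le> 4 * h (n + 2) then ennreal (\<bar>u x - u y\<bar> powr p) else 0) \<partial>\<mu>)
      \<le> 1 / emeasure \<mu> (ball x r \<inter> K) *
        (\<integral>\<^sup>+y\<in>ball x r \<inter> K. ennreal (\<bar>u x - u y\<bar> powr p / phi l p r powr (\<beta> / bs)) \<partial>\<mu>)" .
  qed
  finally show ?thesis .
qed

lemma Gam_measurable[measurable]: "Gam u n \<in> borel_measurable \<mu>"
  unfolding Gam_def by measurable

lemma Tm_measurable[measurable]: "Tm lam u m \<in> borel_measurable \<mu>"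
  unfolding Tm_def by measurable

lemma integral_Gam: "(\<integral>\<^sup>+x. ennreal (Gam u n x) \<partial>\<mu>) = ennreal (ps n * en u (Suc n))"
proof -
  have "(\<integral>\<^sup>+x. ennreal (Gam u n x) \<partial>\<mu>) = (\<integral>\<^sup>+x. (\<Sum>w\<in>W n. ennreal (GW u w) * indicator (cl w) x) \<partial>\<mu>)"
    unfolding Gam_def using GW_nonneg
    by (intro nn_integral_cong) (simp add: sum_ennreal[symmetric] ennreal_mult ennreal_indicator)
  also have "\<dots> = (\<Sum>w\<in>W n. ennreal (GW u w) * emeasure \<mu> (cl w))"
    by (subst nn_integral_sum) (auto simp: nn_integral_cmult_indicator)
  also have "\<dots> = (\<Sum>w\<in>W n. ennreal (GW u w * ps n))"
    using GW_nonneg ps_pos[of n] by (intro sum.cong) (auto simp: emeasure_cl ennreal_mult)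
  also have "\<dots> = ennreal (\<Sum>w\<in>W n. GW u w * ps n)"
    using GW_nonneg ps_pos[of n] by (intro sum_ennreal) simp
  also have "(\<Sum>w\<in>W n. GW u w * ps n) = ps n * en u (Suc n)"
    by (simp add: en_Suc sum_distrib_left mult.commute)
  finally show ?thesis .
qed

lemma integral_Tm:
  assumes "0 < lam"
  shows "integral\<^sup>N \<mu> (Tm lam u m) = (\<Sum>j. ennreal (ps (m + j) * en u (Suc (m + j)) / lam ^ j))"
proof -
  have *: "ennreal (Gam u (m + j) x / lam ^ j) = ennreal (1 / lam ^ j) * ennreal (Gam u (m + j) x)" for j x
    using assms Gam_nonneg by (simp flip: ennreal_mult)
  have "integral\<^sup>N \<mu> (Tm lam u m) = (\<Sum>j. \<integral>\<^sup>+x. ennreal (Gam u (m + j) x / lam ^ j) \<partial>\<mu>)"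
    unfolding Tm_def by (rule nn_integral_suminf) measurable
  also have "\<dots> = (\<Sum>j. ennreal (ps (m + j) * en u (Suc (m + j)) / lam ^ j))"
  proof (rule arg_cong[where f=suminf], rule ext)
    fix j
    have "(\<integral>\<^sup>+x. ennreal (Gam u (m + j) x / lam ^ j) \<partial>\<mu>) = ennreal (1 / lam ^ j) * ennreal (ps (m + j) * en u (Suc (m + j)))"
      unfolding * by (subst nn_integral_cmult) (auto simp: integral_Gam)
    also have "\<dots> = ennreal (ps (m + j) * en u (Suc (m + j)) / lam ^ j)"
      using assms ps_pos[of "m + j"] en_nonneg by (simp flip: ennreal_mult)
    finally show "(\<integral>\<^sup>+x. ennreal (Gam u (m + j) x / lam ^ j) \<partial>\<mu>) = ennreal (ps (m + j) * en u (Suc (m + j)) / lam ^ j)" .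
  qed
  finally show ?thesis .
qed

lemma ps_ratio: "ps n \<le> 2 * L * ps (Suc n)"
proof -
  have "ps n = (2 * real (l (Suc n)) - 1) * ps (Suc n)" using two_l[of n] by (simp add: ps_Suc)
  also have "\<dots> \<le> 2 * L * ps (Suc n)" using l_le[of "Suc n"] ps_pos[of "Suc n"] by (intro mult_right_mono) auto
  finally show ?thesis .
qed

text \<open>Passing from Euclidean distance to \<open>norm1\<close> costs the factor 3/2, hence one
  level. For \<open>n = 0\<close> truncated subtraction gives \<open>m = 0\<close>, the trivial
  case.\<close>

lemma near_of_dist:
  assumes "dist x y < 2 * h n" "m = n - 1" shows "m = 0 \<or> norm1 (x - y) < 2 * h m"
proof (cases n)
  case (Suc k)
  have "norm1 (x - y) \<le> 3/2 * dist x y" using norm1_le_cmod2[of "x - y"] by (simp add: dist_norm)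
  then have "norm1 (x - y) < 3 * h n" using assms by simp
  also have "\<dots> \<le> h k" using h_Suc_le[of k] Suc by simp
  finally show ?thesis using assms Suc h_pos[of k] by simp
qed (use assms in simp)

text \<open>The increment between x and y is bounded by \<open>Tm\<close> at x plus
  \<open>Tm\<close> at y. After Fubini's theorem for the second part, each inner integral is over a
  ball of mass at most \<open>16 * ps n\<close>, while the normalisation is at most
  \<open>1 / ps (Suc n)\<close>; the quotient is bounded because \<open>l\<close> is.\<close>

lemma Phi_le:
  assumes lam: "0 < lam" "lam < 1" and u: "continuous_on K u" and r: "2 * h (Suc n) < r" "r \<le> 2 * h n"
  shows "Phi l \<mu> p bs \<beta> u r \<le> ennreal (2 powr p * C_pt lam * (64 * L)) *
    (ennreal (ph n powr (- (\<beta>/bs))) * integral\<^sup>N \<mu> (Tm lam u (n - 1)))"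
proof -
  let ?T = "Tm lam u (n - 1)" and ?c = "ennreal (ph n powr (- (\<beta>/bs)))" and ?C = "ennreal (2 powr p * C_pt lam)"
  have um[measurable]: "u \<in> borel_measurable \<mu>" by (rule continuous_measurable[OF u])
  have ball: "(\<integral>\<^sup>+y. (if dist x y < r then 1 else 0) \<partial>\<mu>) \<le> ennreal (16 * ps n)" for x
  proof -
    have "(\<integral>\<^sup>+y. (if dist x y < r then 1 else 0) \<partial>\<mu>) = (\<integral>\<^sup>+y. indicator (ball x r \<inter> K) y \<partial>\<mu>)"
      by (intro nn_integral_cong) (auto simp: space_mu)
    also have "\<dots> \<le> ennreal (16 * ps n)" using measure_ball_le[OF r(2), of x]
      by (simp add: emeasure_eq_measure ennreal_leI)
    finally show ?thesis .
  qed
  have I1: "(\<integral>\<^sup>+x. \<integral>\<^sup>+y. (if dist x y < r then ?T x else 0) \<partial>\<mu> \<partial>\<mu>) \<le> ennreal (16 * ps n) * integral\<^sup>N \<mu> ?T"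
  proof -
    have "(\<integral>\<^sup>+x. \<integral>\<^sup>+y. (if dist x y < r then ?T x else 0) \<partial>\<mu> \<partial>\<mu>) \<le> (\<integral>\<^sup>+x. ennreal (16 * ps n) * ?T x \<partial>\<mu>)"
    proof (rule nn_integral_mono)
      fix x assume x: "x \<in> space \<mu>"
      have [measurable]: "(\<lambda>y. dist x y) \<in> borel_measurable \<mu>" by (intro measurable_from_borel) auto
      have "(\<integral>\<^sup>+y. (if dist x y < r then ?T x else 0) \<partial>\<mu>) = (\<integral>\<^sup>+y. ?T x * (if dist x y < r then 1 else 0) \<partial>\<mu>)"
        by (intro nn_integral_cong) auto
      also have "\<dots> = ?T x * (\<integral>\<^sup>+y. (if dist x y < r then 1 else 0) \<partial>\<mu>)" by (rule nn_integral_cmult) measurable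
      also have "\<dots> \<le> ?T x * ennreal (16 * ps n)" by (intro mult_left_mono ball) simp
      finally show "(\<integral>\<^sup>+y. (if dist x y < r then ?T x else 0) \<partial>\<mu>) \<le> ennreal (16 * ps n) * ?T x"
        by (simp add: mult.commute)
    qed
    also have "\<dots> = ennreal (16 * ps n) * integral\<^sup>N \<mu> ?T" by (rule nn_integral_cmult) measurable
    finally show ?thesis .
  qed
  have I2: "(\<integral>\<^sup>+x. \<integral>\<^sup>+y. (if dist x y < r then ?T y else 0) \<partial>\<mu> \<partial>\<mu>) \<le> ennreal (16 * ps n) * integral\<^sup>N \<mu> ?T"
  proof -
    have "(\<integral>\<^sup>+x. \<integral>\<^sup>+y. (if dist x y < r then ?T y else 0) \<partial>\<mu> \<partial>\<mu>) = (\<integral>\<^sup>+y. \<integral>\<^sup>+x. (if dist x y < r then ?T y else 0) \<partial>\<mu> \<partial>\<mu>)"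
      by (rule PP.Fubini'[symmetric]) measurable
    then show ?thesis using I1 by (simp add: dist_commute)
  qed
  have "Phi l \<mu> p bs \<beta> u r \<le> (\<integral>\<^sup>+x. ennreal (1 / ps (Suc n)) * (?c * (\<integral>\<^sup>+y. (if dist x y < r then ennreal (\<bar>u x - u y\<bar> powr p) else 0) \<partial>\<mu>)) \<partial>\<mu>)"
    unfolding Phi_def
    by (intro nn_integral_mono) (auto simp: space_mu Phi_inner[OF um r] intro!: mult_right_mono inverse_measure_ball(1)[OF r])
  also have "\<dots> = ennreal (1 / ps (Suc n)) * (?c * (\<integral>\<^sup>+x. \<integral>\<^sup>+y. (if dist x y < r then ennreal (\<bar>u x - u y\<bar> powr p) else 0) \<partial>\<mu> \<partial>\<mu>))"
    by (simp add: nn_integral_cmult)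
  also have "(\<integral>\<^sup>+x. \<integral>\<^sup>+y. (if dist x y < r then ennreal (\<bar>u x - u y\<bar> powr p) else 0) \<partial>\<mu> \<partial>\<mu>) \<le>
    (\<integral>\<^sup>+x. \<integral>\<^sup>+y. ?C * ((if dist x y < r then ?T x else 0) + (if dist x y < r then ?T y else 0)) \<partial>\<mu> \<partial>\<mu>)"
  proof (intro nn_integral_mono)
    fix x y assume xy: "x \<in> space \<mu>" "y \<in> space \<mu>"
    show "(if dist x y < r then ennreal (\<bar>u x - u y\<bar> powr p) else 0) \<le>
      ?C * ((if dist x y < r then ?T x else 0) + (if dist x y < r then ?T y else 0))"
      using near_points_le[OF lam u, of x y "n - 1"] near_of_dist[of x y n] xy r by (auto simp: space_mu)
  qed
  also have "\<dots> = ?C * ((\<integral>\<^sup>+x. \<integral>\<^sup>+y. (if dist x y < r then ?T x else 0) \<partial>\<mu> \<partial>\<mu>) + (\<integral>\<^sup>+x. \<integral>\<^sup>+y. (if dist x y < r then ?T y else 0) \<partial>\<mu> \<partial>\<mu>))"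
  proof -
    have "(\<integral>\<^sup>+y. ?C * ((if dist x y < r then ?T x else 0) + (if dist x y < r then ?T y else 0)) \<partial>\<mu>) =
      ?C * ((\<integral>\<^sup>+y. (if dist x y < r then ?T x else 0) \<partial>\<mu>) + (\<integral>\<^sup>+y. (if dist x y < r then ?T y else 0) \<partial>\<mu>))" for x
    proof -
      have [measurable]: "(\<lambda>y. dist x y) \<in> borel_measurable \<mu>" by (intro measurable_from_borel) auto
      show ?thesis by (subst nn_integral_cmult, measurable) (subst nn_integral_add, auto)
    qed
    then show ?thesis by (simp only:) (subst nn_integral_cmult, measurable, subst nn_integral_add, auto)
  qed
  also have "\<dots> \<le> ?C * (ennreal (16 * ps n) * integral\<^sup>N \<mu> ?T + ennreal (16 * ps n) * integral\<^sup>N \<mu> ?T)"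
    by (intro mult_left_mono add_mono I1 I2) simp
  also have "\<dots> = ?C * (ennreal (32 * ps n) * integral\<^sup>N \<mu> ?T)"
  proof -
    have "ennreal (32 * ps n) = ennreal (16 * ps n) + ennreal (16 * ps n)"
      using ps_pos[of n] by (simp flip: ennreal_plus)
    then show ?thesis by (simp add: distrib_right)
  qed
  finally have "Phi l \<mu> p bs \<beta> u r \<le> ennreal (1 / ps (Suc n)) * (?c * (?C * (ennreal (32 * ps n) * integral\<^sup>N \<mu> ?T)))"
    by (simp add: mult_left_mono)
  also have "\<dots> = ?C * (ennreal (1 / ps (Suc n)) * ennreal (32 * ps n)) * (?c * integral\<^sup>N \<mu> ?T)"
    by (simp add: mult_ac)
  also have "\<dots> \<le> ?C * ennreal (64 * L) * (?c * integral\<^sup>N \<mu> ?T)"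
  proof (intro mult_right_mono mult_left_mono)
    have "ennreal (1 / ps (Suc n)) * ennreal (32 * ps n) = ennreal (1 / ps (Suc n) * (32 * ps n))"
      using ps_pos by (intro ennreal_mult[symmetric]) (auto intro: less_imp_le)
    also have "\<dots> \<le> ennreal (64 * L)"
      using ps_ratio[of n] ps_pos[of "Suc n"] by (intro ennreal_leI) (simp add: field_simps)
    finally show "ennreal (1 / ps (Suc n)) * ennreal (32 * ps n) \<le> ennreal (64 * L)" .
  qed auto
  also have "?C * ennreal (64 * L) = ennreal (2 powr p * C_pt lam * (64 * L))"
    using C_pt_nonneg L_ge3 by (intro ennreal_mult[symmetric]) auto
  finally show ?thesis .
qed

section \<open>Averages over cells\<close>

definition avg :: "(complex \<Rightarrow> real) \<Rightarrow> complex list \<Rightarrow> real" where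
  "avg u w = (\<integral>x. indicator (cl w) x * u x \<partial>\<mu>) / measure \<mu> (cl w)"

lemma avg_point_le:
  assumes "integrable \<mu> u" "w \<in> W n"
  shows "ennreal (\<bar>c - avg u w\<bar> powr p) \<le> ennreal (2 powr p / ps n) * (\<integral>\<^sup>+x. ennreal (\<bar>c - u x\<bar> powr p) * indicator (cl w) x \<partial>\<mu>)"
  using powr_average_le[OF assms(1) cl_sets, of w p c] p ps_pos[of n] measure_cl[OF assms(2)]
  by (simp add: avg_def)

text \<open>The averaging inequality is used twice: on the cell \<open>w\<close> against the
  constant \<open>avg u w'\<close>, and then on \<open>w'\<close> against the constant
  \<open>u x\<close>. Hence \<open>4 powr p\<close>.\<close>

lemma avg_diff_le:
  assumes u: "integrable \<mu> u" and w: "w \<in> W n" "w' \<in> W k"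
  shows "ennreal (\<bar>avg u w' - avg u w\<bar> powr p) \<le> ennreal (4 powr p / (ps n * ps k)) *
    (\<integral>\<^sup>+x. (\<integral>\<^sup>+y. ennreal (\<bar>u x - u y\<bar> powr p) * indicator (cl w') y \<partial>\<mu>) * indicator (cl w) x \<partial>\<mu>)"
proof -
  have [measurable]: "u \<in> borel_measurable \<mu>" using u by simp
  let ?I = "\<lambda>x. \<integral>\<^sup>+y. ennreal (\<bar>u x - u y\<bar> powr p) * indicator (cl w') y \<partial>\<mu>"
  have "ennreal (\<bar>avg u w' - avg u w\<bar> powr p) \<le> ennreal (2 powr p / ps n) * (\<integral>\<^sup>+x. ennreal (\<bar>avg u w' - u x\<bar> powr p) * indicator (cl w) x \<partial>\<mu>)"
    by (rule avg_point_le[OF u w(1)])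
  also have "\<dots> \<le> ennreal (2 powr p / ps n) * (\<integral>\<^sup>+x. ennreal (2 powr p / ps k) * (?I x * indicator (cl w) x) \<partial>\<mu>)"
  proof (intro mult_left_mono nn_integral_mono)
    fix x
    show "ennreal (\<bar>avg u w' - u x\<bar> powr p) * indicator (cl w) x \<le> ennreal (2 powr p / ps k) * (?I x * indicator (cl w) x)"
      using mult_right_mono[OF avg_point_le[OF u w(2), of "u x"], of "indicator (cl w) x"]
      by (simp add: abs_minus_commute mult.assoc)
  qed simp
  also have "\<dots> = ennreal (2 powr p / ps n) * (ennreal (2 powr p / ps k) * (\<integral>\<^sup>+x. ?I x * indicator (cl w) x \<partial>\<mu>))"
    by (subst nn_integral_cmult) auto
  also have "\<dots> = ennreal (4 powr p / (ps n * ps k)) * (\<integral>\<^sup>+x. ?I x * indicator (cl w) x \<partial>\<mu>)"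
  proof -
    have "2 powr p / ps n * (2 powr p / ps k) = 4 powr p / (ps n * ps k)"
      by (simp flip: powr_mult)
    then show ?thesis using ps_pos[of n] ps_pos[of k]
      by (simp add: mult.assoc[symmetric] ennreal_mult[symmetric])
  qed
  finally show ?thesis .
qed

lemma continuous_bounded_integrable:
  assumes u: "continuous_on K u" shows "integrable \<mu> (u :: complex \<Rightarrow> real)"
proof -
  obtain B where "\<And>x. x \<in> K \<Longrightarrow> norm (u x) \<le> B"
    using compact_continuous_image[OF u compact_K] compact_imp_bounded bounded_iff by (metis imageI)
  then show ?thesis
    by (intro integrable_const_bound[where B=B] continuous_measurable[OF u]) (auto simp: space_mu)
qed

text \<open>The cells shrinking to the vertex \<open>ctr w + h n * e\<close> of a cell; \<open>e = 0\<close> gives its center.\<close>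

primrec ext :: "complex \<Rightarrow> complex list \<Rightarrow> nat \<Rightarrow> complex list" where
  "ext e w 0 = w"
| "ext e w (Suc j) = ext e w j @ [of_real (1 - 1 / real (l (Suc (length w + j)))) * e]"

lemma ext_W: "w \<in> W n \<Longrightarrow> e \<in> insert 0 dirs \<Longrightarrow> ext e w j \<in> W (n + j)"
proof (induction j)
  case (Suc j)
  have "of_real (1 - 1 / real (l (Suc (n + j)))) * e \<in> S_set (l (Suc (n + j)))"
    using Suc.prems(2) S_set_end[OF l_odd] S_set_0 by auto
  then show ?case using W_snoc[OF Suc.IH] Suc.prems W_length[of w n] by simp
qed simp

lemma ext_snoc_ctr:
  assumes "w \<in> W n" "e \<in> insert 0 dirs"
  shows "ctr (ext e w j) + of_real (h (n + j)) * e = ctr w + of_real (h n) * e"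
proof (induction j)
  case (Suc j)
  then show ?case using corner_snoc[OF ext_W[OF assms, of j], of e] W_length[OF assms(1)] by simp
qed simp

lemma ext_inj: "ext e w j = ext e w' j \<Longrightarrow> w = w'"
  by (induction j) auto

lemma ext_box_subset: 
  assumes "w \<in> W n" "e \<in> insert 0 dirs" shows "box (ext e w (Suc j)) \<subseteq> box (ext e w j)"
proof -
  have "of_real (1 - 1 / real (l (Suc (n + j)))) * e \<in> S_set (l (Suc (n + j)))"
    using assms(2) S_set_end[OF l_odd] S_set_0 by auto
  then show ?thesis using box_snoc_subset[OF ext_W[OF assms, of j]] W_length[OF assms(1)] by simp
qed

lemma vertex_in_ext:
  assumes "w \<in> W n" "e \<in> insert 0 dirs" shows "ctr w + of_real (h n) * e \<in> box (ext e w j)"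
  using corner_in_box[of e "ext e w j"] ctr_in_box[of "ext e w j"] assms W_length[OF ext_W[OF assms, of j]]
  unfolding ext_snoc_ctr[OF assms, of j, symmetric] by auto

lemma vertex_in_K:
  assumes "w \<in> W n" "e \<in> insert 0 dirs" shows "ctr w + of_real (h n) * e \<in> K"
  using verts_in_K[OF assms(1)] assms(2) by (auto simp: verts_def W_length[OF assms(1)])

lemma avg_ext_limit:
  assumes u: "continuous_on K u" and w: "w \<in> W n" "e \<in> insert 0 dirs"
  shows "(\<lambda>j. avg u (ext e w j)) \<longlonglongrightarrow> u (ctr w + of_real (h n) * e)"
proof (rule tendstoI)
  fix r :: real assume r: "0 < r"
  let ?z = "ctr w + of_real (h n) * e"
  note ui = continuous_bounded_integrable[OF u]
  \<comment> \<open>The averaging inequality carries the factor \<open>2 powr p\<close>, so an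
    oscillation of \<open>r / 4\<close> gives a distance of \<open>r / 2\<close>.\<close>
  obtain d where d: "0 < d" "\<And>x. x \<in> K \<Longrightarrow> dist x ?z < d \<Longrightarrow> dist (u x) (u ?z) < r / 4"
    using u[unfolded continuous_on_iff] vertex_in_K[OF w] r by (metis zero_less_divide_iff zero_less_numeral)
  have ev: "\<forall>\<^sub>F j in sequentially. h (n + j) < d / 2"
    using order_tendstoD(2)[OF LIMSEQ_ignore_initial_segment[OF h_tendsto_0, of n], of "d/2"] d(1)
    by (simp add: add.commute)
  show "\<forall>\<^sub>F j in sequentially. dist (avg u (ext e w j)) (u ?z) < r"
    using ev
  proof eventually_elim
    case (elim j)
    let ?v = "ext e w j"
    have v: "?v \<in> W (n + j)" by (rule ext_W[OF w])
    have "ennreal (\<bar>u ?z - avg u ?v\<bar> powr p) \<le> ennreal (2 powr p / ps (n + j)) * (\<integral>\<^sup>+x. ennreal (\<bar>u ?z - u x\<bar> powr p) * indicator (cl ?v) x \<partial>\<mu>)"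
      by (rule avg_point_le[OF ui v])
    also have "\<dots> \<le> ennreal (2 powr p / ps (n + j)) * (\<integral>\<^sup>+x. ennreal ((r/4) powr p) * indicator (cl ?v) x \<partial>\<mu>)"
    proof (intro mult_left_mono nn_integral_mono)
      fix x
      show "ennreal (\<bar>u ?z - u x\<bar> powr p) * indicator (cl ?v) x \<le> ennreal ((r/4) powr p) * indicator (cl ?v) x"
      proof (cases "x \<in> cl ?v")
        case True
        then have "dist x ?z < d" using box_dist[OF _ vertex_in_ext[OF w], of x j] W_length[OF v] elim by simp
        then have "\<bar>u ?z - u x\<bar> \<le> r / 4" using d(2)[of x] True abs_minus_commute[of "u x"] by (simp add: dist_real_def)
        then have "\<bar>u ?z - u x\<bar> powr p \<le> (r / 4) powr p" using p by (intro powr_mono2) auto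
        then show ?thesis using True by (simp add: ennreal_leI)
      qed simp
    qed simp
    also have "\<dots> = ennreal (2 powr p / ps (n + j)) * (ennreal ((r/4) powr p) * ennreal (ps (n + j)))"
      by (subst nn_integral_cmult_indicator) (auto simp: emeasure_cl[OF v])
    also have "\<dots> = ennreal (2 powr p * (r/4) powr p)"
      using ps_pos[of "n + j"] by (simp flip: ennreal_mult)
    also have "2 powr p * (r/4) powr p = (r/2) powr p" by (simp flip: powr_mult)
    finally have "\<bar>u ?z - avg u ?v\<bar> powr p \<le> (r/2) powr p" by (subst (asm) ennreal_le_iff) auto
    then have "\<bar>u ?z - avg u ?v\<bar> \<le> r / 2"
      using p r powr_less_mono2[of p "r/2" "\<bar>u ?z - avg u ?v\<bar>"] by (meson not_le less_imp_le le_less_trans zero_less_one half_gt_zero)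
    then show ?case using r by (simp add: dist_real_def abs_minus_commute)
  qed
qed

definition C_av :: "real \<Rightarrow> real" where "C_av lam = (1 / (1 - lam powr (1/p))) powr p"

definition cellI :: "(complex \<Rightarrow> real) \<Rightarrow> complex list \<Rightarrow> ennreal" where
  "cellI u w = (\<integral>\<^sup>+x. (\<integral>\<^sup>+y. ennreal (\<bar>u x - u y\<bar> powr p) * indicator (cl w) y \<partial>\<mu>) * indicator (cl w) x \<partial>\<mu>)"

text \<open>The constant of \<open>avg_diff_le\<close> between the levels \<open>n + j\<close> and
  \<open>Suc (n + j)\<close>, divided by the weight of the \<open>j\<close>-th increment in the
  telescoping lemma.\<close>

definition chain_weight :: "real \<Rightarrow> nat \<Rightarrow> nat \<Rightarrow> real" where
  "chain_weight lam n j = 4 powr p / (ps (n + j) * ps (Suc (n + j))) / lam ^ j"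

lemma vertex_avg_le:
  assumes lam: "0 < lam" "lam < 1" and u: "continuous_on K u" and w: "w \<in> W n" "e \<in> insert 0 dirs"
  shows "ennreal (\<bar>u (ctr w + of_real (h n) * e) - avg u w\<bar> powr p) \<le>
    ennreal (C_av lam) * (\<Sum>j. ennreal (chain_weight lam n j) * cellI u (ext e w j))"
proof -
  have p0: "0 < p" using p by simp
  have "ennreal (\<bar>u (ctr w + of_real (h n) * e) - avg u w\<bar> powr p) \<le> ennreal (C_av lam) *
    (\<Sum>j. ennreal (\<bar>avg u (ext e w (Suc j)) - avg u (ext e w j)\<bar> powr p / lam ^ j))"
    using weighted_powr_sum_limit[OF lam p0 avg_ext_limit[OF u w]] by (simp add: C_av_def)
  also have "\<dots> \<le> ennreal (C_av lam) * (\<Sum>j. ennreal (chain_weight lam n j) * cellI u (ext e w j))"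
  proof (intro mult_left_mono suminf_le)
    fix j
    let ?v = "ext e w j" and ?v' = "ext e w (Suc j)"
    have v: "?v \<in> W (n + j)" "?v' \<in> W (Suc (n + j))" using ext_W[OF w, of j] ext_W[OF w, of "Suc j"] by auto
    have "ennreal (\<bar>avg u ?v' - avg u ?v\<bar> powr p / lam ^ j) = ennreal (1 / lam ^ j) * ennreal (\<bar>avg u ?v' - avg u ?v\<bar> powr p)"
      using lam by (simp flip: ennreal_mult)
    also have "\<dots> \<le> ennreal (1 / lam ^ j) * (ennreal (4 powr p / (ps (n + j) * ps (Suc (n + j)))) *
        (\<integral>\<^sup>+x. (\<integral>\<^sup>+y. ennreal (\<bar>u x - u y\<bar> powr p) * indicator (cl ?v') y \<partial>\<mu>) * indicator (cl ?v) x \<partial>\<mu>))"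
      by (intro mult_left_mono avg_diff_le[OF continuous_bounded_integrable[OF u] v]) simp
    also have "\<dots> \<le> ennreal (1 / lam ^ j) * (ennreal (4 powr p / (ps (n + j) * ps (Suc (n + j)))) * cellI u ?v)"
      unfolding cellI_def using ext_box_subset[OF w, of j]
      by (intro mult_left_mono nn_integral_mono mult_right_mono) (auto split: split_indicator)
    also have "\<dots> = ennreal (chain_weight lam n j) * cellI u ?v"
      unfolding chain_weight_def mult.assoc[symmetric] using lam ps_pos
      by (subst ennreal_mult[symmetric]) (auto intro!: less_imp_le simp: mult_ac)
    finally show "ennreal (\<bar>avg u ?v' - avg u ?v\<bar> powr p / lam ^ j) \<le> ennreal (chain_weight lam n j) * cellI u ?v" .
  qed auto
  finally show ?thesis .
qed

text \<open>Distinct words have distinct extensions, so the left side runs over different cells of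
  level \<open>n + j\<close>. As cells are disjoint up to null sets, no multiplicity
  appears.\<close>

lemma sum_ext_cellI:
  assumes u: "u \<in> borel_measurable \<mu>" and e: "e \<in> insert 0 dirs"
  shows "(\<Sum>w\<in>W n. cellI u (ext e w j)) \<le> dd u (4 * h (n + j))"
proof -
  have "(\<Sum>w\<in>W n. cellI u (ext e w j)) = (\<Sum>v\<in>(\<lambda>w. ext e w j) ` W n. cellI u v)"
    by (subst sum.reindex) (auto intro: inj_onI ext_inj)
  also have "\<dots> \<le> (\<Sum>v\<in>W (n + j). cellI u v)"
    using ext_W e finite_W by (intro sum_mono2) auto
  also have "\<dots> \<le> dd u (2 * h (n + j))" unfolding cellI_def by (rule dd_cells[OF u])
  also have "\<dots> \<le> dd u (4 * h (n + j))" using h_pos[of "n + j"] by (intro dd_mono) simp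
  finally show ?thesis .
qed

text \<open>The values at the two ends of an edge, a center and a corner, are both compared with the
  average over the cell. Four directions with two terms each give the 8.\<close>

lemma en_le_dd:
  assumes lam: "0 < lam" "lam < 1" and u: "continuous_on K u"
  shows "ennreal (en u n) \<le> ennreal (8 * 2 powr p * C_av lam) * (\<Sum>j. ennreal (chain_weight lam n j) * dd u (4 * h (n + j)))"
proof -
  have um: "u \<in> borel_measurable \<mu>" by (rule continuous_measurable[OF u])
  let ?Z = "\<Sum>j. ennreal (chain_weight lam n j) * dd u (4 * h (n + j))"
  let ?X = "\<lambda>e w. ennreal (\<bar>u (ctr w + of_real (h n) * e) - avg u w\<bar> powr p)"
  have X: "(\<Sum>w\<in>W n. ?X e w) \<le> ennreal (C_av lam) * ?Z" if e: "e \<in> insert 0 dirs" for e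
  proof -
    have "(\<Sum>w\<in>W n. ?X e w) \<le> (\<Sum>w\<in>W n. ennreal (C_av lam) * (\<Sum>j. ennreal (chain_weight lam n j) * cellI u (ext e w j)))"
      by (intro sum_mono vertex_avg_le[OF lam u _ e])
    also have "\<dots> = ennreal (C_av lam) * (\<Sum>j. \<Sum>w\<in>W n. ennreal (chain_weight lam n j) * cellI u (ext e w j))"
      by (subst suminf_sum) (auto simp: sum_distrib_left)
    also have "\<dots> \<le> ennreal (C_av lam) * ?Z"
      unfolding sum_distrib_left[symmetric]
      by (intro mult_left_mono suminf_le sum_ext_cellI[OF um e]) auto
    finally show ?thesis .
  qed
  have eW: "ennreal (eW u w) \<le> ennreal (2 powr p) * (\<Sum>e\<in>dirs. ?X 0 w + ?X e w)" if w: "w \<in> W n" for w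
  proof -
    have "eW u w \<le> (\<Sum>e\<in>dirs. 2 powr p * (\<bar>u (ctr w + of_real (h n) * 0) - avg u w\<bar> powr p + \<bar>u (ctr w + of_real (h n) * e) - avg u w\<bar> powr p))"
      unfolding eW_def W_length[OF w] using p by (intro sum_mono add_powr_le) auto
    also have "\<dots> = 2 powr p * (\<Sum>e\<in>dirs. \<bar>u (ctr w + of_real (h n) * 0) - avg u w\<bar> powr p + \<bar>u (ctr w + of_real (h n) * e) - avg u w\<bar> powr p)"
      by (rule sum_distrib_left[symmetric])
    finally have "ennreal (eW u w) \<le> ennreal (2 powr p * (\<Sum>e\<in>dirs. \<bar>u (ctr w + of_real (h n) * 0) - avg u w\<bar> powr p + \<bar>u (ctr w + of_real (h n) * e) - avg u w\<bar> powr p))"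
      by (rule ennreal_leI)
    also have "\<dots> = ennreal (2 powr p) * (\<Sum>e\<in>dirs. ?X 0 w + ?X e w)"
      by (subst ennreal_mult) (auto intro: sum_nonneg simp flip: sum_ennreal ennreal_plus)
    finally show ?thesis .
  qed
  have "ennreal (en u n) = (\<Sum>w\<in>W n. ennreal (eW u w))"
    unfolding en_def by (rule sum_ennreal[symmetric]) (rule eW_nonneg)
  also have "\<dots> \<le> (\<Sum>w\<in>W n. ennreal (2 powr p) * (\<Sum>e\<in>dirs. ?X 0 w + ?X e w))"
    by (intro sum_mono eW)
  also have "\<dots> = ennreal (2 powr p) * (\<Sum>e\<in>dirs. (\<Sum>w\<in>W n. ?X 0 w) + (\<Sum>w\<in>W n. ?X e w))"
    unfolding sum_distrib_left[symmetric] by (subst sum.swap) (simp only: sum.distrib)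
  also have "\<dots> \<le> ennreal (2 powr p) * (\<Sum>e\<in>dirs. ennreal (C_av lam) * ?Z + ennreal (C_av lam) * ?Z)"
    by (intro mult_left_mono sum_mono add_mono X) auto
  also have "\<dots> = ennreal (2 powr p) * (8 * (ennreal (C_av lam) * ?Z))"
    by (simp add: dirs_card flip: mult_2)
  also have "\<dots> = ennreal (8 * 2 powr p * C_av lam) * ?Z"
    by (simp add: ennreal_mult C_av_def mult_ac)
  finally show ?thesis .
qed

end

context vicsek_energy
begin

section \<open>Comparison of energies and Besov norms\<close>

text \<open>The per-step decay rate; it comes from \<open>2 l - 1 \<le> l\<^sup>2\<close> and is less than \<open>1\<close> exactly if
  \<open>t > 2 / (p + 1)\<close>.\<close>

definition sig :: "real \<Rightarrow> real" where "sig t = 3 powr (2 - (p + 1) * t)"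
definition lam :: "real \<Rightarrow> real" where "lam t = sqrt (sig t)"

lemma lam_bounds: assumes "2 / (p + 1) < t" shows "0 < lam t" "lam t < 1" "lam t * lam t = sig t" "0 < sig t"
proof -
  have "2 < (p + 1) * t" using assms p by (simp add: pos_divide_less_eq mult.commute)
  then have "sig t < 3 powr 0" unfolding sig_def by (intro powr_less_mono) auto
  then show "lam t < 1" by (simp add: lam_def)
  show "0 < lam t" "lam t * lam t = sig t" "0 < sig t" by (auto simp: lam_def sig_def)
qed

lemma ph_Suc: "ph (Suc n) = ph n * (real (l (Suc n)) powr (- (p - 1)) / (2 * real (l (Suc n)) - 1))"
proof -
  have "2 * h (Suc n) = (2 * h n) / real (l (Suc n))" by (simp add: h_Suc)
  then have "(2 * h (Suc n)) powr (p - 1) = (2 * h n) powr (p - 1) * real (l (Suc n)) powr (- (p - 1))"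
    unfolding powr_minus_divide by (simp only:) (simp add: powr_divide)
  then show ?thesis by (simp add: ph_def ps_Suc)
qed

text \<open>With \<open>b\<close> the ratio of consecutive values of \<open>ph\<close>, the claim is
  that \<open>b powr \<theta> * (2 * m - 1)\<close> is at most \<open>sig t\<close>. As
  \<open>b\<close> is at most 1, the exponent may be lowered to \<open>t\<close>; as
  \<open>1 - t\<close> is nonnegative, \<open>2 * m - 1\<close> may be replaced by
  \<open>m powr 2\<close>; and as \<open>2 - (p + 1) * t\<close> is negative, \<open>m\<close> may
  be lowered to 3.\<close>

lemma ratio_step:
  assumes t: "2 / (p + 1) < t" "t \<le> 1" "t \<le> \<theta>"
  shows "ph (Suc n) powr \<theta> * ps n \<le> sig t * (ph n powr \<theta> * ps (Suc n))"
proof -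
  define m where "m = real (l (Suc n))"
  have m: "3 \<le> m" using l_ge3[of n] by (simp add: m_def)
  define b where "b = m powr (- (p - 1)) / (2 * m - 1)"
  have t0: "0 \<le> t" using t(1) p by (smt (verit) divide_nonneg_nonneg)
  have b: "0 < b" "b \<le> 1"
  proof -
    have "m powr (- (p - 1)) \<le> m powr 0" using m p by (intro powr_mono) auto
    then show "0 < b" "b \<le> 1" using m by (auto simp: b_def)
  qed
  have "b powr \<theta> * (2 * m - 1) \<le> b powr t * (2 * m - 1)"
    using b m t by (intro mult_right_mono powr_mono') auto
  also have "\<dots> = m powr (- (p - 1) * t) * (2 * m - 1) powr (1 - t)"
  proof -
    have "b powr t = m powr (- (p - 1) * t) / (2 * m - 1) powr t" by (simp only: b_def powr_divide powr_powr)
    moreover have "(2 * m - 1) powr (1 - t) = (2 * m - 1) / (2 * m - 1) powr t" using m by (simp add: powr_diff)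
    ultimately show ?thesis by (simp only: times_divide_eq_left times_divide_eq_right)
  qed
  also have "\<dots> \<le> m powr (- (p - 1) * t) * (m powr 2) powr (1 - t)"
  proof (intro mult_left_mono powr_mono2)
    have "0 \<le> (m - 1)\<^sup>2" by simp
    then show "2 * m - 1 \<le> m powr 2" using m by (simp add: power2_eq_square algebra_simps)
  qed (use t m in auto)
  also have "\<dots> = m powr (- (p - 1) * t + 2 * (1 - t))" by (simp add: powr_powr powr_add)
  also have "- (p - 1) * t + 2 * (1 - t) = 2 - (p + 1) * t" by (simp add: algebra_simps)
  also have "m powr (2 - (p + 1) * t) \<le> 3 powr (2 - (p + 1) * t)"
  proof (rule powr_mono2')
    have "2 < (p + 1) * t" using t p by (simp add: pos_divide_less_eq mult.commute)
    then show "2 - (p + 1) * t \<le> 0" by simp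
  qed (use m in auto)
  finally have *: "b powr \<theta> * (2 * m - 1) \<le> sig t" by (simp add: sig_def)
  have "ps n = (2 * m - 1) * ps (Suc n)" using two_l[of n] by (simp add: ps_Suc m_def)
  moreover have "ph (Suc n) powr \<theta> = ph n powr \<theta> * b powr \<theta>"
    unfolding ph_Suc m_def[symmetric] b_def[symmetric] using ph_pos[of n] b by (simp add: powr_mult)
  ultimately have "ph (Suc n) powr \<theta> * ps n = (b powr \<theta> * (2 * m - 1)) * (ph n powr \<theta> * ps (Suc n))"
    by (simp add: mult_ac)
  also have "\<dots> \<le> sig t * (ph n powr \<theta> * ps (Suc n))"
    using * ps_pos[of "Suc n"] by (intro mult_right_mono) auto
  finally show ?thesis .
qed

lemma ratio_bound:
  assumes t: "2 / (p + 1) < t" "t \<le> 1" "t \<le> \<theta>"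
  shows "ph (n + j) powr \<theta> * ps n \<le> sig t ^ j * (ph n powr \<theta> * ps (n + j))"
proof (induction j)
  case (Suc j)
  have pp: "0 < ps n" "0 < ps (n + j)" "0 < ps (Suc (n + j))" using ps_pos by auto
  have "ph (Suc (n + j)) powr \<theta> * ps n * ps (n + j) \<le> sig t * (ph (n + j) powr \<theta> * ps (Suc (n + j))) * ps n"
    using mult_right_mono[OF ratio_step[OF t, of "n + j"], of "ps n"] pp by (simp add: mult_ac)
  also have "\<dots> = sig t * ps (Suc (n + j)) * (ph (n + j) powr \<theta> * ps n)" by (simp add: mult_ac)
  also have "\<dots> \<le> sig t * ps (Suc (n + j)) * (sig t ^ j * (ph n powr \<theta> * ps (n + j)))"
    using pp lam_bounds(4)[OF t(1)] by (intro mult_left_mono Suc) auto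
  also have "\<dots> = sig t ^ Suc j * (ph n powr \<theta> * ps (Suc (n + j))) * ps (n + j)" by (simp add: mult_ac)
  finally show ?case using pp(2) by simp
qed simp

lemma ps_antimono: "m \<le> n \<Longrightarrow> ps n \<le> ps m"
proof (rule lift_Suc_antimono_le[where f=ps])
  fix n show "ps (Suc n) \<le> ps n" using two_l[of n] ps_pos[of n] by (simp add: ps_Suc divide_le_eq)
qed

lemma ratio_bound_ph:
  assumes t: "2 / (p + 1) < t" "t \<le> 1" "t \<le> \<theta>"
  shows "ph (n + j) powr \<theta> \<le> sig t ^ j * ph n powr \<theta>"
proof -
  have "ph (n + j) powr \<theta> * ps n \<le> sig t ^ j * (ph n powr \<theta> * ps (n + j))" by (rule ratio_bound[OF t])
  also have "\<dots> \<le> sig t ^ j * (ph n powr \<theta> * ps n)"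
    using lam_bounds(4)[OF t(1)] ps_antimono[of n "n + j"] by (intro mult_left_mono) auto
  finally show ?thesis using ps_pos[of n] by (simp add: mult.assoc[symmetric])
qed

lemma ph_antimono: "m \<le> n \<Longrightarrow> ph n \<le> ph m"
  unfolding ph_def using h_decseq h_pos p ps_antimono ps_pos
  by (intro mult_mono powr_mono2) (auto intro: less_imp_le)

lemma ph_ratio: "ph n \<le> (2 * L * L powr (p - 1)) * ph (Suc n)"
proof -
  let ?m = "real (l (Suc n))"
  have m: "3 \<le> ?m" "?m \<le> L" using l_ge3[of n] l_le by auto
  have "ph n = ((2 * ?m - 1) * ?m powr (p - 1)) * ph (Suc n)"
    using m unfolding ph_Suc powr_minus_divide by simp
  also have "\<dots> \<le> (2 * L * L powr (p - 1)) * ph (Suc n)"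
    using m p ph_pos[of "Suc n"] by (intro mult_right_mono mult_mono powr_mono2) auto
  finally show ?thesis .
qed

definition EE :: "real \<Rightarrow> (complex \<Rightarrow> real) \<Rightarrow> nat \<Rightarrow> ennreal" where
  "EE \<theta> u n = ennreal (ph n powr (- \<theta>) * ps n * en u n)"

lemma E_level_EE: "ennreal (E_level l p bs \<beta> n u) = EE (\<beta> / bs) u n"
  by (simp add: E_level_eq EE_def)

lemma EE_le_Suc:
  assumes "0 \<le> \<theta>" shows "EE \<theta> u n \<le> ennreal (2 * L * L powr (p - 1)) * EE \<theta> u (Suc n)"
proof -
  have "ph n powr (- \<theta>) \<le> ph (Suc n) powr (- \<theta>)"
    using assms ph_pos[of "Suc n"] ph_antimono[of n "Suc n"] by (intro powr_mono2') auto
  moreover have "ps n \<le> 2 * L * ps (Suc n)"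
  proof -
    have "ps n = (2 * real (l (Suc n)) - 1) * ps (Suc n)" using two_l[of n] by (simp add: ps_Suc)
    also have "\<dots> \<le> 2 * L * ps (Suc n)" using l_le[of "Suc n"] ps_pos[of "Suc n"] by (intro mult_right_mono) auto
    finally show ?thesis .
  qed
  moreover have "en u n \<le> L powr (p - 1) * en u (Suc n)"
    using en_le_Suc[of u n] mult_right_mono[OF l_powr_le en_nonneg, of "Suc n" u "Suc n"] by simp
  ultimately have "ph n powr (- \<theta>) * ps n * en u n \<le> ph (Suc n) powr (- \<theta>) * (2 * L * ps (Suc n)) * (L powr (p - 1) * en u (Suc n))"
    using ps_pos[of n] ps_pos[of "Suc n"] en_nonneg[of u n] L_ge3 by (intro mult_mono) (auto intro!: mult_nonneg_nonneg)
  then have "ennreal (ph n powr (- \<theta>) * ps n * en u n) \<le> ennreal ((2 * L * L powr (p - 1)) * (ph (Suc n) powr (- \<theta>) * ps (Suc n) * en u (Suc n)))"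
    by (intro ennreal_leI) (simp add: mult_ac)
  then show ?thesis unfolding EE_def using L_ge3 ps_pos[of "Suc n"] en_nonneg[of u "Suc n"]
    by (subst (asm) ennreal_mult) auto
qed

end

context vicsek_space
begin

text \<open>The lower bound for \<open>Phi\<close> from \<open>Phi_ge\<close>, renormalised to its
  own level. It depends on the scale and no longer on the radius within the scale.\<close>

definition JJ :: "real \<Rightarrow> (complex \<Rightarrow> real) \<Rightarrow> nat \<Rightarrow> ennreal" where
  "JJ \<theta> u k = ennreal (ph k powr (- \<theta>) / ps k) * dd u (4 * h k)"

lemma EE_le_JJ:
  assumes t: "2 / (p + 1) < t" "t \<le> 1" "t \<le> \<theta>" and u: "continuous_on K u"
  shows "EE \<theta> u n \<le> ennreal (8 * 2 powr p * C_av (lam t) * (4 powr p * (2 * L))) *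
    (\<Sum>j. ennreal (lam t ^ j) * JJ \<theta> u (n + j))"
proof -
  note lb = lam_bounds[OF t(1)]
  let ?a = "ph n powr (- \<theta>) * ps n" and ?K = "8 * 2 powr p * C_av (lam t)" and ?Q = "4 powr p * (2 * L)"
  have K0: "0 \<le> ?K" "0 \<le> ?Q" "0 \<le> ?a" using L_ge3 ps_pos[of n] by (auto simp: C_av_def)
  have term_le: "?a * chain_weight (lam t) n j \<le> ?Q * (lam t ^ j * (ph (n + j) powr (- \<theta>) / ps (n + j)))" for j
  proof -
    let ?k = "n + j"
    have pos: "0 < ps ?k" "0 < ps (Suc ?k)" "0 < ph n powr \<theta>" "0 < ph ?k powr \<theta>" "0 < lam t ^ j" "0 < ps n"
      using ps_pos ph_pos[of n] ph_pos[of ?k] lb by (auto simp: less_imp_neq)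
    have "ph ?k powr \<theta> * ps n \<le> sig t ^ j * (ph n powr \<theta> * ps ?k)" by (rule ratio_bound[OF t])
    also have "sig t ^ j = lam t ^ j * lam t ^ j" using lb(3) by (simp flip: power_mult_distrib)
    finally have 1: "?a \<le> lam t ^ j * lam t ^ j * (ps ?k * ph ?k powr (- \<theta>))"
      using pos by (simp add: powr_minus_divide field_simps)
    have 2: "1 / ps (Suc ?k) \<le> 2 * L / ps ?k" using ps_ratio[of ?k] pos by (simp add: field_simps)
    have "?a * chain_weight (lam t) n j = (4 powr p / ps ?k / lam t ^ j) * (?a * (1 / ps (Suc ?k)))"
      by (simp add: chain_weight_def mult_ac)
    also have "\<dots> \<le> (4 powr p / ps ?k / lam t ^ j) * ((lam t ^ j * lam t ^ j * (ps ?k * ph ?k powr (- \<theta>))) * (2 * L / ps ?k))"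
      using pos K0 by (intro mult_left_mono mult_mono 1 2) auto
    also have "\<dots> = ?Q * (lam t ^ j * (ph ?k powr (- \<theta>) / ps ?k))" using pos by (simp add: field_simps)
    finally show ?thesis .
  qed
  have "EE \<theta> u n = ennreal ?a * ennreal (en u n)"
    unfolding EE_def using K0 en_nonneg by (intro ennreal_mult) auto
  also have "\<dots> \<le> ennreal ?a * (ennreal ?K * (\<Sum>j. ennreal (chain_weight (lam t) n j) * dd u (4 * h (n + j))))"
    by (intro mult_left_mono en_le_dd[OF lb(1,2) u]) simp
  also have "\<dots> = ennreal ?K * (\<Sum>j. ennreal ?a * (ennreal (chain_weight (lam t) n j) * dd u (4 * h (n + j))))"
    by (subst ennreal_suminf_cmult) (rule mult.left_commute)
  also have "\<dots> \<le> ennreal ?K * (\<Sum>j. ennreal ?Q * (ennreal (lam t ^ j) * JJ \<theta> u (n + j)))"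
  proof (intro mult_left_mono suminf_le)
    fix j
    have cw: "0 \<le> chain_weight (lam t) n j" using lb ps_pos[of "n+j"] ps_pos[of "Suc (n+j)"] by (simp add: chain_weight_def)
    have "ennreal ?a * ennreal (chain_weight (lam t) n j) \<le> ennreal ?Q * (ennreal (lam t ^ j) * ennreal (ph (n + j) powr (- \<theta>) / ps (n + j)))"
      using term_le[of j] K0 lb ps_pos[of "n + j"] cw by (simp add: ennreal_leI flip: ennreal_mult)
    from mult_right_mono[OF this, of "dd u (4 * h (n + j))"]
    show "ennreal ?a * (ennreal (chain_weight (lam t) n j) * dd u (4 * h (n + j))) \<le> ennreal ?Q * (ennreal (lam t ^ j) * JJ \<theta> u (n + j))"
      by (simp add: JJ_def mult.assoc)
  qed auto
  also have "\<dots> = ennreal (?K * ?Q) * (\<Sum>j. ennreal (lam t ^ j) * JJ \<theta> u (n + j))"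
    by (simp only: ennreal_mult[OF K0(1,2)] mult.assoc[of "ennreal ?K" "ennreal ?Q"] ennreal_suminf_cmult)
  finally show ?thesis .
qed

lemma JJ_le_Phi:
  assumes u: "u \<in> borel_measurable \<mu>" and r: "2 * h (Suc n) < r" "r \<le> 2 * h n"
    and t: "0 \<le> \<beta> / bs" "\<beta> / bs \<le> t"
  shows "JJ (\<beta> / bs) u (n + 2) \<le> ennreal (64 * L\<^sup>2 * ((2 * L * L powr (p - 1))\<^sup>2) powr t) * Phi l \<mu> p bs \<beta> u r"
proof -
  let ?\<theta> = "\<beta> / bs" and ?P = "(2 * L * L powr (p - 1))\<^sup>2"
  have pos: "0 < ps n" "0 < ps (n + 2)" "0 < ph n" "0 < ph (n + 2)" using ps_pos ph_pos by auto
  have L1: "1 \<le> L powr (p - 1)" using L_ge3 p by (intro ge_one_powr_ge_zero) auto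
  have "1 * 1 \<le> (2 * L) * L powr (p - 1)" using L_ge3 L1 by (intro mult_mono) auto
  then have P1: "1 \<le> ?P" by (simp add: one_le_power)
  have "ph n \<le> ?P * ph (n + 2)"
  proof -
    have "ph n \<le> (2 * L * L powr (p - 1)) * ph (Suc n)" by (rule ph_ratio)
    also have "\<dots> \<le> (2 * L * L powr (p - 1)) * ((2 * L * L powr (p - 1)) * ph (Suc (Suc n)))"
      using L_ge3 by (intro mult_left_mono ph_ratio) auto
    finally show ?thesis by (simp add: power2_eq_square mult_ac)
  qed
  then have "ph n powr ?\<theta> \<le> (?P * ph (n + 2)) powr ?\<theta>" using t pos by (intro powr_mono2) auto
  also have "\<dots> = ?P powr ?\<theta> * ph (n + 2) powr ?\<theta>" using pos by (simp add: powr_mult)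
  \<comment> \<open>Since the base is at least 1, the exponent may be raised to \<open>t\<close>;
    this removes \<beta> from the constant.\<close>
  also have "\<dots> \<le> ?P powr t * ph (n + 2) powr ?\<theta>" using t P1 by (intro mult_right_mono powr_mono) auto
  finally have 1: "ph n powr ?\<theta> \<le> ?P powr t * ph (n + 2) powr ?\<theta>" .
  have "ps n \<le> 2 * L * (2 * L * ps (n + 2))"
    using order_trans[OF ps_ratio[of n] mult_left_mono[OF ps_ratio[of "Suc n"], of "2 * L"]] L_ge3 by simp
  then have 2: "ps n \<le> 4 * L\<^sup>2 * ps (n + 2)" by (simp add: power2_eq_square mult_ac)
  have "ph n powr ?\<theta> * (16 * ps n) \<le> (?P powr t * ph (n + 2) powr ?\<theta>) * (16 * (4 * L\<^sup>2 * ps (n + 2)))"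
    using pos 2 by (intro mult_mono 1) auto
  then have "ph (n + 2) powr (- ?\<theta>) / ps (n + 2) \<le> (64 * L\<^sup>2 * ?P powr t) * (ph n powr (- ?\<theta>) / (16 * ps n))"
    using pos by (simp add: powr_minus_divide divide_le_eq le_divide_eq mult_ac)
  then have "JJ ?\<theta> u (n + 2) \<le> ennreal ((64 * L\<^sup>2 * ?P powr t) * (ph n powr (- ?\<theta>) / (16 * ps n))) * dd u (4 * h (n + 2))"
    unfolding JJ_def by (intro mult_right_mono ennreal_leI) auto
  also have "\<dots> = ennreal (64 * L\<^sup>2 * ?P powr t) * (ennreal (ph n powr (- ?\<theta>) / (16 * ps n)) * dd u (4 * h (n + 2)))"
    using pos by (subst ennreal_mult) (auto simp: mult.assoc)
  also have "\<dots> \<le> ennreal (64 * L\<^sup>2 * ?P powr t) * Phi l \<mu> p bs \<beta> u r"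
    by (intro mult_left_mono Phi_ge[OF u r]) simp
  finally show ?thesis .
qed

lemma Phi_le_EE:
  assumes t: "2 / (p + 1) < t" "t \<le> 1" "t \<le> \<beta> / bs" and u: "continuous_on K u"
    and r: "2 * h (Suc n) < r" "r \<le> 2 * h n"
  shows "Phi l \<mu> p bs \<beta> u r \<le> ennreal (2 powr p * C_pt (lam t) * (64 * L) * (2 * L)) *
    (\<Sum>j. ennreal (lam t ^ j) * EE (\<beta> / bs) u (Suc (n - 1) + j))"
proof -
  note lb = lam_bounds[OF t(1)]
  let ?\<theta> = "\<beta> / bs" and ?m = "n - 1" and ?K = "2 powr p * C_pt (lam t) * (64 * L)"
  have K0: "0 \<le> ?K" using C_pt_nonneg L_ge3 by simp
  have term_le: "ph n powr (- ?\<theta>) * (ps (?m + j) * en u (Suc (?m + j)) / lam t ^ j) \<le>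
      2 * L * (lam t ^ j * (ph (Suc ?m + j) powr (- ?\<theta>) * ps (Suc ?m + j) * en u (Suc ?m + j)))" for j
  proof -
    let ?k = "Suc ?m + j"
    have pos: "0 < ps ?k" "0 < ph n powr ?\<theta>" "0 < ph ?k powr ?\<theta>" "0 < lam t ^ j"
      using ps_pos ph_pos[of n] ph_pos[of ?k] lb by (auto simp: less_imp_neq)
    have t0: "0 \<le> ?\<theta>" using t(1,3) p by (smt (verit) divide_nonneg_nonneg)
    have "ph ?k powr ?\<theta> \<le> sig t ^ j * ph (Suc ?m) powr ?\<theta>" by (rule ratio_bound_ph[OF t])
    also have "\<dots> \<le> sig t ^ j * ph n powr ?\<theta>"
      using lb(4) ph_antimono[of n "Suc ?m"] ph_pos[of "Suc ?m"] t0 by (intro mult_left_mono powr_mono2) auto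
    also have "sig t ^ j = lam t ^ j * lam t ^ j" using lb(3) by (simp flip: power_mult_distrib)
    finally have 1: "ph n powr (- ?\<theta>) / lam t ^ j \<le> lam t ^ j * ph ?k powr (- ?\<theta>)"
      using pos by (simp add: powr_minus_divide field_simps)
    have "ph n powr (- ?\<theta>) * (ps (?m + j) * en u (Suc (?m + j)) / lam t ^ j) = (ph n powr (- ?\<theta>) / lam t ^ j) * (ps (?m + j) * en u ?k)"
      by simp
    also have "\<dots> \<le> (lam t ^ j * ph ?k powr (- ?\<theta>)) * ((2 * L * ps ?k) * en u ?k)"
      using pos 1 ps_ratio[of "?m + j"] en_nonneg ps_pos[of "?m + j"]
      by (intro mult_mono) (auto intro!: mult_nonneg_nonneg)
    finally show ?thesis by (simp add: mult_ac)
  qed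
  have "Phi l \<mu> p bs \<beta> u r \<le> ennreal ?K * (ennreal (ph n powr (- ?\<theta>)) * integral\<^sup>N \<mu> (Tm (lam t) u ?m))"
    by (rule Phi_le[OF lb(1,2) u r])
  also have "\<dots> = ennreal ?K * (\<Sum>j. ennreal (ph n powr (- ?\<theta>)) * ennreal (ps (?m + j) * en u (Suc (?m + j)) / lam t ^ j))"
    unfolding integral_Tm[OF lb(1)] by simp
  also have "\<dots> \<le> ennreal ?K * (\<Sum>j. ennreal (2 * L) * (ennreal (lam t ^ j) * EE ?\<theta> u (Suc ?m + j)))"
  proof (intro mult_left_mono suminf_le)
    fix j
    have "0 \<le> ps (?m + j) * en u (Suc (?m + j)) / lam t ^ j" "0 \<le> ph (Suc ?m + j) powr (- ?\<theta>) * ps (Suc ?m + j) * en u (Suc ?m + j)"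
      using ps_pos[of "?m + j"] ps_pos[of "Suc ?m + j"] en_nonneg[of u] lb by auto
    then show "ennreal (ph n powr (- ?\<theta>)) * ennreal (ps (?m + j) * en u (Suc (?m + j)) / lam t ^ j) \<le>
      ennreal (2 * L) * (ennreal (lam t ^ j) * EE ?\<theta> u (Suc ?m + j))"
      unfolding EE_def using term_le[of j] L_ge3 lb by (simp only: ennreal_mult[symmetric] ennreal_leI powr_ge_zero
          zero_le_power less_imp_le mult_nonneg_nonneg)
  qed auto
  also have "\<dots> = ennreal (?K * (2 * L)) * (\<Sum>j. ennreal (lam t ^ j) * EE ?\<theta> u (Suc ?m + j))"
  proof -
    have "0 \<le> 2 * L" using L_ge3 by simp
    then show ?thesis
      by (simp only: ennreal_mult[OF K0] mult.assoc[of "ennreal ?K" "ennreal (2 * L)"] ennreal_suminf_cmult)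
  qed
  finally show ?thesis .
qed

end

section \<open>Series with values in [0, infinity] and powers of seminorms\<close>

lemma suminf_swap_ennreal:
  fixes f :: "nat \<Rightarrow> nat \<Rightarrow> ennreal"
  shows "(\<Sum>n. \<Sum>j. f n j) = (\<Sum>j. \<Sum>n. f n j)"
proof -
  have "(\<Sum>n. \<Sum>j. f n j) = (\<integral>\<^sup>+n. (\<Sum>j. f n j) \<partial>count_space UNIV)"
    by (rule nn_integral_count_space_nat[symmetric])
  also have "\<dots> = (\<Sum>j. \<integral>\<^sup>+n. f n j \<partial>count_space UNIV)"
    by (rule nn_integral_suminf) simp
  finally show ?thesis by (simp add: nn_integral_count_space_nat)
qed

lemma suminf_shift_le_ennreal: "(\<Sum>n. a (n + j)) \<le> (\<Sum>n. a n :: ennreal)"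
  using suminf_offset[of a j] by (simp add: add_increasing)

text \<open>A form of Young's inequality. It carries an estimate with geometric weights on the finer
  levels over to the sum over all levels.\<close>

lemma convolution_sum_le:
  fixes a c :: "nat \<Rightarrow> ennreal"
  shows "(\<Sum>n. \<Sum>j. c j * a (n + j)) \<le> (\<Sum>j. c j) * (\<Sum>n. a n)"
proof -
  have "(\<Sum>n. \<Sum>j. c j * a (n + j)) = (\<Sum>j. c j * (\<Sum>n. a (n + j)))"
    by (subst suminf_swap_ennreal) simp
  also have "\<dots> \<le> (\<Sum>j. c j * (\<Sum>n. a n))"
    by (intro suminf_le mult_left_mono suminf_shift_le_ennreal) auto
  finally show ?thesis by simp
qed

lemma geometric_ennreal: "0 \<le> c \<Longrightarrow> c < 1 \<Longrightarrow> (\<Sum>j. ennreal (c ^ j)) = ennreal (1 / (1 - c))"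
  by (intro suminf_ennreal_eq geometric_sums) auto

lemma enn_powr_mono: "0 < a \<Longrightarrow> x \<le> y \<Longrightarrow> enn_powr x a \<le> enn_powr y a"
  unfolding enn_powr_def
  by (auto simp: top_unique less_top intro!: ennreal_leI powr_mono2 enn2real_mono)

lemma enn_powr_inverse:
  assumes "0 < a" "a * b = 1" shows "enn_powr (enn_powr x a) b = x"
  using assms by (cases x) (auto simp: enn_powr_def powr_powr)

text \<open>\<open>besov_pinf\<close> takes the root inside the supremum; the root is an increasing
  bijection and commutes with it.\<close>

lemma enn_powr_SUP:
  assumes "0 < p"
  shows "enn_powr (SUP i\<in>I. enn_powr (f i) (1 / p)) p = (SUP i\<in>I. f i)"
proof (rule antisym)
  have "(SUP i\<in>I. enn_powr (f i) (1 / p)) \<le> enn_powr (SUP i\<in>I. f i) (1 / p)"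
    using assms by (intro SUP_least enn_powr_mono SUP_upper) auto
  from enn_powr_mono[OF assms this] show "enn_powr (SUP i\<in>I. enn_powr (f i) (1 / p)) p \<le> (SUP i\<in>I. f i)"
    using assms by (simp add: enn_powr_inverse)
  show "(SUP i\<in>I. f i) \<le> enn_powr (SUP i\<in>I. enn_powr (f i) (1 / p)) p"
  proof (rule SUP_least)
    fix i assume i: "i \<in> I"
    have "f i = enn_powr (enn_powr (f i) (1 / p)) p" using assms by (simp add: enn_powr_inverse)
    also have "\<dots> \<le> enn_powr (SUP i\<in>I. enn_powr (f i) (1 / p)) p"
      using assms i by (intro enn_powr_mono SUP_upper) auto
    finally show "f i \<le> enn_powr (SUP i\<in>I. enn_powr (f i) (1 / p)) p" .
  qed
qed

context vicsek_energy
begin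

text \<open>A function that is constant on each scale. Comparing \<open>Phi\<close> with such
  functions turns the integral over the radius into a series, by monotonicity of the
  integral.\<close>

definition step :: "(nat \<Rightarrow> ennreal) \<Rightarrow> real \<Rightarrow> ennreal" where
  "step f r = (\<Sum>k. f k * indicator {2 * h (Suc k)<..2 * h k} r)"

lemma step_value:
  assumes "2 * h (Suc n) < r" "r \<le> 2 * h n" shows "step f r = f n"
proof -
  have "f k * indicator {2 * h (Suc k)<..2 * h k} r = (if k = n then f k else 0)" for k
  proof (cases "k = n")
    case False
    then have "r \<notin> {2 * h (Suc k)<..2 * h k}"
      using assms h_decseq[of "Suc k" n] h_decseq[of "Suc n" k] by (cases "k < n") auto
    then show ?thesis using False by simp
  qed (use assms in simp)
  then show ?thesis unfolding step_def using sums_single[of n f] by (simp add: sums_iff)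
qed

lemma step_zero: "\<not> (0 < r \<and> r \<le> 2) \<Longrightarrow> step f r = 0"
proof -
  assume "\<not> (0 < r \<and> r \<le> 2)"
  then have "r \<notin> {2 * h (Suc k)<..2 * h k}" for k
    using h_pos[of "Suc k"] h_decseq[of 0 k] h_0 by auto
  then show ?thesis by (simp add: step_def)
qed

lemma step_integral: "(\<integral>\<^sup>+r. step f r \<partial>lborel) = (\<Sum>k. f k * ennreal (2 * h k - 2 * h (Suc k)))"
proof -
  have "(\<integral>\<^sup>+r. step f r \<partial>lborel) = (\<Sum>k. \<integral>\<^sup>+r. f k * indicator {2 * h (Suc k)<..2 * h k} r \<partial>lborel)"
    unfolding step_def by (rule nn_integral_suminf) simp
  also have "\<dots> = (\<Sum>k. f k * ennreal (2 * h k - 2 * h (Suc k)))"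
    using h_decseq[of _ "Suc _"] by (simp add: nn_integral_cmult_indicator)
  finally show ?thesis .
qed

end

context vicsek_space
begin

section \<open>Equivalence of Besov seminorms and discrete energies\<close>

definition Phi_int :: "real \<Rightarrow> real \<Rightarrow> (complex \<Rightarrow> real) \<Rightarrow> ennreal" where
  "Phi_int bs \<beta> u = (\<integral>\<^sup>+r\<in>{0<..2}. Phi l \<mu> p bs \<beta> u r * ennreal (1 / r) \<partial>lborel)"
definition Phi_sup :: "real \<Rightarrow> real \<Rightarrow> (complex \<Rightarrow> real) \<Rightarrow> ennreal" where
  "Phi_sup bs \<beta> u = (SUP r\<in>{0<..2}. Phi l \<mu> p bs \<beta> u r)"

lemma besov_pp_powr: "enn_powr (besov_pp l \<mu> p bs \<beta> u) p = Phi_int bs \<beta> u"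
  using p by (simp add: besov_pp_def diameter_K enn_powr_inverse Phi_int_def)

lemma besov_pinf_powr: "enn_powr (besov_pinf l \<mu> p bs \<beta> u) p = Phi_sup bs \<beta> u"
  using p by (simp add: besov_pinf_def diameter_K enn_powr_SUP Phi_sup_def)

lemma enn_powr_less_top: "0 < a \<Longrightarrow> enn_powr x a < \<infinity> \<longleftrightarrow> x < \<infinity>"
  by (auto simp: enn_powr_def less_top)

lemma besov_pp_finite: "besov_pp l \<mu> p bs \<beta> u < \<infinity> \<longleftrightarrow> Phi_int bs \<beta> u < \<infinity>"
  using besov_pp_powr[of bs \<beta> u] enn_powr_less_top[of p "besov_pp l \<mu> p bs \<beta> u"] p by simp
lemma besov_pinf_finite: "besov_pinf l \<mu> p bs \<beta> u < \<infinity> \<longleftrightarrow> Phi_sup bs \<beta> u < \<infinity>"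
  using besov_pinf_powr[of bs \<beta> u] enn_powr_less_top[of p "besov_pinf l \<mu> p bs \<beta> u"] p by simp

text \<open>These bound the integral of 1 / r over one scale from both sides: the length of the
  interval is comparable with \<open>h n\<close> because \<open>l\<close> is at least 3, and with
  \<open>h (Suc n)\<close> because \<open>l\<close> is bounded.\<close>

lemma h_gap: "h n \<le> 3/2 * (h n - h (Suc n))" "h n - h (Suc n) \<le> L * h (Suc n)"
proof -
  show "h n \<le> 3/2 * (h n - h (Suc n))" using h_Suc_le[of n] by simp
  have "h n = h (Suc n) * real (l (Suc n))" by (simp add: h_Suc_l)
  also have "\<dots> \<le> h (Suc n) * L" using l_le h_pos[of "Suc n"] by (intro mult_left_mono) auto
  finally show "h n - h (Suc n) \<le> L * h (Suc n)" using h_pos[of "Suc n"] by (simp add: mult.commute)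
qed

definition C_J :: "real \<Rightarrow> real" where "C_J t = 64 * L\<^sup>2 * ((2 * L * L powr (p - 1))\<^sup>2) powr t"

lemma C_J_pos: "0 < C_J t" using L_ge3 by (simp add: C_J_def)

lemma JJ_le_Phi_sup:
  assumes u: "u \<in> borel_measurable \<mu>" and t: "0 \<le> \<beta> / bs" "\<beta> / bs \<le> t"
  shows "JJ (\<beta> / bs) u (n + 2) \<le> ennreal (C_J t) * Phi_sup bs \<beta> u"
proof -
  have r: "2 * h (Suc n) < 2 * h n" using h_Suc_le[of n] h_pos[of "Suc n"] by simp
  have "JJ (\<beta> / bs) u (n + 2) \<le> ennreal (C_J t) * Phi l \<mu> p bs \<beta> u (2 * h n)"
    unfolding C_J_def by (rule JJ_le_Phi[OF u r order_refl t])
  also have "\<dots> \<le> ennreal (C_J t) * Phi_sup bs \<beta> u"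
    unfolding Phi_sup_def using h_pos[of n] h_decseq[of 0 n] h_0
    by (intro mult_left_mono SUP_upper) auto
  finally show ?thesis .
qed

lemma sum_JJ_le_Phi_int:
  assumes u: "u \<in> borel_measurable \<mu>" and t: "0 \<le> \<beta> / bs" "\<beta> / bs \<le> t"
  shows "(\<Sum>n. JJ (\<beta> / bs) u (n + 2)) \<le> ennreal (3/2 * C_J t) * Phi_int bs \<beta> u"
proof -
  let ?J = "\<lambda>n. JJ (\<beta> / bs) u (n + 2)"
  \<comment> \<open>On scale \<open>n\<close> the factor 1 / r is replaced by its smallest value,
    the one at the right end \<open>2 * h n\<close>; the converse estimate takes the left
    end.\<close>
  let ?f = "\<lambda>n. ennreal (1 / C_J t) * ?J n * ennreal (1 / (2 * h n))"
  have inv: "ennreal (C_J t) * ennreal (1 / C_J t) = 1"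
    using C_J_pos[of t] by (simp flip: ennreal_mult)
  have "(\<Sum>n. ?J n) \<le> (\<Sum>n. ennreal (3/2 * C_J t) * (?f n * ennreal (2 * h n - 2 * h (Suc n))))"
  proof (rule suminf_le)
    fix n
    have "1 \<le> 3/2 * (1 / (2 * h n) * (2 * h n - 2 * h (Suc n)))" "0 \<le> 2 * h n - 2 * h (Suc n)"
      using h_gap(1)[of n] h_pos[of n] h_decseq[of n "Suc n"] by (auto simp: field_simps)
    then have "1 \<le> ennreal (3/2) * (ennreal (1 / (2 * h n)) * ennreal (2 * h n - 2 * h (Suc n)))"
      using h_pos[of n] by (simp add: ennreal_mult[symmetric] flip: ennreal_1)
    from mult_left_mono[OF this, of "?J n"]
    have "?J n \<le> ?J n * (ennreal (3/2) * (ennreal (1 / (2 * h n)) * ennreal (2 * h n - 2 * h (Suc n))))"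
      by (simp only: mult_1_right zero_le)
    also have "\<dots> = (ennreal (C_J t) * ennreal (1 / C_J t)) *
        (?J n * (ennreal (3/2) * (ennreal (1 / (2 * h n)) * ennreal (2 * h n - 2 * h (Suc n)))))"
      by (simp only: inv mult_1_left)
    also have "\<dots> = (ennreal (3/2) * ennreal (C_J t)) * (?f n * ennreal (2 * h n - 2 * h (Suc n)))"
      by (simp only: mult_ac)
    finally show "?J n \<le> ennreal (3/2 * C_J t) * (?f n * ennreal (2 * h n - 2 * h (Suc n)))"
      using C_J_pos[of t] by (subst ennreal_mult) simp_all
  qed auto
  also have "\<dots> = ennreal (3/2 * C_J t) * (\<integral>\<^sup>+r. step ?f r \<partial>lborel)"
    by (simp only: step_integral ennreal_suminf_cmult)
  also have "\<dots> \<le> ennreal (3/2 * C_J t) * Phi_int bs \<beta> u"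
    unfolding Phi_int_def
  proof (intro mult_left_mono nn_integral_mono)
    fix r :: real
    show "step ?f r \<le> Phi l \<mu> p bs \<beta> u r * ennreal (1 / r) * indicator {0<..2} r"
    proof (cases "0 < r \<and> r \<le> 2")
      case True
      then obtain n where n: "2 * h (Suc n) < r" "r \<le> 2 * h n" using scale_exists by blast
      have "?J n \<le> ennreal (C_J t) * Phi l \<mu> p bs \<beta> u r"
        unfolding C_J_def by (rule JJ_le_Phi[OF u n t])
      from mult_left_mono[OF this, of "ennreal (1 / C_J t)"]
      have "ennreal (1 / C_J t) * ?J n \<le> Phi l \<mu> p bs \<beta> u r"
        using inv by (simp add: mult.assoc[symmetric] mult.commute)
      then have "?f n \<le> Phi l \<mu> p bs \<beta> u r * ennreal (1 / r)"
        using True n by (intro mult_mono ennreal_leI divide_left_mono) auto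
      then show ?thesis using True by (simp add: step_value[OF n])
    qed (simp add: step_zero)
  qed simp
  finally show ?thesis .
qed

text \<open>Two levels are skipped because \<open>JJ\<close> at level \<open>n + 2\<close> is what \<open>Phi\<close> at scale \<open>n\<close> controls.\<close>

definition C_L :: "real \<Rightarrow> real" where
  "C_L t = (2 * L * L powr (p - 1)) * (2 * L * L powr (p - 1)) *
     (8 * 2 powr p * C_av (lam t) * (4 powr p * (2 * L)))"

lemma C_L_nonneg: "0 \<le> C_L t" using L_ge3 by (simp add: C_L_def C_av_def)

lemma EE_le_JJ_shift:
  assumes t: "2 / (p + 1) < t" "t \<le> 1" "t \<le> \<theta>" and u: "continuous_on K u"
  shows "EE \<theta> u n \<le> ennreal (C_L t) * (\<Sum>j. ennreal (lam t ^ j) * JJ \<theta> u (n + j + 2))"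
proof -
  let ?D = "2 * L * L powr (p - 1)" and ?K = "8 * 2 powr p * C_av (lam t) * (4 powr p * (2 * L))"
  have D: "0 \<le> ?D" "0 \<le> ?K" "0 \<le> ?D * ?D" using L_ge3 by (auto simp: C_av_def)
  have t0: "0 \<le> \<theta>" using t(1,3) p by (smt (verit) divide_nonneg_nonneg)
  have "EE \<theta> u n \<le> ennreal ?D * EE \<theta> u (Suc n)" by (rule EE_le_Suc[OF t0])
  also have "\<dots> \<le> ennreal ?D * (ennreal ?D * EE \<theta> u (Suc (Suc n)))"
    by (intro mult_left_mono EE_le_Suc[OF t0]) simp
  also have "\<dots> \<le> ennreal ?D * (ennreal ?D * (ennreal ?K * (\<Sum>j. ennreal (lam t ^ j) * JJ \<theta> u (Suc (Suc n) + j))))"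
    by (intro mult_left_mono EE_le_JJ[OF t u]) auto
  also have "\<dots> = ennreal (C_L t) * (\<Sum>j. ennreal (lam t ^ j) * JJ \<theta> u (Suc (Suc n) + j))"
    unfolding C_L_def ennreal_mult[OF D(3,2)] ennreal_mult[OF D(1,1)] by (simp only: mult.assoc)
  finally show ?thesis by simp
qed

definition C_U :: "real \<Rightarrow> real" where "C_U t = 2 powr p * C_pt (lam t) * (64 * L) * (2 * L)"

lemma C_U_nonneg: "0 \<le> C_U t" using L_ge3 C_pt_nonneg by (simp add: C_U_def)

lemma suminf_geometric_const_le:
  assumes "0 \<le> c" "c < 1" "\<And>j. f j \<le> (B :: ennreal)"
  shows "(\<Sum>j. ennreal (c ^ j) * f j) \<le> ennreal (1 / (1 - c)) * B"
proof -
  have "(\<Sum>j. ennreal (c ^ j) * f j) \<le> (\<Sum>j. ennreal (c ^ j) * B)"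
    using assms(3) by (intro suminf_le mult_left_mono) auto
  then show ?thesis using assms(1,2) by (simp only: ennreal_suminf_multc geometric_ennreal)
qed

lemma EE_le_Phi_sup:
  assumes t: "2 / (p + 1) < t" "t \<le> 1" "t \<le> \<beta> / bs" "\<beta> / bs \<le> t'" and u: "continuous_on K u"
  shows "(SUP n. EE (\<beta> / bs) u n) \<le> ennreal (C_L t * (1 / (1 - lam t)) * C_J t') * Phi_sup bs \<beta> u"
proof (rule SUP_least)
  fix n
  note lb = lam_bounds[OF t(1)]
  have t0: "0 \<le> \<beta> / bs" using t(1,3) p by (smt (verit) divide_nonneg_nonneg)
  have g: "0 \<le> 1 / (1 - lam t)" "0 \<le> C_J t'" using lb C_J_pos[of t'] by auto
  have "EE (\<beta> / bs) u n \<le> ennreal (C_L t) * (\<Sum>j. ennreal (lam t ^ j) * JJ (\<beta> / bs) u (n + j + 2))"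
    by (rule EE_le_JJ_shift[OF t(1-3) u])
  also have "\<dots> \<le> ennreal (C_L t) * (ennreal (1 / (1 - lam t)) * (ennreal (C_J t') * Phi_sup bs \<beta> u))"
    using lb by (intro mult_left_mono suminf_geometric_const_le JJ_le_Phi_sup[OF continuous_measurable[OF u] t0 t(4)]) auto
  also have "\<dots> = ennreal (C_L t * (1 / (1 - lam t)) * C_J t') * Phi_sup bs \<beta> u"
    using g C_L_nonneg by (simp only: ennreal_mult mult_nonneg_nonneg mult.assoc)
  finally show "EE (\<beta> / bs) u n \<le> ennreal (C_L t * (1 / (1 - lam t)) * C_J t') * Phi_sup bs \<beta> u" .
qed

lemma sum_EE_le_Phi_int:
  assumes t: "2 / (p + 1) < t" "t \<le> 1" "t \<le> \<beta> / bs" "\<beta> / bs \<le> t'" and u: "continuous_on K u"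
  shows "(\<Sum>n. EE (\<beta> / bs) u n) \<le> ennreal (C_L t * (1 / (1 - lam t)) * (3/2 * C_J t')) * Phi_int bs \<beta> u"
proof -
  note lb = lam_bounds[OF t(1)]
  have t0: "0 \<le> \<beta> / bs" using t(1,3) p by (smt (verit) divide_nonneg_nonneg)
  have g: "0 \<le> 1 / (1 - lam t)" "0 \<le> 3/2 * C_J t'" using lb C_J_pos[of t'] by auto
  have geo: "(\<Sum>j. ennreal (lam t ^ j)) \<le> ennreal (1 / (1 - lam t))"
    by (rule order_eq_refl[OF geometric_ennreal]) (use lb in auto)
  have "(\<Sum>n. EE (\<beta> / bs) u n) \<le> (\<Sum>n. ennreal (C_L t) * (\<Sum>j. ennreal (lam t ^ j) * JJ (\<beta> / bs) u (n + j + 2)))"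
    by (intro suminf_le EE_le_JJ_shift[OF t(1-3) u]) auto
  also have "\<dots> = ennreal (C_L t) * (\<Sum>n. \<Sum>j. ennreal (lam t ^ j) * JJ (\<beta> / bs) u (n + j + 2))"
    by (rule ennreal_suminf_cmult)
  also have "\<dots> \<le> ennreal (C_L t) * ((\<Sum>j. ennreal (lam t ^ j)) * (\<Sum>n. JJ (\<beta> / bs) u (n + 2)))"
    using convolution_sum_le[of "\<lambda>j. ennreal (lam t ^ j)" "\<lambda>n. JJ (\<beta> / bs) u (n + 2)"]
    by (intro mult_left_mono) (auto simp: add.assoc)
  also have "\<dots> \<le> ennreal (C_L t) * (ennreal (1 / (1 - lam t)) * (ennreal (3/2 * C_J t') * Phi_int bs \<beta> u))"
    using lb geo by (intro mult_left_mono mult_mono sum_JJ_le_Phi_int[OF continuous_measurable[OF u] t0 t(4)]) auto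
  also have "\<dots> = ennreal (C_L t * (1 / (1 - lam t)) * (3/2 * C_J t')) * Phi_int bs \<beta> u"
    using g C_L_nonneg by (simp only: ennreal_mult mult_nonneg_nonneg mult.assoc[of "ennreal _"])
  finally show ?thesis .
qed

lemma Phi_sup_le_EE:
  assumes t: "2 / (p + 1) < t" "t \<le> 1" "t \<le> \<beta> / bs" and u: "continuous_on K u"
  shows "Phi_sup bs \<beta> u \<le> ennreal (C_U t * (1 / (1 - lam t))) * (SUP n. EE (\<beta> / bs) u n)"
  unfolding Phi_sup_def
proof (rule SUP_least)
  fix r :: real assume "r \<in> {0<..2}"
  then obtain n where n: "2 * h (Suc n) < r" "r \<le> 2 * h n" using scale_exists by auto
  note lb = lam_bounds[OF t(1)]
  have g: "0 \<le> 1 / (1 - lam t)" using lb by auto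
  have "Phi l \<mu> p bs \<beta> u r \<le> ennreal (C_U t) * (\<Sum>j. ennreal (lam t ^ j) * EE (\<beta> / bs) u (Suc (n - 1) + j))"
    unfolding C_U_def by (rule Phi_le_EE[OF t u n])
  also have "\<dots> \<le> ennreal (C_U t) * (ennreal (1 / (1 - lam t)) * (SUP n. EE (\<beta> / bs) u n))"
    using lb by (intro mult_left_mono suminf_geometric_const_le SUP_upper) auto
  also have "\<dots> = ennreal (C_U t * (1 / (1 - lam t))) * (SUP n. EE (\<beta> / bs) u n)"
    using g C_U_nonneg by (simp only: ennreal_mult mult.assoc)
  finally show "Phi l \<mu> p bs \<beta> u r \<le> ennreal (C_U t * (1 / (1 - lam t))) * (SUP n. EE (\<beta> / bs) u n)" .
qed

lemma Phi_int_le_EE: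
  assumes t: "2 / (p + 1) < t" "t \<le> 1" "t \<le> \<beta> / bs" and u: "continuous_on K u"
  shows "Phi_int bs \<beta> u \<le> ennreal (C_U t * L * 2 * (1 / (1 - lam t))) * (\<Sum>n. EE (\<beta> / bs) u n)"
proof -
  note lb = lam_bounds[OF t(1)]
  have g: "0 \<le> 1 / (1 - lam t)" "0 \<le> L" using lb L_ge3 by auto
  let ?S = "\<lambda>n. \<Sum>j. ennreal (lam t ^ j) * EE (\<beta> / bs) u (Suc (n - 1) + j)"
  let ?f = "\<lambda>n. ennreal (C_U t) * ?S n * ennreal (1 / (2 * h (Suc n)))"
  have "Phi_int bs \<beta> u \<le> (\<integral>\<^sup>+r. step ?f r \<partial>lborel)"
    unfolding Phi_int_def
  proof (rule nn_integral_mono)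
    fix r :: real
    show "Phi l \<mu> p bs \<beta> u r * ennreal (1 / r) * indicator {0<..2} r \<le> step ?f r"
    proof (cases "0 < r \<and> r \<le> 2")
      case True
      then obtain n where n: "2 * h (Suc n) < r" "r \<le> 2 * h n" using scale_exists by blast
      have "Phi l \<mu> p bs \<beta> u r * ennreal (1 / r) \<le> ?f n"
        unfolding C_U_def using True n h_pos[of "Suc n"]
        by (intro mult_mono Phi_le_EE[OF t u n] ennreal_leI divide_left_mono) auto
      then show ?thesis using True by (simp add: step_value[OF n])
    qed auto
  qed
  also have "\<dots> = (\<Sum>n. ?f n * ennreal (2 * h n - 2 * h (Suc n)))" by (rule step_integral)
  also have "\<dots> \<le> (\<Sum>n. ennreal (C_U t) * (?S n * ennreal L))"
  proof (rule suminf_le)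
    fix n
    have "1 / (2 * h (Suc n)) * (2 * h n - 2 * h (Suc n)) \<le> L" "0 \<le> 2 * h n - 2 * h (Suc n)"
      using h_gap(2)[of n] h_pos[of "Suc n"] h_decseq[of n "Suc n"] by (auto simp: field_simps)
    then have "ennreal (1 / (2 * h (Suc n))) * ennreal (2 * h n - 2 * h (Suc n)) \<le> ennreal L"
      using h_pos[of "Suc n"] by (simp add: ennreal_leI flip: ennreal_mult)
    from mult_left_mono[OF this, of "ennreal (C_U t) * ?S n"]
    show "?f n * ennreal (2 * h n - 2 * h (Suc n)) \<le> ennreal (C_U t) * (?S n * ennreal L)"
      by (simp add: mult_ac)
  qed auto
  also have "\<dots> = ennreal (C_U t) * ((\<Sum>n. ?S n) * ennreal L)"
    by (simp only: ennreal_suminf_cmult ennreal_suminf_multc)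
  \<comment> \<open>Because of \<open>Suc (n - 1)\<close> the scales 0 and 1 both start at level 1.
    The term that occurs twice costs the factor 2.\<close>
  also have "(\<Sum>n. ?S n) \<le> 2 * (\<Sum>n. \<Sum>j. ennreal (lam t ^ j) * EE (\<beta> / bs) u (Suc n + j))"
  proof -
    let ?R = "\<lambda>n. \<Sum>j. ennreal (lam t ^ j) * EE (\<beta> / bs) u (Suc n + j)"
    have "(\<Sum>n. ?S n) = (\<Sum>n. ?S (n + 1)) + ?S 0"
      using suminf_offset[of ?S 1] by (simp add: add.commute)
    also have "(\<Sum>n. ?S (n + 1)) = (\<Sum>n. ?R n)" by simp
    also have "?S 0 \<le> (\<Sum>n. ?R n)" using sum_le_suminf[of ?R "{0}"] by simp
    finally show ?thesis by (simp add: mult_2 add_left_mono)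
  qed
  also have "(\<Sum>n. \<Sum>j. ennreal (lam t ^ j) * EE (\<beta> / bs) u (Suc n + j)) \<le> ennreal (1 / (1 - lam t)) * (\<Sum>n. EE (\<beta> / bs) u n)"
  proof -
    have "(\<Sum>n. \<Sum>j. ennreal (lam t ^ j) * EE (\<beta> / bs) u (Suc n + j)) \<le>
        (\<Sum>j. ennreal (lam t ^ j)) * (\<Sum>n. EE (\<beta> / bs) u (n + 1))"
      using convolution_sum_le[of "\<lambda>j. ennreal (lam t ^ j)" "\<lambda>n. EE (\<beta> / bs) u (n + 1)"]
      by (simp only: add_Suc) (simp only: Suc_eq_plus1)
    also have "\<dots> \<le> ennreal (1 / (1 - lam t)) * (\<Sum>n. EE (\<beta> / bs) u n)"
      using suminf_shift_le_ennreal[of "EE (\<beta> / bs) u" 1]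
      by (intro mult_mono order_eq_refl[OF geometric_ennreal]) (use lb in auto)
    finally show ?thesis .
  qed
  finally have "Phi_int bs \<beta> u \<le> ennreal (C_U t) * ((2 * (ennreal (1 / (1 - lam t)) * (\<Sum>n. EE (\<beta> / bs) u n))) * ennreal L)"
    by (simp add: mult_left_mono mult_right_mono)
  also have "\<dots> = ennreal (C_U t * L * 2 * (1 / (1 - lam t))) * (\<Sum>n. EE (\<beta> / bs) u n)"
  proof -
    have "ennreal (C_U t * L * 2 * (1 / (1 - lam t))) = ennreal (C_U t) * ennreal L * ennreal 2 * ennreal (1 / (1 - lam t))"
      using g C_U_nonneg by (simp only: ennreal_mult mult_nonneg_nonneg zero_le_numeral)
    then show ?thesis by (simp only: ennreal_numeral mult_ac)
  qed
  finally show ?thesis .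
qed

end

section \<open>Continuous versions\<close>

context vicsek_scales
begin

definition tail :: "(nat \<Rightarrow> real) \<Rightarrow> nat \<Rightarrow> real" where "tail \<eta> n = (\<Sum>k. \<eta> (k + n))"

lemma tail_tendsto_0: assumes "summable \<eta>" shows "tail \<eta> \<longlonglongrightarrow> 0"
proof -
  have "(\<lambda>n. (\<Sum>k. \<eta> k) - (\<Sum>k<n. \<eta> k)) \<longlonglongrightarrow> (\<Sum>k. \<eta> k) - (\<Sum>k. \<eta> k)"
    by (intro tendsto_intros summable_LIMSEQ assms)
  moreover have "tail \<eta> = (\<lambda>n. (\<Sum>k. \<eta> k) - (\<Sum>k<n. \<eta> k))"
    unfolding tail_def by (rule ext) (rule suminf_minus_initial_segment[OF assms])
  ultimately show ?thesis by simp
qed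

lemma le_tail: assumes "summable \<eta>" "\<And>n. 0 \<le> \<eta> n" shows "\<eta> n \<le> tail \<eta> n"
proof -
  have "summable (\<lambda>k. \<eta> (k + n))" using assms(1) by (simp add: summable_iff_shift)
  from sum_le_suminf[OF this, of "{0}"] show ?thesis using assms(2) by (simp add: tail_def)
qed

text \<open>A cell of the next level around the same point may have a parent adjacent to
  \<open>w\<close>, so one step of a chain costs one \<open>nbr\<close> and one \<open>child\<close>
  bound; hence the factor 2. The lemma serves the averages of a Besov function, which are controlled
  from level \<open>start = 2\<close> on, and also \<open>axis_value\<close>.\<close>

lemma limit_function:
  fixes a :: "complex list \<Rightarrow> real"
  assumes \<eta>: "summable \<eta>" "\<And>n. 0 \<le> \<eta> n"
    and child: "\<And>n w s. start \<le> n \<Longrightarrow> w \<in> W n \<Longrightarrow> s \<in> S_set (l (Suc n)) \<Longrightarrow> \<bar>a (w @ [s]) - a w\<bar> \<le> \<eta> n"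
    and nbr: "\<And>n w w' e. start \<le> n \<Longrightarrow> w \<in> W n \<Longrightarrow> w' \<in> W n \<Longrightarrow> e \<in> dirs \<Longrightarrow>
      ctr w' = ctr w + of_real (2 * h n) * e \<Longrightarrow> \<bar>a w' - a w\<bar> \<le> \<eta> n"
  obtains v where "continuous_on K v"
    "\<And>n w x. start \<le> n \<Longrightarrow> w \<in> W n \<Longrightarrow> x \<in> box w \<Longrightarrow> x \<in> K \<Longrightarrow> \<bar>v x - a w\<bar> \<le> 2 * tail \<eta> n"
proof -
  define sel where "sel n x = (SOME w. w \<in> W n \<and> x \<in> box w)" for n x
  have sel: "sel n x \<in> W n \<and> x \<in> box (sel n x)" if "x \<in> K" for n x
  proof -
    have "\<exists>w. w \<in> W n \<and> x \<in> box w" using that in_K_iff[of x] by blast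
    then show ?thesis unfolding sel_def by (rule someI_ex)
  qed
  define v where "v x = lim (\<lambda>n. a (sel n x))" for x
  have close: "\<bar>a w' - a w\<bar> \<le> \<eta> n" if cls: "start \<le> n" "w \<in> W n" "w' \<in> W n" "x \<in> box w" "y \<in> box w'" "norm1 (x - y) < 2 * h n" for n w w' x y
  proof -
    consider "w = w'" | e where "e \<in> dirs" "ctr w' = ctr w + of_real (2 * h n) * e"
      using near_cells[OF cls(2-5) disjI2[OF cls(6)]] by metis
    then show ?thesis
    proof cases
      case 1 then show ?thesis using \<eta>(2)[of n] by simp
    next
      case 2 then show ?thesis using nbr[OF cls(1-3)] by blast
    qed
  qed
  have step: "\<bar>a w' - a w\<bar> \<le> 2 * \<eta> n" if n: "start \<le> n" "w \<in> W n" "w' \<in> W (Suc n)" "x \<in> box w" "x \<in> box w'" for n w w' x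
  proof -
    obtain w1 s where w1: "w' = w1 @ [s]" "w1 \<in> W n" "s \<in> S_set (l (Suc n))" using n by (auto elim: W_SucE)
    have "x \<in> box w1" using box_snoc_subset w1 n by blast
    then have "\<bar>a w1 - a w\<bar> \<le> \<eta> n" using close[OF n(1,2) w1(2) n(4)] h_pos[of n] by simp
    moreover have "\<bar>a w' - a w1\<bar> \<le> \<eta> n" using child n w1 by blast
    ultimately show ?thesis by linarith
  qed
  have main: "\<bar>v x - a w\<bar> \<le> 2 * tail \<eta> n" if n: "start \<le> n" "w \<in> W n" "x \<in> box w" "x \<in> K" for n w x
  proof -
    \<comment> \<open>Starting the selected chain at an arbitrary \<open>w\<close> leaves its limit
      unchanged, so the bound holds for every cell around \<open>x\<close>.\<close>
    define c where "c k = (if k = 0 then a w else a (sel (n + k) x))" for k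
    define d where "d k = c (Suc k) - c k" for k
    have dk: "\<bar>d k\<bar> \<le> 2 * \<eta> (k + n)" for k
    proof -
      have s: "sel (Suc (n + k)) x \<in> W (Suc (n + k))" "x \<in> box (sel (Suc (n + k)) x)" using sel[OF n(4)] by blast+
      show ?thesis
        using step[of "n + k" _ "sel (Suc (n + k)) x" x] s sel[OF n(4), of "n + k"] n
        by (auto simp: d_def c_def add.commute)
    qed
    have sm: "summable (\<lambda>k. 2 * \<eta> (k + n))" using \<eta>(1) by (intro summable_mult) (simp add: summable_iff_shift)
    have sd: "summable (\<lambda>k. \<bar>d k\<bar>)" by (rule summable_comparison_test'[OF sm, of 0]) (use dk in auto)
    have "(\<lambda>N. a w + (\<Sum>k<N. d k)) \<longlonglongrightarrow> a w + (\<Sum>k. d k)"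
      by (intro tendsto_intros summable_LIMSEQ summable_rabs_cancel[OF sd])
    moreover have "a w + (\<Sum>k<N. d k) = c N" for N
      unfolding d_def by (subst sum_lessThan_telescope) (simp add: c_def)
    ultimately have "c \<longlonglongrightarrow> a w + (\<Sum>k. d k)" by simp
    then have "(\<lambda>k. c (Suc k)) \<longlonglongrightarrow> a w + (\<Sum>k. d k)" by (rule LIMSEQ_Suc)
    then have "(\<lambda>k. a (sel (k + Suc n) x)) \<longlonglongrightarrow> a w + (\<Sum>k. d k)" by (simp add: c_def add.commute)
    then have "(\<lambda>k. a (sel k x)) \<longlonglongrightarrow> a w + (\<Sum>k. d k)" by (rule LIMSEQ_offset)
    then have "v x = a w + (\<Sum>k. d k)" unfolding v_def by (rule limI)
    then have "\<bar>v x - a w\<bar> \<le> (\<Sum>k. \<bar>d k\<bar>)" using summable_rabs[OF sd] by simp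
    also have "\<dots> \<le> (\<Sum>k. 2 * \<eta> (k + n))" using dk by (intro suminf_le sd sm) auto
    also have "\<dots> = 2 * tail \<eta> n" unfolding tail_def using \<eta>(1)
      by (intro suminf_mult) (simp add: summable_iff_shift)
    finally show ?thesis .
  qed
  have "continuous_on K v"
    unfolding continuous_on_iff
  proof (intro ballI allI impI)
    fix x and r :: real assume x: "x \<in> K" and r: "0 < r"
    have "\<forall>\<^sub>F n in sequentially. tail \<eta> n < r / 5 \<and> start \<le> n"
      using order_tendstoD(2)[OF tail_tendsto_0[OF \<eta>(1)], of "r/5"] r eventually_ge_at_top[of start]
      by (auto simp: eventually_conj_iff)
    \<comment> \<open>Two differences of at most \<open>2 * tail \<eta> n\<close> and one of at most
      \<open>\<eta> n\<close> add up to five tails.\<close>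
    then obtain n where n: "tail \<eta> n < r / 5" "start \<le> n" by (auto dest!: eventually_happens'[OF sequentially_bot])
    show "\<exists>d>0. \<forall>y\<in>K. dist y x < d \<longrightarrow> dist (v y) (v x) < r"
    proof (intro exI[of _ "h n"] conjI ballI impI h_pos)
      fix y assume y: "y \<in> K" "dist y x < h n"
      have "norm1 (x - y) \<le> 3/2 * dist y x" using norm1_le_cmod2[of "x - y"] by (simp add: dist_norm norm_minus_commute)
      also have "\<dots> < 2 * h n" using y h_pos[of n] by simp
      finally have "\<bar>a (sel n y) - a (sel n x)\<bar> \<le> \<eta> n" using close[of n "sel n x" "sel n y" x y] sel[OF x, of n] sel[OF y(1), of n] n by blast
      moreover have "\<bar>v x - a (sel n x)\<bar> \<le> 2 * tail \<eta> n" "\<bar>v y - a (sel n y)\<bar> \<le> 2 * tail \<eta> n"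
        using main sel x y n by blast+
      ultimately show "dist (v y) (v x) < r" using n(1) le_tail[OF \<eta>, of n] by (simp add: dist_real_def)
    qed
  qed
  then show ?thesis using main that by blast
qed

end

context vicsek_space
begin

lemma Lp_integrable: assumes "u \<in> Lp p \<mu>" shows "integrable \<mu> u"
proof -
  have u: "u \<in> borel_measurable \<mu>" "integrable \<mu> (\<lambda>x. \<bar>u x\<bar> powr p)" using assms by (auto simp: Lp_def)
  show ?thesis
  proof (rule Bochner_Integration.integrable_bound[of _ "\<lambda>x. 1 + \<bar>u x\<bar> powr p"])
    have "\<bar>t\<bar> \<le> 1 + \<bar>t\<bar> powr p" for t :: real
    proof (cases "\<bar>t\<bar> \<le> 1")
      case False
      then have "\<bar>t\<bar> powr 1 \<le> \<bar>t\<bar> powr p" using p by (intro powr_mono) auto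
      then show ?thesis by simp
    qed (simp add: add_increasing2)
    then show "AE x in \<mu>. norm (u x) \<le> norm (1 + \<bar>u x\<bar> powr p)" by (simp add: abs_of_nonneg)
  qed (use u in auto)
qed

lemma continuous_Lp: assumes u: "continuous_on K u" shows "u \<in> Lp p \<mu>"
proof -
  have "continuous_on K (\<lambda>x. \<bar>u x\<bar> powr p)" using u p by (intro continuous_intros continuous_on_powr') auto
  from continuous_bounded_integrable[OF this] show ?thesis using continuous_measurable[OF u] by (simp add: Lp_def)
qed

lemma Phi_cong_AE:
  assumes "AE x in \<mu>. u x = v x" shows "Phi l \<mu> p bs \<beta> u r = Phi l \<mu> p bs \<beta> v r"
  unfolding Phi_def
proof (rule nn_integral_cong_AE)
  show "AE x in \<mu>. 1 / emeasure \<mu> (ball x r \<inter> K) * (\<integral>\<^sup>+y\<in>ball x r \<inter> K. ennreal (\<bar>u x - u y\<bar> powr p / phi l p r powr (\<beta> / bs)) \<partial>\<mu>) =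
     1 / emeasure \<mu> (ball x r \<inter> K) * (\<integral>\<^sup>+y\<in>ball x r \<inter> K. ennreal (\<bar>v x - v y\<bar> powr p / phi l p r powr (\<beta> / bs)) \<partial>\<mu>)"
    using assms
  proof eventually_elim
    case (elim x)
    have "(\<integral>\<^sup>+y\<in>ball x r \<inter> K. ennreal (\<bar>u x - u y\<bar> powr p / phi l p r powr (\<beta> / bs)) \<partial>\<mu>) =
      (\<integral>\<^sup>+y\<in>ball x r \<inter> K. ennreal (\<bar>v x - v y\<bar> powr p / phi l p r powr (\<beta> / bs)) \<partial>\<mu>)"
      by (rule nn_integral_cong_AE) (use assms in eventually_elim, simp add: elim)
    then show ?case by simp
  qed
qed

lemma Phi_sup_cong_AE: "AE x in \<mu>. u x = v x \<Longrightarrow> Phi_sup bs \<beta> u = Phi_sup bs \<beta> v"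
  unfolding Phi_sup_def using Phi_cong_AE by (metis (no_types, lifting) SUP_cong)
lemma Phi_int_cong_AE: "AE x in \<mu>. u x = v x \<Longrightarrow> Phi_int bs \<beta> u = Phi_int bs \<beta> v"
  unfolding Phi_int_def using Phi_cong_AE by presburger

text \<open>The bound on \<open>JJ\<close> makes the averages change by at most a constant times
  (\<open>sig t\<close>)^(n/p) from a cell of level \<open>n\<close> to its children and neighbours.
  This is summable, so the averages have a continuous limit \<open>v\<close>. On each cell both
  \<open>u\<close> and \<open>v\<close> are compared with the average, and \<open>n\<close> tends to
  infinity.\<close>

lemma continuous_version:
  assumes t: "2 / (p + 1) < t" "t \<le> 1" "t \<le> \<theta>" and u: "u \<in> Lp p \<mu>"
    and M: "\<And>n. JJ \<theta> u (n + 2) \<le> ennreal M" and M0: "0 \<le> M"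
  obtains v where "continuous_on K v" "AE x in \<mu>. u x = v x"
proof -
  note lb = lam_bounds[OF t(1)]
  have ui: "integrable \<mu> u" by (rule Lp_integrable[OF u])
  then have um[measurable]: "u \<in> borel_measurable \<mu>" by simp
  have sig1: "sig t < 1"
    using lb mult_strict_mono[of "lam t" 1 "lam t" 1] by simp
  have dd_le: "dd u (4 * h n) \<le> ennreal (M * (ps n * ph n powr \<theta>))" if n: "2 \<le> n" for n
  proof -
    have "ennreal (ph n powr (- \<theta>) / ps n) * dd u (4 * h n) \<le> ennreal M"
    proof -
      have "n - 2 + 2 = n" using n by simp
      then show ?thesis using M[of "n - 2"] by (simp only: JJ_def)
    qed
    from mult_left_mono[OF this, of "ennreal (ps n * ph n powr \<theta>)"]
    have "ennreal (ps n * ph n powr \<theta>) * (ennreal (ph n powr (- \<theta>) / ps n) * dd u (4 * h n)) \<le> ennreal (ps n * ph n powr \<theta>) * ennreal M"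
      by simp
    moreover have one: "ennreal (ps n * ph n powr \<theta>) * ennreal (ph n powr (- \<theta>) / ps n) = 1"
    proof -
      have "(ps n * ph n powr \<theta>) * (ph n powr (- \<theta>) / ps n) = 1"
        using ps_pos[of n] ph_pos[of n] by (simp add: powr_minus_divide)
      then show ?thesis using ps_pos[of n] by (subst ennreal_mult[symmetric]) auto
    qed
    moreover have "ennreal (ps n * ph n powr \<theta>) * ennreal M = ennreal (M * (ps n * ph n powr \<theta>))"
      using M0 ps_pos[of n] by (subst ennreal_mult[symmetric]) (auto simp: mult.commute)
    ultimately show ?thesis by (simp only: mult.assoc[symmetric] one mult_1_left)
  qed
  define A where "A = 4 powr p * M * (2 * L) * ph 0 powr \<theta>"
  have A0: "0 \<le> A" using M0 L_ge3 by (simp add: A_def)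
  define \<eta> where "\<eta> n = A powr (1/p) * (sig t powr (1/p)) ^ n" for n :: nat
  have q: "0 < sig t powr (1/p)" "sig t powr (1/p) < 1"
    using lb sig1 p powr_less_mono2[of "1/p" "sig t" 1] by auto
  have \<eta>: "summable \<eta>" "\<And>n. 0 \<le> \<eta> n"
    unfolding \<eta>_def using q by (auto intro!: summable_mult summable_geometric)
  have osc: "\<bar>avg u w' - avg u w\<bar> \<le> \<eta> n"
    if n: "2 \<le> n" and w: "w \<in> W n" "w' \<in> W k" "k = n \<or> k = Suc n"
      and le: "(\<integral>\<^sup>+x. (\<integral>\<^sup>+y. ennreal (\<bar>u x - u y\<bar> powr p) * indicator (cl w') y \<partial>\<mu>) * indicator (cl w) x \<partial>\<mu>) \<le> dd u (4 * h n)"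
    for n k w w'
  proof -
    have pos: "0 < ps n" "0 < ps k" "0 < ph n powr \<theta>" using ps_pos ph_pos[of n] by (auto simp: less_imp_neq)
    have "1 / ps k \<le> 2 * L / ps n"
      using w(3) ps_ratio[of n] pos L_ge3 ps_pos[of "Suc n"] by (auto simp: field_simps)
    moreover have "ph n powr \<theta> / ps n \<le> sig t ^ n * ph 0 powr \<theta>"
      using ratio_bound[OF t, of 0 n] pos by (simp add: ps_0 field_simps)
    ultimately have "(1 / ps k) * ph n powr \<theta> \<le> 2 * L * (sig t ^ n * ph 0 powr \<theta>)"
      using mult_right_mono[of "1 / ps k" "2 * L / ps n" "ph n powr \<theta>"]
        mult_left_mono[of "ph n powr \<theta> / ps n" "sig t ^ n * ph 0 powr \<theta>" "2 * L"] L_ge3 by simp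
    from mult_left_mono[OF this, of "4 powr p * M"]
    have b: "4 powr p / (ps n * ps k) * (M * (ps n * ph n powr \<theta>)) \<le> A * sig t ^ n"
      using pos M0 by (simp add: A_def mult_ac)
    have "ennreal (\<bar>avg u w' - avg u w\<bar> powr p) \<le> ennreal (4 powr p / (ps n * ps k)) * ennreal (M * (ps n * ph n powr \<theta>))"
      by (rule order_trans[OF avg_diff_le[OF ui w(1,2)] mult_left_mono[OF order_trans[OF le dd_le[OF n]]]]) simp
    also have "\<dots> \<le> ennreal (A * sig t ^ n)"
      using b pos M0 by (simp add: ennreal_leI flip: ennreal_mult)
    finally have "\<bar>avg u w' - avg u w\<bar> powr p \<le> A * sig t ^ n"
      using A0 lb(4) by (subst (asm) ennreal_le_iff) auto
    then have "(\<bar>avg u w' - avg u w\<bar> powr p) powr (1/p) \<le> (A * sig t ^ n) powr (1/p)"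
      using p by (intro powr_mono2) auto
    also have "\<dots> = \<eta> n" using A0 lb(4) by (simp add: \<eta>_def powr_mult powr_powr powr_realpow[symmetric] mult.commute)
    finally show ?thesis using p by (simp add: powr_powr)
  qed
  obtain v where v: "continuous_on K v"
    "\<And>n w x. 2 \<le> n \<Longrightarrow> w \<in> W n \<Longrightarrow> x \<in> box w \<Longrightarrow> x \<in> K \<Longrightarrow> \<bar>v x - avg u w\<bar> \<le> 2 * tail \<eta> n"
  proof (rule limit_function[where a = "avg u" and start = 2, OF \<eta>])
    show "\<bar>avg u (w @ [s]) - avg u w\<bar> \<le> \<eta> n" if "2 \<le> n" "w \<in> W n" "s \<in> S_set (l (Suc n))" for n w s
    proof (rule osc[OF that(1,2) W_snoc[OF that(2,3)]])
      show "(\<integral>\<^sup>+x. (\<integral>\<^sup>+y. ennreal (\<bar>u x - u y\<bar> powr p) * indicator (cl (w @ [s])) y \<partial>\<mu>) * indicator (cl w) x \<partial>\<mu>) \<le> dd u (4 * h n)"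
        using box_snoc_subset[OF that(2,3)] by (intro neighbour_dd[OF um that(2) that(2)]) auto
    qed simp
    show "\<bar>avg u w' - avg u w\<bar> \<le> \<eta> n"
      if "2 \<le> n" "w \<in> W n" "w' \<in> W n" "e \<in> dirs" "ctr w' = ctr w + of_real (2 * h n) * e" for n w w' e
    proof (rule osc[OF that(1-3)])
      show "(\<integral>\<^sup>+x. (\<integral>\<^sup>+y. ennreal (\<bar>u x - u y\<bar> powr p) * indicator (cl w') y \<partial>\<mu>) * indicator (cl w) x \<partial>\<mu>) \<le> dd u (4 * h n)"
        using that by (intro neighbour_dd[OF um that(2,3)]) blast+
    qed simp
  qed blast
  have vm[measurable]: "v \<in> borel_measurable \<mu>" by (rule continuous_measurable[OF v(1)])
  \<comment> \<open>The first summand bounds the distance of \<open>u\<close> from its averages, the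
    second that of \<open>v\<close>.\<close>
  let ?b = "\<lambda>n. 2 powr p * (2 powr p * M * ph n powr \<theta> + (2 * tail \<eta> n) powr p)"
  have tail0: "0 \<le> tail \<eta> n" for n using le_tail[OF \<eta>, of n] \<eta>(2)[of n] by linarith
  have bound: "(\<integral>\<^sup>+x. ennreal (\<bar>u x - v x\<bar> powr p) \<partial>\<mu>) \<le> ennreal (?b n)" if n: "2 \<le> n" for n
  proof -
    let ?T = "ennreal ((2 * tail \<eta> n) powr p)"
    have "(\<integral>\<^sup>+x. ennreal (\<bar>u x - v x\<bar> powr p) \<partial>\<mu>) = (\<Sum>w\<in>W n. \<integral>\<^sup>+x. ennreal (\<bar>u x - v x\<bar> powr p) * indicator (cl w) x \<partial>\<mu>)"
      by (rule nn_integral_cells[symmetric]) measurable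
    also have "\<dots> \<le> (\<Sum>w\<in>W n. \<integral>\<^sup>+x. ennreal (2 powr p) * (ennreal (\<bar>u x - avg u w\<bar> powr p) * indicator (cl w) x + ?T * indicator (cl w) x) \<partial>\<mu>)"
    proof (intro sum_mono nn_integral_mono)
      fix w x assume w: "w \<in> W n"
      show "ennreal (\<bar>u x - v x\<bar> powr p) * indicator (cl w) x \<le>
        ennreal (2 powr p) * (ennreal (\<bar>u x - avg u w\<bar> powr p) * indicator (cl w) x + ?T * indicator (cl w) x)"
      proof (cases "x \<in> cl w")
        case True
        have "\<bar>u x - v x\<bar> powr p \<le> 2 powr p * (\<bar>u x - avg u w\<bar> powr p + \<bar>v x - avg u w\<bar> powr p)"
          using p by (intro add_powr_le) auto
        also have "\<dots> \<le> 2 powr p * (\<bar>u x - avg u w\<bar> powr p + (2 * tail \<eta> n) powr p)"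
          using v(2)[OF n w] True p by (intro mult_left_mono add_left_mono powr_mono2) auto
        finally have "ennreal (\<bar>u x - v x\<bar> powr p) \<le> ennreal (2 powr p * (\<bar>u x - avg u w\<bar> powr p + (2 * tail \<eta> n) powr p))"
          by (rule ennreal_leI)
        then show ?thesis using True by (simp add: ennreal_mult ennreal_plus)
      qed simp
    qed
    also have "\<dots> = (\<Sum>w\<in>W n. ennreal (2 powr p) * ((\<integral>\<^sup>+x. ennreal (\<bar>u x - avg u w\<bar> powr p) * indicator (cl w) x \<partial>\<mu>) + ?T * ennreal (ps n)))"
      by (intro sum.cong refl) (simp add: nn_integral_cmult nn_integral_add nn_integral_cmult_indicator emeasure_cl)
    also have "\<dots> = ennreal (2 powr p) * ((\<Sum>w\<in>W n. \<integral>\<^sup>+x. ennreal (\<bar>u x - avg u w\<bar> powr p) * indicator (cl w) x \<partial>\<mu>) + ?T)"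
    proof -
      have "(\<Sum>w\<in>W n. ?T * ennreal (ps n)) = ?T * ennreal (\<Sum>w\<in>W n. ps n)"
        using ps_pos[of n] by (subst sum_ennreal[symmetric]) (auto simp: sum_distrib_left mult.left_commute)
      also have "(\<Sum>w\<in>W n. ps n) = 1" using card_W[of n] ps_pos[of n] by simp
      finally show ?thesis by (simp only: sum_distrib_left[symmetric] sum.distrib) simp
    qed
    also have "\<dots> \<le> ennreal (2 powr p) * (ennreal (2 powr p * M * ph n powr \<theta>) + ?T)"
    proof (intro mult_left_mono add_right_mono)
      have "(\<Sum>w\<in>W n. \<integral>\<^sup>+x. ennreal (\<bar>u x - avg u w\<bar> powr p) * indicator (cl w) x \<partial>\<mu>) \<le>
        (\<Sum>w\<in>W n. \<integral>\<^sup>+x. ennreal (2 powr p / ps n) * ((\<integral>\<^sup>+y. ennreal (\<bar>u x - u y\<bar> powr p) * indicator (cl w) y \<partial>\<mu>) * indicator (cl w) x) \<partial>\<mu>)"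
      proof (intro sum_mono nn_integral_mono)
        fix w x assume w: "w \<in> W n"
        show "ennreal (\<bar>u x - avg u w\<bar> powr p) * indicator (cl w) x \<le>
          ennreal (2 powr p / ps n) * ((\<integral>\<^sup>+y. ennreal (\<bar>u x - u y\<bar> powr p) * indicator (cl w) y \<partial>\<mu>) * indicator (cl w) x)"
          using mult_right_mono[OF avg_point_le[OF ui w, of "u x"], of "indicator (cl w) x"] by (simp add: mult.assoc)
      qed
      also have "\<dots> = ennreal (2 powr p / ps n) * (\<Sum>w\<in>W n. \<integral>\<^sup>+x. (\<integral>\<^sup>+y. ennreal (\<bar>u x - u y\<bar> powr p) * indicator (cl w) y \<partial>\<mu>) * indicator (cl w) x \<partial>\<mu>)"
        by (simp add: nn_integral_cmult sum_distrib_left)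
      also have "\<dots> \<le> ennreal (2 powr p / ps n) * ennreal (M * (ps n * ph n powr \<theta>))"
        using h_pos[of n] by (intro mult_left_mono order_trans[OF dd_cells[OF um] order_trans[OF dd_mono dd_le[OF n]]]) auto
      also have "\<dots> = ennreal (2 powr p * M * ph n powr \<theta>)"
        using ps_pos[of n] M0 by (subst ennreal_mult[symmetric]) auto
      finally show "(\<Sum>w\<in>W n. \<integral>\<^sup>+x. ennreal (\<bar>u x - avg u w\<bar> powr p) * indicator (cl w) x \<partial>\<mu>) \<le> ennreal (2 powr p * M * ph n powr \<theta>)" .
    qed simp
    also have "\<dots> = ennreal (?b n)" using M0 by (simp add: ennreal_mult ennreal_plus)
    finally show ?thesis .
  qed
  have "?b \<longlonglongrightarrow> 2 powr p * (2 powr p * M * 0 + (2 * 0) powr p)"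
  proof (intro tendsto_intros tendsto_powr' tail_tendsto_0[OF \<eta>(1)])
    show "(\<lambda>n. ph n powr \<theta>) \<longlonglongrightarrow> 0"
    proof (rule real_tendsto_sandwich[OF _ _ tendsto_const])
      show "(\<lambda>n. sig t ^ n * ph 0 powr \<theta>) \<longlonglongrightarrow> 0"
        using tendsto_mult_right[OF LIMSEQ_power_zero[of "sig t"], of "ph 0 powr \<theta>"] lb sig1 by simp
      show "\<forall>\<^sub>F n in sequentially. ph n powr \<theta> \<le> sig t ^ n * ph 0 powr \<theta>"
        using ratio_bound_ph[OF t, of 0] by (simp add: always_eventually)
    qed simp
  qed (use p tail0 in \<open>auto intro!: always_eventually\<close>)
  then have b0: "?b \<longlonglongrightarrow> 0" using p by simp
  have "(\<integral>\<^sup>+x. ennreal (\<bar>u x - v x\<bar> powr p) \<partial>\<mu>) \<le> 0"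
  proof (rule LIMSEQ_le_const)
    show "(\<lambda>n. ennreal (?b n)) \<longlonglongrightarrow> 0" using tendsto_ennrealI[OF b0] by simp
    show "\<exists>N. \<forall>n\<ge>N. (\<integral>\<^sup>+x. ennreal (\<bar>u x - v x\<bar> powr p) \<partial>\<mu>) \<le> ennreal (?b n)" using bound by blast
  qed
  then have "AE x in \<mu>. ennreal (\<bar>u x - v x\<bar> powr p) = 0"
    by (subst nn_integral_0_iff_AE[symmetric]) auto
  then have "AE x in \<mu>. u x = v x" by eventually_elim (simp add: ennreal_eq_0_iff)
  then show ?thesis using that v(1) by blast
qed

end

section \<open>A non-constant function of finite energy\<close>

context vicsek_scales
begin

text \<open>A function of finite energy: on the horizontal diagonal it is the coordinate \<open>crd_x\<close>, and it
  is constant on each branch leaving this diagonal. \<open>axis_value w\<close> is the first coordinate of the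
  center of the last cell around \<open>w\<close> that is centered on the diagonal.\<close>

definition axis_value :: "complex list \<Rightarrow> real" where
  "axis_value w = crd_x (ctr (takeWhile (\<lambda>s. crd_y s = 0) w))"
definition on_axis :: "complex list \<Rightarrow> bool" where
  "on_axis w \<longleftrightarrow> (\<forall>s\<in>set w. crd_y s = 0)"

lemma on_axis_snoc: "on_axis (w @ [s]) \<longleftrightarrow> on_axis w \<and> crd_y s = 0"
  by (auto simp: on_axis_def)

lemma axis_value_on: "on_axis w \<Longrightarrow> axis_value w = crd_x (ctr w)"
  by (simp add: axis_value_def on_axis_def takeWhile_eq_all_conv[THEN iffD2])

lemma axis_value_off: "\<not> on_axis w \<Longrightarrow> axis_value (w @ v) = axis_value w"
  by (auto simp: axis_value_def on_axis_def takeWhile_append1)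

lemma letter_axis: "s \<in> S_set m \<Longrightarrow> crd_y s \<noteq> 0 \<Longrightarrow> crd_x s = 0"
  unfolding S_set_dirs by (auto simp only: mem_Collect_eq crd_scale dirs_crd)

lemma axis_value_snoc_on:
  assumes "on_axis w" "s \<in> S_set m" shows "axis_value (w @ [s]) = axis_value w + h (length w) * crd_x s"
proof (cases "crd_y s = 0")
  case True
  then show ?thesis using assms by (simp add: axis_value_on on_axis_snoc ctr_snoc crd_add crd_scale)
next
  case False
  have "takeWhile (\<lambda>s. crd_y s = 0) (w @ [s]) = w"
    using assms False by (simp add: on_axis_def takeWhile_append2)
  then show ?thesis using letter_axis[OF assms(2) False] assms(1) by (simp add: axis_value_on) (simp add: axis_value_def)
qed

lemma axis_value_snoc_vertical:
  assumes "s \<in> S_set m" "crd_x s = 0" shows "axis_value (w @ [s]) = axis_value w"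
  using assms axis_value_snoc_on[of w s m] axis_value_off by (cases "on_axis w") auto

text \<open>The last clause carries the induction. Equal values pass to the touching children if the
  letters appended there are vertical or both words have left the axis; along a horizontal
  \<open>e\<close> a word on the axis would change its value.\<close>

lemma adjacent_axis:
  assumes "w \<in> W n" "w' \<in> W n" "e \<in> dirs" "ctr w' = ctr w + of_real (2 * h n) * e"
  shows "(on_axis w \<and> on_axis w') \<or>
    (axis_value w = axis_value w' \<and> (crd_x e = 0 \<or> (\<not> on_axis w \<and> \<not> on_axis w')))"
  using assms
proof (induction n arbitrary: w w' e)
  case 0 then show ?case by (auto simp: W_0 on_axis_def)
next
  case (Suc n)
  obtain v s where w: "w = v @ [s]" "v \<in> W n" "s \<in> S_set (l (Suc n))"
    using Suc.prems(1) by (auto elim: W_SucE)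
  obtain v' t where w': "w' = v' @ [t]" "v' \<in> W n" "t \<in> S_set (l (Suc n))"
    using Suc.prems(2) by (auto elim: W_SucE)
  have len: "length v = n" "length v' = n" using w w' W_length by auto
  have hpos: "0 < h n" "0 < h (Suc n)" using h_pos by auto
  show ?case
  proof (cases "v = v'")
    case True
    have d: "of_real (h n) * (t - s) = of_real (2 * h (Suc n)) * e"
      using Suc.prems(4) by (simp add: w(1) w'(1) True ctr_snoc len algebra_simps)
    have dx: "h n * (crd_x t - crd_x s) = 2 * h (Suc n) * crd_x e" "h n * (crd_y t - crd_y s) = 2 * h (Suc n) * crd_y e"
      using arg_cong[OF d, of crd_x] arg_cong[OF d, of crd_y] by (simp_all only: crd_scale crd_diff)
    show ?thesis
    proof (cases "on_axis v")
      case on: True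
      show ?thesis
      proof (cases "crd_y s = 0 \<and> crd_y t = 0")
        case True
        then show ?thesis using on \<open>v = v'\<close> by (simp add: w(1) w'(1) on_axis_snoc)
      next
        case False
        have "crd_x e = 0"
        proof (cases "crd_y s \<noteq> 0 \<and> crd_y t \<noteq> 0")
          case True
          then have "crd_x s = 0" "crd_x t = 0" using letter_axis w(3) w'(3) by blast+
          then show ?thesis using dx(1) hpos by simp
        next
          case F: False
          then have "crd_y t - crd_y s \<noteq> 0" using False by auto
          then have "crd_y e \<noteq> 0" using dx(2) hpos by auto
          then show ?thesis using Suc.prems(3) by (auto simp: dirs_crd)
        qed
        moreover from this have "crd_x t = crd_x s" using dx(1) hpos by simp
        then have "axis_value w = axis_value w'"
          using axis_value_snoc_on[OF on w(3)] axis_value_snoc_on[OF on w'(3)] \<open>v = v'\<close> by (simp add: w(1) w'(1))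
        ultimately show ?thesis by blast
      qed
    next
      case False
      then show ?thesis using \<open>v = v'\<close> by (simp add: w(1) w'(1) axis_value_off on_axis_snoc)
    qed
  next
    case False
    define z where "z = ctr w + of_real (h (Suc n)) * e"
    have z': "z = ctr w' + of_real (h (Suc n)) * (- e)" using Suc.prems(4) by (simp add: z_def)
    have lenw: "length w = Suc n" "length w' = Suc n" using Suc.prems W_length by auto
    have zb: "z \<in> box w" "z \<in> box w'"
      using corner_in_box[OF Suc.prems(3), of w] corner_in_box[OF dirs_minus[OF Suc.prems(3)], of w']
      unfolding lenw z'[symmetric] z_def[symmetric] by simp_all
    have zb2: "z \<in> box v" "z \<in> box v'" using zb box_snoc_subset w w' by blast+
    obtain f where f: "f \<in> dirs" "ctr v' = ctr v + of_real (2 * h n) * f"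
      using near_cells[OF w(2) w'(2) zb2] False hpos by auto
    have nz: "norm1 (z - z) < 2 * h (Suc n)" using hpos by simp
    note nc = near_children[OF w(2) w'(2) w(3) w'(3) f zb[unfolded w(1) w'(1)] nz]
    have "of_real (2 * h (Suc n)) * f = of_real (2 * h (Suc n)) * e"
      using nc(3) Suc.prems(4) by (simp add: w(1) w'(1))
    then have fe: "f = e" using hpos by simp
    note nc = nc[unfolded fe] and f = f[unfolded fe]
    have sx: "crd_x s = (1 - 1 / real (l (Suc n))) * crd_x e" "crd_y s = (1 - 1 / real (l (Suc n))) * crd_y e"
      "crd_x t = - (1 - 1 / real (l (Suc n))) * crd_x e" "crd_y t = - (1 - 1 / real (l (Suc n))) * crd_y e"
      unfolding nc(1,2) crd_scale crd_minus by (simp_all only: mult_minus_left mult_minus_right)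
    have vert: "axis_value w = axis_value v \<and> axis_value w' = axis_value v'" if "crd_x e = 0"
      using axis_value_snoc_vertical[OF w(3)] axis_value_snoc_vertical[OF w'(3)] that sx by (simp add: w(1) w'(1))
    consider "on_axis v \<and> on_axis v'" "crd_x e = 0" | "on_axis v \<and> on_axis v'" "crd_y e = 0"
      | "axis_value v = axis_value v'" "crd_x e = 0" | "axis_value v = axis_value v'" "\<not> on_axis v \<and> \<not> on_axis v'"
      using Suc.IH[OF w(2) w'(2) f] f(1) by (auto simp: dirs_crd)
    then show ?thesis
    proof cases
      case 1
      have "crd_x (ctr v') = crd_x (ctr v)" unfolding f(2) crd_add crd_scale using 1(2) by simp
      then have "axis_value v = axis_value v'" using 1 by (simp add: axis_value_on)
      then show ?thesis using vert 1 by simp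
    next
      case 2
      then show ?thesis using sx by (simp add: w(1) w'(1) on_axis_snoc)
    next
      case 3
      then show ?thesis using vert by simp
    next
      case 4
      then show ?thesis by (simp add: w(1) w'(1) axis_value_off on_axis_snoc)
    qed
  qed
qed

lemma card_axis_letters: "card {s\<in>S_set (l (Suc n)). crd_y s = 0} \<le> l (Suc n)"
proof -
  let ?m = "l (Suc n)"
  let ?A = "(\<lambda>k. of_real (2 * real k / real ?m) * q_pt 1) ` {0..(?m - 1) div 2}"
  let ?B = "(\<lambda>k. of_real (2 * real k / real ?m) * q_pt 3) ` {1..(?m - 1) div 2}"
  have "{s\<in>S_set ?m. crd_y s = 0} \<subseteq> ?A \<union> ?B"
  proof
    fix s assume "s \<in> {s\<in>S_set ?m. crd_y s = 0}"
    then obtain k e where s: "s = of_real (2 * real k / real ?m) * e" "e \<in> dirs" "k \<le> (?m - 1) div 2" "crd_y s = 0"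
      by (auto simp: S_set_dirs)
    show "s \<in> ?A \<union> ?B"
    proof (cases "k = 0")
      case True then show ?thesis using s by auto
    next
      case False
      have "2 * real k / real ?m * crd_y e = 0" using s(4) unfolding s(1) crd_scale .
      then have "crd_y e = 0" using False l_pos[of "Suc n"] by simp
      then have "e = q_pt 1 \<or> e = q_pt 3"
        using s(2) crd_q by (auto simp: dirs_eq)
      then show ?thesis using s False by auto
    qed
  qed
  then have "card {s\<in>S_set ?m. crd_y s = 0} \<le> card (?A \<union> ?B)" by (rule card_mono[rotated]) auto
  also have "\<dots> \<le> card ?A + card ?B" by (rule card_Un_le)
  also have "\<dots> \<le> Suc ((?m - 1) div 2) + (?m - 1) div 2"
    by (intro add_mono order_trans[OF card_image_le]) auto
  also have "\<dots> = ?m" using l_odd[of n] by (auto elim!: oddE)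
  finally show ?thesis .
qed

text \<open>Each step offers at most \<open>l\<close> letters on the axis, and the product of these
  numbers is \<open>1 / h n\<close>. With an energy of order \<open>h n powr p\<close> per axis
  cell, the total is of the critical order \<open>h n powr (p - 1)\<close>.\<close>

lemma card_on_axis: "real (card {w\<in>W n. on_axis w}) * h n \<le> 1"
proof (induction n)
  case 0
  have "{w\<in>W 0. on_axis w} \<subseteq> {[]}" by (auto simp: W_0)
  then have "card {w\<in>W 0. on_axis w} \<le> card {[] :: complex list}" by (rule card_mono[rotated]) simp
  then show ?case by (simp add: h_0)
next
  case (Suc n)
  let ?X = "{w\<in>W n. on_axis w}" and ?S = "{s\<in>S_set (l (Suc n)). crd_y s = 0}"
  have fin: "finite ?X" "finite ?S" using finite_W finite_S_set by auto
  have "{w\<in>W (Suc n). on_axis w} \<subseteq> (\<lambda>(w, s). w @ [s]) ` (?X \<times> ?S)"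
    by (auto simp: W_Suc on_axis_snoc)
  then have "card {w\<in>W (Suc n). on_axis w} \<le> card ((\<lambda>(w, s). w @ [s]) ` (?X \<times> ?S))"
    using fin by (intro card_mono) auto
  also have "\<dots> \<le> card (?X \<times> ?S)" using fin by (intro card_image_le) auto
  also have "\<dots> \<le> card ?X * l (Suc n)" using card_axis_letters[of n] by (simp add: card_cartesian_product)
  finally have "real (card {w\<in>W (Suc n). on_axis w}) \<le> real (card ?X * l (Suc n))" by (rule of_nat_mono)
  then have "real (card {w\<in>W (Suc n). on_axis w}) * h (Suc n) \<le> real (card ?X * l (Suc n)) * h (Suc n)"
    using h_pos[of "Suc n"] by (intro mult_right_mono) auto
  also have "\<dots> = real (card ?X) * h n" using h_Suc_l[of n] by (simp add: mult.assoc mult.commute[of "h (Suc n)"])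
  also have "\<dots> \<le> 1" by (rule Suc)
  finally show ?case .
qed

lemma h_add_le: "h (k + n) \<le> (1/3) ^ k * h n"
proof (induction k)
  case (Suc k) then show ?case using h_Suc_le[of "k + n"] by simp
qed simp

lemma tail_h: "summable (\<lambda>n. 2 * h n)" "tail (\<lambda>n. 2 * h n) n \<le> 3 * h n"
proof -
  have s: "summable (\<lambda>k. (1/3::real) ^ k)" by (rule summable_geometric) simp
  show sm: "summable (\<lambda>n. 2 * h n)"
  proof (rule summable_comparison_test'[of _ 0])
    show "summable (\<lambda>k. 2 * (1/3::real) ^ k)" using s by (rule summable_mult)
    show "norm (2 * h n) \<le> 2 * (1/3) ^ n" for n using h_le_power[of n] h_pos[of n] by simp
  qed
  have "tail (\<lambda>n. 2 * h n) n \<le> (\<Sum>k. 2 * h n * (1/3) ^ k)"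
    unfolding tail_def
  proof (rule suminf_le)
    show "2 * h (k + n) \<le> 2 * h n * (1/3) ^ k" for k using h_add_le[of k n] by (simp add: mult_ac)
    show "summable (\<lambda>k. 2 * h (k + n))" using sm by (simp add: summable_iff_shift[of "\<lambda>n. 2 * h n"])
    show "summable (\<lambda>k. 2 * h n * (1/3::real) ^ k)" using s by (rule summable_mult)
  qed
  also have "\<dots> = 3 * h n" using suminf_geometric[of "1/3::real"] suminf_mult[OF s, of "2 * h n"] by simp
  finally show "tail (\<lambda>n. 2 * h n) n \<le> 3 * h n" .
qed

end

context vicsek_space
begin

lemma ext_append: "\<exists>v. ext e w j = w @ v"
  by (induction j) auto

lemma limit_at_vertex:
  assumes v: "\<And>n w x. w \<in> W n \<Longrightarrow> x \<in> box w \<Longrightarrow> x \<in> K \<Longrightarrow> \<bar>v x - a w\<bar> \<le> 6 * h n"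
    and w: "w \<in> W n" "e \<in> insert 0 dirs" and lim: "(\<lambda>j. a (ext e w j)) \<longlonglongrightarrow> c"
  shows "v (ctr w + of_real (h n) * e) = c"
proof -
  let ?z = "ctr w + of_real (h n) * e"
  have "(\<lambda>j. v ?z - a (ext e w j)) \<longlonglongrightarrow> 0"
  proof (rule Lim_null_comparison)
    show "\<forall>\<^sub>F j in sequentially. norm (v ?z - a (ext e w j)) \<le> 6 * h (n + j)"
      using v[OF ext_W[OF w] vertex_in_ext[OF w] vertex_in_K[OF w]] by (simp add: always_eventually)
    show "(\<lambda>j. 6 * h (n + j)) \<longlonglongrightarrow> 0"
      using tendsto_mult_right_zero[OF LIMSEQ_ignore_initial_segment[OF h_tendsto_0, of n], of 6] by (simp add: add.commute)
  qed
  moreover have "(\<lambda>j. v ?z - a (ext e w j)) \<longlonglongrightarrow> v ?z - c" by (intro tendsto_intros lim)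
  ultimately show ?thesis using LIMSEQ_unique by fastforce
qed

lemma ext_axis:
  assumes "on_axis w" "w \<in> W n" "crd_y e = 0"
  shows "on_axis (ext e w j)"
proof (induction j)
  case (Suc j)
  then show ?case using assms(3) by (simp only: ext.simps on_axis_snoc crd_scale) simp
qed (use assms in simp)

lemma finite_energy_nonconstant:
  obtains v where "continuous_on K v" "\<And>n. h n powr (1 - p) * en v n \<le> 4 * 12 powr p" "nonconstant \<mu> v"
proof -
  let ?\<eta> = "\<lambda>n. 2 * h n"
  obtain v where v: "continuous_on K v"
    and v0: "\<And>n w x. 0 \<le> n \<Longrightarrow> w \<in> W n \<Longrightarrow> x \<in> box w \<Longrightarrow> x \<in> K \<Longrightarrow> \<bar>v x - axis_value w\<bar> \<le> 2 * tail ?\<eta> n"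
  proof (rule limit_function[where a = axis_value and start = 0 and \<eta> = ?\<eta>])
    show "summable ?\<eta>" by (rule tail_h)
    show "0 \<le> 2 * h n" for n using h_pos[of n] by simp
    show "\<bar>axis_value (w @ [s]) - axis_value w\<bar> \<le> 2 * h n" if ws: "w \<in> W n" "s \<in> S_set (l (Suc n))" for n w s
    proof (cases "on_axis w")
      case True
      have "\<bar>crd_x s\<bar> \<le> norm1 s" by (simp add: norm1_def)
      also have "\<dots> \<le> 1" using S_set_norm1[OF l_odd ws(2)] l_pos[of "Suc n"] by (smt (verit) divide_nonneg_nonneg of_nat_0_le_iff)
      finally have "h n * \<bar>crd_x s\<bar> \<le> h n * 2" using h_pos[of n] by (intro mult_left_mono) auto
      then show ?thesis using axis_value_snoc_on[OF True ws(2)] W_length[OF ws(1)] h_pos[of n] by (simp add: abs_mult)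
    next
      case False
      then show ?thesis using h_pos[of n] by (simp add: axis_value_off)
    qed
    show "\<bar>axis_value w' - axis_value w\<bar> \<le> 2 * h n"
      if ww: "w \<in> W n" "w' \<in> W n" "e \<in> dirs" "ctr w' = ctr w + of_real (2 * h n) * e" for n w w' e
    proof -
      consider "on_axis w" "on_axis w'" | "axis_value w = axis_value w'" using adjacent_axis[OF ww] by blast
      then show ?thesis
      proof cases
        case 1
        have "crd_x (ctr w') - crd_x (ctr w) = 2 * h n * crd_x e" unfolding ww(4) crd_add crd_scale by simp
        then show ?thesis using 1 ww(3) h_pos[of n] by (auto simp: axis_value_on dirs_crd)
      qed (use h_pos[of n] in simp)
    qed
  qed blast
  have v6: "\<bar>v x - axis_value w\<bar> \<le> 6 * h n" if "w \<in> W n" "x \<in> box w" "x \<in> K" for n w x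
    using v0[OF _ that] tail_h(2)[of n] by simp
  \<comment> \<open>All extensions of a word off the axis have the same value, so the limit function
    agrees at all vertices of the cell.\<close>
  have off: "eW v w = 0" if w: "w \<in> W n" "\<not> on_axis w" for n w
  proof -
    have "v (ctr w + of_real (h n) * e) = axis_value w" if e: "e \<in> insert 0 dirs" for e
    proof (rule limit_at_vertex[OF v6 w(1) e])
      have "axis_value (ext e w j) = axis_value w" for j using ext_append[of e w j] axis_value_off[OF w(2)] by auto
      then show "(\<lambda>j. axis_value (ext e w j)) \<longlonglongrightarrow> axis_value w" by simp
    qed
    from this[of 0] this show ?thesis using p by (simp add: eW_def W_length[OF w(1)])
  qed
  have eWle: "eW v w \<le> (if on_axis w then 4 * (12 * h n) powr p else 0)" if w: "w \<in> W n" for n w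
  proof (cases "on_axis w")
    case True
    have "eW v w \<le> (\<Sum>e\<in>dirs. (12 * h n) powr p)"
      unfolding eW_def W_length[OF w]
    proof (rule sum_mono)
      fix e assume e: "e \<in> dirs"
      have "\<bar>v (ctr w) - axis_value w\<bar> \<le> 6 * h n"
        using v6[OF w ctr_in_box] vertex_in_K[OF w, of 0] by simp
      moreover have "\<bar>v (ctr w + of_real (h n) * e) - axis_value w\<bar> \<le> 6 * h n"
        using v6[OF w, of "ctr w + of_real (h n) * e"] corner_in_box[OF e, of w] vertex_in_K[OF w, of e] e W_length[OF w] by simp
      ultimately have "\<bar>v (ctr w) - v (ctr w + of_real (h n) * e)\<bar> \<le> 12 * h n" by linarith
      then show "\<bar>v (ctr w) - v (ctr w + of_real (h n) * e)\<bar> powr p \<le> (12 * h n) powr p"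
        using p by (intro powr_mono2) auto
    qed
    then show ?thesis using True by (simp add: dirs_card)
  qed (simp add: off[OF w])
  have energy: "h n powr (1 - p) * en v n \<le> 4 * 12 powr p" for n
  proof -
    have "en v n \<le> (\<Sum>w\<in>W n. if on_axis w then 4 * (12 * h n) powr p else 0)"
      unfolding en_def by (intro sum_mono eWle)
    also have "\<dots> = real (card {w\<in>W n. on_axis w}) * (4 * (12 * h n) powr p)"
      using finite_W by (simp add: sum.If_cases Int_def)
    also have "(12 * h n) powr p = 12 powr p * (h n powr (p - 1) * h n)"
      using h_pos[of n] by (simp add: powr_mult powr_diff)
    finally have "en v n \<le> (real (card {w\<in>W n. on_axis w}) * h n) * (4 * 12 powr p * h n powr (p - 1))" by (simp add: mult_ac)
    also have "\<dots> \<le> 1 * (4 * 12 powr p * h n powr (p - 1))" by (intro mult_right_mono card_on_axis) simp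
    finally have "h n powr (1 - p) * en v n \<le> h n powr (1 - p) * (4 * 12 powr p * h n powr (p - 1))" by (intro mult_left_mono) auto
    also have "\<dots> = 4 * 12 powr p * (h n powr (1 - p) * h n powr (p - 1))" by simp
    also have "h n powr (1 - p) * h n powr (p - 1) = 1" using h_pos[of n] by (simp flip: powr_add)
    finally show ?thesis by simp
  qed
  have nil: "[] \<in> W 0" "on_axis []" by (auto simp: W_0 on_axis_def)
  have "v (ctr [] + of_real (h 0) * q_pt 1) = 1"
  proof (rule limit_at_vertex[OF v6 nil(1)])
    have q1: "q_pt 1 \<in> insert 0 dirs" by (simp add: dirs_eq)
    show "q_pt 1 \<in> insert 0 dirs" by (rule q1)
    have "axis_value (ext (q_pt 1) [] j) = 1 - h j" for j
    proof -
      have "ctr (ext (q_pt 1) [] j) = of_real (1 - h j) * q_pt 1"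
        using ext_snoc_ctr[OF nil(1) q1, of j] by (simp add: ctr_Nil h_0 algebra_simps)
      moreover have "on_axis (ext (q_pt 1) [] j)" using ext_axis[OF nil(2,1)] crd_q by simp
      ultimately show ?thesis using crd_q by (simp only: axis_value_on crd_scale) simp
    qed
    then show "(\<lambda>j. axis_value (ext (q_pt 1) [] j)) \<longlonglongrightarrow> 1"
      using tendsto_diff[OF tendsto_const[of 1] h_tendsto_0] by simp
  qed
  then have v1: "v (q_pt 1) = 1" by (simp add: ctr_Nil h_0)
  have "v (ctr [] + of_real (h 0) * 0) = 0"
  proof (rule limit_at_vertex[OF v6 nil(1)])
    show "(0::complex) \<in> insert 0 dirs" by simp
    have "axis_value (ext 0 [] j) = 0" for j
      using ext_snoc_ctr[OF nil(1), of 0 j] ext_axis[OF nil(2,1), of 0 j] crd_0 by (simp add: axis_value_on ctr_Nil)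
    then show "(\<lambda>j. axis_value (ext 0 [] j)) \<longlonglongrightarrow> 0" by simp
  qed
  then have v00: "v 0 = 0" by (simp add: ctr_Nil)
  have "nonconstant \<mu> v"
    unfolding nonconstant_def
  proof
    assume "\<exists>c. AE x in \<mu>. v x = c"
    then obtain c where c: "AE x in \<mu>. v x = c" by blast
    have "v (ctr [] + of_real (h 0) * e) = c" if e: "e \<in> insert 0 dirs" for e
    proof -
      let ?z = "ctr [] + of_real (h 0) * e"
      have "\<bar>v ?z - c\<bar> \<le> 12 * h j" for j
      proof -
        have ex: "ext e [] j \<in> W j" using ext_W[OF nil(1) e, of j] by simp
        \<comment> \<open>The cells shrinking to the vertex have positive mass. A value taken almost
          everywhere is thus taken in each of them and, in the limit, at the vertex; this
          contradicts the values 1 and 0.\<close>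
        have "\<exists>x\<in>cl (ext e [] j). v x = c"
        proof (rule ccontr)
          assume none: "\<not> ?thesis"
          from c have "AE x in \<mu>. x \<notin> cl (ext e [] j)" by eventually_elim (use none in blast)
          then have "emeasure \<mu> (cl (ext e [] j)) = 0"
            using AE_iff_null_sets[OF cl_sets] by blast
          then show False using emeasure_cl[OF ex] ps_pos[of j] by simp
        qed
        then obtain x where x: "x \<in> cl (ext e [] j)" "v x = c" by blast
        have "\<bar>v x - axis_value (ext e [] j)\<bar> \<le> 6 * h j" using v6[OF ex] x by blast
        moreover have "\<bar>v ?z - axis_value (ext e [] j)\<bar> \<le> 6 * h j"
          using v6[OF ex vertex_in_ext[OF nil(1) e] vertex_in_K[OF nil(1) e]] .
        ultimately show ?thesis using x(2) by linarith
      qed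
      then have "\<bar>v ?z - c\<bar> \<le> 12 * 0"
        by (intro LIMSEQ_le_const[OF tendsto_mult_left[OF h_tendsto_0]]) auto
      then show ?thesis by simp
    qed
    from this[of 0] this[of "q_pt 1"] show False using v1 v00 by (simp add: ctr_Nil h_0 dirs_eq)
  qed
  then show ?thesis using that v energy by blast
qed

end

section \<open>The critical exponent\<close>

lemma ennreal_rescale_le:
  assumes "X \<le> ennreal C * Y" "C \<le> c" "1 \<le> c"
  shows "ennreal (1 / c) * X \<le> Y"
proof -
  have "ennreal (1 / c) * X \<le> ennreal (1 / c) * (ennreal c * Y)"
    using assms by (intro mult_left_mono order_trans[OF assms(1)] mult_right_mono ennreal_leI) auto
  also have "\<dots> = (ennreal (1 / c) * ennreal c) * Y" by (simp only: mult.assoc)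
  also have "ennreal (1 / c) * ennreal c = 1" using assms by (simp flip: ennreal_mult)
  finally show ?thesis by simp
qed

lemma ennreal_weaken_const: "X \<le> ennreal C * Y \<Longrightarrow> C \<le> c \<Longrightarrow> X \<le> ennreal c * Y"
  by (erule order_trans) (intro mult_right_mono ennreal_leI, auto)

lemma tail_sum_le: "(\<Sum>k. f (N + k)) \<le> (\<Sum>n. f n :: ennreal)"
  using suminf_shift_le_ennreal[of f N] by (simp add: add.commute)

context vicsek_energy
begin

text \<open>\<open>e1\<close> is the energy in the normalisation of \<open>E_p\<close>, with
  \<open>h n\<close>, while \<open>EE 1\<close> is normalised by the scale
  \<open>2 * h n\<close>.\<close>

definition e1 :: "(complex \<Rightarrow> real) \<Rightarrow> nat \<Rightarrow> real" where "e1 u n = h n powr (1 - p) * en u n"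
definition SE :: "(complex \<Rightarrow> real) \<Rightarrow> ennreal" where "SE u = (SUP n. EE 1 u n)"

lemma critical: "2 / (p + 1) < 1" "0 < 2 / (p + 1)" using p by (auto simp: field_simps)

lemma EE_1: "EE 1 u n = ennreal (2 powr (1 - p)) * ennreal (e1 u n)"
proof -
  have "ph n powr (- 1) * ps n = (2 * h n) powr (1 - p)"
    using ps_pos[of n] h_pos[of n] ph_pos[of n] powr_minus_divide[of "2 * h n" "p - 1"]
    by (simp add: powr_minus_divide ph_def)
  also have "\<dots> = 2 powr (1 - p) * h n powr (1 - p)" by (simp add: powr_mult)
  finally show ?thesis using en_nonneg[of u n] by (simp add: EE_def e1_def mult.assoc flip: ennreal_mult)
qed

text \<open>All dependence on \<open>\<theta>\<close> is in the first factor. Below the critical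
  exponent \<open>E_pp\<close> is therefore controlled by the series of \<open>ph n powr s\<close>
  with \<open>s = 1 - \<theta>\<close>.\<close>

lemma EE_scale: "EE \<theta> u n = ennreal (ph n powr (1 - \<theta>)) * EE 1 u n"
proof -
  have "ph n powr (- \<theta>) = ph n powr (1 - \<theta>) * ph n powr (- 1)" using powr_add[of "ph n" "1 - \<theta>" "-1"] by simp
  then show ?thesis using ps_pos[of n] en_nonneg[of u n] by (simp add: EE_def mult.assoc flip: ennreal_mult)
qed

lemma e1_mono: "e1 u n \<le> e1 u (n + k)"
proof (induction k)
  case (Suc k)
  let ?m = "real (l (Suc (n + k)))"
  have "h (n + k) powr (1 - p) * ?m powr (p - 1) = h (Suc (n + k)) powr (1 - p)"
    using h_pos[of "n + k"] l_pos[of "Suc (n + k)"] powr_minus_divide[of ?m "p - 1"] by (simp add: h_Suc powr_divide)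
  then have "e1 u (n + k) \<le> e1 u (Suc (n + k))"
    using mult_left_mono[OF en_le_Suc[of u "n + k"], of "h (n + k) powr (1 - p)"]
    by (simp add: e1_def mult.assoc[symmetric])
  then show ?case using Suc by simp
qed simp

lemma EE1_mono: "EE 1 u n \<le> EE 1 u (n + k)"
  unfolding EE_1 by (intro mult_left_mono ennreal_leI e1_mono) simp

lemma E_p_SE: "E_p l p u = ennreal (2 powr (p - 1)) * SE u"
proof -
  have pr: "(\<Prod>j\<le>n. real (l j) powr (p - 1)) = h n powr (1 - p)" for n
  proof (induction n)
    case (Suc n)
    have "(\<Prod>j\<le>Suc n. real (l j) powr (p - 1)) = h n powr (1 - p) * real (l (Suc n)) powr (p - 1)"
      using Suc by simp
    also have "\<dots> = h (Suc n) powr (1 - p)"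
      using h_pos[of n] l_pos[of "Suc n"] powr_minus_divide[of "real (l (Suc n))" "p - 1"]
      by (simp add: h_Suc powr_divide)
    finally show ?case .
  qed (simp add: l_0 h_0)
  have "ennreal (2 powr (p - 1)) * EE 1 u n = ennreal (e1 u n)" for n
  proof -
    have "ennreal (2 powr (p - 1)) * ennreal (2 powr (1 - p)) = 1" by (simp flip: ennreal_mult powr_add)
    then show ?thesis by (simp add: EE_1 mult.assoc[symmetric])
  qed
  then show ?thesis
    unfolding E_p_def sum_edges pr SE_def SUP_mult_left_ennreal by (simp add: e1_def)
qed

lemma E_pinf_SUP: "E_pinf l p bs \<beta> u = (SUP n. EE (\<beta> / bs) u n)"
  by (simp add: E_pinf_def E_level_EE)
lemma E_pp_sum: "E_pp l p bs \<beta> u = (\<Sum>n. EE (\<beta> / bs) u n)"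
  by (simp add: E_pp_def E_level_EE)

section \<open>The series of \<open>ph n powr s\<close> as \<open>s\<close> tends to 0\<close>

definition A_up :: real where "A_up = ph 0 * (1 + (p - 1) * ln 3) / ((p - 1) * ln 3)"
definition P :: real where "P = 2 * L * L powr (p - 1)"

lemma A_up_pos: "0 < A_up"
  unfolding A_up_def using ph_pos[of 0] p by (intro divide_pos_pos mult_pos_pos add_pos_nonneg) auto

lemma P_gt_1: "1 < P"
proof -
  have "1 \<le> L powr (p - 1)" using L_ge3 p by (intro ge_one_powr_ge_zero) auto
  then have "2 * L * 1 \<le> P" unfolding P_def using L_ge3 by (intro mult_left_mono) auto
  then show ?thesis using L_ge3 by simp
qed

lemma ph_0: "ph 0 = 2 powr (p - 1)" by (simp add: ph_def h_0 ps_0)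

text \<open>\<open>ph\<close> decays at least like the powers of \<open>sig 1\<close>, which is 3 to
  the power \<open>1 - p\<close>, so a geometric series of ratio \<open>exp (- y)\<close> dominates.
  Bounding 1 / (1 - exp (- y)) by (1 + y) / y, with y at most \<open>(p - 1) * ln 3\<close> in the
  numerator, gives \<open>A_up\<close>.\<close>

lemma sum_ph_upper:
  assumes s: "0 < s" "s \<le> 1" shows "(\<Sum>n. ennreal (ph n powr s)) \<le> ennreal (A_up / s)"
proof -
  define y where "y = (p - 1) * s * ln 3"
  have y: "0 < y" "y \<le> (p - 1) * ln 3" using p s by (auto simp: y_def)
  have "ph n powr s \<le> ph 0 * exp (- y) ^ n" for n
  proof -
    have "ph n \<le> sig 1 ^ n * ph 0"
      using ratio_bound_ph[OF critical(1) order_refl order_refl, of 0 n] ph_pos[of n] ph_pos[of 0] by simp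
    then have "ph n powr s \<le> (sig 1 ^ n * ph 0) powr s" using ph_pos[of n] s by (intro powr_mono2) auto
    also have "\<dots> = (sig 1 ^ n) powr s * ph 0 powr s" by (simp add: powr_mult sig_def)
    also have "(sig 1 ^ n) powr s = exp (- y) ^ n"
      by (simp add: sig_def y_def powr_def exp_of_nat_mult[symmetric] ln_realpow algebra_simps)
    also have "ph 0 powr s \<le> ph 0 powr 1" using s p by (intro powr_mono) (auto simp: ph_0 ge_one_powr_ge_zero)
    finally show ?thesis using ph_pos[of 0] by (simp add: mult.commute mult_left_mono)
  qed
  then have "(\<Sum>n. ennreal (ph n powr s)) \<le> (\<Sum>n. ennreal (ph 0) * ennreal (exp (- y) ^ n))"
    using ph_pos[of 0] by (intro suminf_le) (auto intro!: ennreal_leI simp flip: ennreal_mult)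
  also have "\<dots> = ennreal (ph 0) * ennreal (1 / (1 - exp (- y)))"
    using y by (simp only: ennreal_suminf_cmult) (subst geometric_ennreal, auto)
  also have "\<dots> = ennreal (ph 0 * (1 / (1 - exp (- y))))"
    using y ph_pos[of 0] by (intro ennreal_mult[symmetric]) auto
  also have "\<dots> \<le> ennreal (A_up / s)"
  proof (rule ennreal_leI)
    have "exp (- y) \<le> 1 / (1 + y)" using exp_ge_add_one_self[of y] y by (simp add: exp_minus inverse_eq_divide frac_le)
    then have "y / (1 + y) \<le> 1 - exp (- y)" using y by (simp add: field_simps)
    then have "1 / (1 - exp (- y)) \<le> 1 / (y / (1 + y))" using y by (intro divide_left_mono) auto
    also have "\<dots> = (1 + y) / y" by simp
    also have "\<dots> \<le> (1 + (p - 1) * ln 3) / y" using y by (intro divide_right_mono) auto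
    finally have "ph 0 * (1 / (1 - exp (- y))) \<le> ph 0 * ((1 + (p - 1) * ln 3) / y)"
      using ph_pos[of 0] by (intro mult_left_mono) auto
    also have "\<dots> = A_up / s" by (simp add: A_up_def y_def mult_ac)
    finally show "ph 0 * (1 / (1 - exp (- y))) \<le> A_up / s" .
  qed
  finally show ?thesis .
qed

text \<open>\<open>ph\<close> loses at most the factor \<open>P\<close> per level, and 1 / (1 - exp
  (- y)) is at least 1 / y. Dropping the first \<open>N\<close> terms costs
  \<open>P powr (- s * real N)\<close>, which tends to 1 as \<open>s\<close> tends to 0.\<close>

lemma sum_ph_lower:
  assumes s: "0 < s" "s \<le> 1"
  shows "ennreal (P powr (- s * real N) / (s * ln P)) \<le> (\<Sum>k. ennreal (ph (N + k) powr s))"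
proof -
  have P: "1 < P" by (rule P_gt_1)
  define y where "y = s * ln P"
  have y: "0 < y" using P s by (simp add: y_def)
  have ph_ge: "1 \<le> P ^ n * ph n" for n
  proof (induction n)
    case 0 show ?case using p by (simp add: ph_0 ge_one_powr_ge_zero)
  next
    case (Suc n)
    have "P ^ n * ph n \<le> P ^ n * (P * ph (Suc n))" unfolding P_def
      using ph_ratio[of n] L_ge3 by (intro mult_left_mono) auto
    then show ?case using Suc by (simp add: mult_ac)
  qed
  have "P powr (- s * real N) * exp (- y) ^ k \<le> ph (N + k) powr s" for k
  proof -
    have "1 / P ^ (N + k) \<le> ph (N + k)" using ph_ge[of "N + k"] P by (simp add: divide_le_eq mult.commute)
    then have "(1 / P ^ (N + k)) powr s \<le> ph (N + k) powr s" using P s by (intro powr_mono2) auto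
    moreover have "(1 / P ^ (N + k)) powr s = P powr (- s * real N) * exp (- y) ^ k"
    proof -
      have "(1 / P ^ (N + k)) powr s = exp (- (real (N + k) * ln P) * s)"
        using P by (simp add: powr_def ln_div ln_realpow mult_ac)
      also have "\<dots> = exp (- s * real N * ln P + real k * (- y))" by (simp add: y_def algebra_simps)
      also have "\<dots> = P powr (- s * real N) * exp (- y) ^ k"
        using P by (simp only: exp_add exp_of_nat_mult) (simp add: powr_def)
      finally show ?thesis .
    qed
    ultimately show ?thesis by simp
  qed
  then have "(\<Sum>k. ennreal (P powr (- s * real N)) * ennreal (exp (- y) ^ k)) \<le> (\<Sum>k. ennreal (ph (N + k) powr s))"
    by (intro suminf_le) (auto intro!: ennreal_leI simp flip: ennreal_mult)
  also have "(\<Sum>k. ennreal (P powr (- s * real N)) * ennreal (exp (- y) ^ k)) = ennreal (P powr (- s * real N)) * ennreal (1 / (1 - exp (- y)))"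
    using y by (simp only: ennreal_suminf_cmult) (subst geometric_ennreal, auto)
  also have "\<dots> = ennreal (P powr (- s * real N) * (1 / (1 - exp (- y))))"
    using y by (intro ennreal_mult[symmetric]) auto
  finally have *: "ennreal (P powr (- s * real N) * (1 / (1 - exp (- y)))) \<le> (\<Sum>k. ennreal (ph (N + k) powr s))" .
  have "1 / y \<le> 1 / (1 - exp (- y))"
    using y exp_ge_add_one_self[of "- y"] by (intro divide_left_mono) auto
  then have "P powr (- s * real N) / (s * ln P) \<le> P powr (- s * real N) * (1 / (1 - exp (- y)))"
    using mult_left_mono[of "1 / y" "1 / (1 - exp (- y))" "P powr (- s * real N)"] by (simp add: y_def)
  then show ?thesis using * ennreal_leI order_trans by blast
qed

lemma E_pp_upper:
  assumes "0 < bs" "0 \<le> \<beta>" "\<beta> < bs"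
  shows "ennreal (bs - \<beta>) * E_pp l p bs \<beta> u \<le> ennreal (bs * A_up) * SE u"
proof -
  define s where "s = 1 - \<beta> / bs"
  have s: "0 < s" "s \<le> 1" "bs - \<beta> = bs * s" using assms by (auto simp: s_def field_simps)
  have "E_pp l p bs \<beta> u = (\<Sum>n. ennreal (ph n powr s) * EE 1 u n)"
    unfolding E_pp_sum s_def by (intro arg_cong[where f=suminf] ext EE_scale)
  also have "\<dots> \<le> (\<Sum>n. ennreal (ph n powr s) * SE u)"
    unfolding SE_def by (intro suminf_le mult_left_mono SUP_upper) auto
  also have "\<dots> \<le> ennreal (A_up / s) * SE u"
    unfolding ennreal_suminf_multc by (intro mult_right_mono sum_ph_upper s) simp
  finally have "ennreal (bs - \<beta>) * E_pp l p bs \<beta> u \<le> ennreal (bs * s) * (ennreal (A_up / s) * SE u)"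
    unfolding s(3) by (intro mult_left_mono) auto
  also have "\<dots> = ennreal (bs * s * (A_up / s)) * SE u"
    using s assms A_up_pos by (subst ennreal_mult) (auto simp: mult.assoc)
  finally show ?thesis using s by simp
qed

text \<open>From level \<open>N\<close> on the critical energies are at least
  \<open>EE 1 u N\<close>, and the tail of the series supplies 1 / s, which cancels against
  \<open>bs - \<beta>\<close>. The last hypothesis holds for \<beta> close to \<open>bs\<close> and
  accounts for the 2.\<close>

lemma E_pp_lower:
  assumes "0 < bs" "0 \<le> \<beta>" "\<beta> < bs" "1/2 \<le> P powr (- (1 - \<beta> / bs) * real N)"
  shows "ennreal (bs / (2 * ln P)) * EE 1 u N \<le> ennreal (bs - \<beta>) * E_pp l p bs \<beta> u"
proof -
  define s where "s = 1 - \<beta> / bs"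
  have s: "0 < s" "s \<le> 1" "bs - \<beta> = bs * s" using assms by (auto simp: s_def field_simps)
  have lnP: "0 < ln P" using P_gt_1 by simp
  have "bs / (2 * ln P) = bs * s * ((1/2) / (s * ln P))" using s lnP by simp
  also have "\<dots> \<le> bs * s * (P powr (- s * real N) / (s * ln P))"
    using assms s lnP by (intro mult_left_mono divide_right_mono) (auto simp: s_def)
  finally have "ennreal (bs / (2 * ln P)) * EE 1 u N \<le> ennreal (bs * s * (P powr (- s * real N) / (s * ln P))) * EE 1 u N"
    by (intro mult_right_mono ennreal_leI) auto
  also have "\<dots> = ennreal (bs * s) * (ennreal (P powr (- s * real N) / (s * ln P)) * EE 1 u N)"
    using s lnP assms by (subst ennreal_mult) (auto simp: mult.assoc)
  also have "\<dots> \<le> ennreal (bs * s) * (\<Sum>k. ennreal (ph (N + k) powr s) * EE 1 u N)"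
    unfolding ennreal_suminf_multc by (intro mult_left_mono mult_right_mono sum_ph_lower s) auto
  also have "\<dots> \<le> ennreal (bs * s) * (\<Sum>k. ennreal (ph (N + k) powr s) * EE 1 u (N + k))"
    by (intro mult_left_mono suminf_le EE1_mono) auto
  also have "\<dots> = ennreal (bs * s) * (\<Sum>k. EE (\<beta> / bs) u (N + k))"
  proof -
    have "(\<lambda>k. ennreal (ph (N + k) powr s) * EE 1 u (N + k)) = (\<lambda>k. EE (\<beta> / bs) u (N + k))"
      unfolding s_def by (rule ext) (rule EE_scale[symmetric])
    then show ?thesis by simp
  qed
  also have "\<dots> \<le> ennreal (bs * s) * E_pp l p bs \<beta> u"
    unfolding E_pp_sum by (intro mult_left_mono tail_sum_le) auto
  finally show ?thesis by (simp add: s(3))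
qed

lemma E_pp_lower_eventually:
  assumes bs: "0 < bs"
  shows "\<forall>\<^sub>F \<beta> in at_left bs. 0 \<le> \<beta> \<and> \<beta> < bs \<and> ennreal (bs / (2 * ln P)) * EE 1 u N \<le> ennreal (bs - \<beta>) * E_pp l p bs \<beta> u"
proof -
  have "((\<lambda>\<beta>. P powr (- (1 - \<beta> / bs) * real N)) \<longlongrightarrow> P powr (- (1 - bs / bs) * real N)) (at_left bs)"
    using P_gt_1 bs by (intro tendsto_intros) auto
  then have "\<forall>\<^sub>F \<beta> in at_left bs. 1/2 < P powr (- (1 - \<beta> / bs) * real N)"
    using bs P_gt_1 by (intro order_tendstoD(1)) auto
  moreover have "\<forall>\<^sub>F \<beta> in at_left bs. 0 < \<beta> \<and> \<beta> < bs"
    using eventually_at_left_real[OF bs] by (simp add: greaterThanLessThan_iff)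
  ultimately show ?thesis
  proof eventually_elim
    case (elim \<beta>)
    then show ?case using E_pp_lower[OF bs, of \<beta> N u] by auto
  qed
qed

end

context vicsek_space
begin

section \<open>Besov spaces, the critical exponent and limits\<close>

lemma Bpinf_iff: "u \<in> Bpinf l \<mu> p bs \<beta> \<longleftrightarrow> u \<in> Lp p \<mu> \<and> Phi_sup bs \<beta> u < \<top>"
  unfolding Bpinf_def mem_Collect_eq besov_pinf_finite by simp
lemma Bpp_iff: "u \<in> Bpp l \<mu> p bs \<beta> \<longleftrightarrow> u \<in> Lp p \<mu> \<and> Phi_int bs \<beta> u < \<top>"
  unfolding Bpp_def mem_Collect_eq besov_pp_finite by simp

definition comparable :: "real \<Rightarrow> real \<Rightarrow> real \<Rightarrow> (complex \<Rightarrow> real) \<Rightarrow> bool" where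
  "comparable c bs \<beta> u \<longleftrightarrow>
     Phi_sup bs \<beta> u \<le> ennreal c * E_pinf l p bs \<beta> u \<and> E_pinf l p bs \<beta> u \<le> ennreal c * Phi_sup bs \<beta> u \<and>
     Phi_int bs \<beta> u \<le> ennreal c * E_pp l p bs \<beta> u \<and> E_pp l p bs \<beta> u \<le> ennreal c * Phi_int bs \<beta> u"

text \<open>The constant depends on the exponent only through its range from \<open>t\<close> to
  \<open>t'\<close>. One constant for all \<beta> close to \<open>bs\<close> is what the limit at
  the critical exponent requires.\<close>

lemma uniform_comparison:
  assumes t: "2 / (p + 1) < t" "t \<le> 1"
  shows "\<exists>c\<ge>1. \<forall>bs \<beta> u. t \<le> \<beta> / bs \<longrightarrow> \<beta> / bs \<le> t' \<longrightarrow> continuous_on K u \<longrightarrow> comparable c bs \<beta> u"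
proof -
  define c where "c = Max {1, C_L t * (1 / (1 - lam t)) * C_J t', C_L t * (1 / (1 - lam t)) * (3/2 * C_J t'),
    C_U t * (1 / (1 - lam t)), C_U t * L * 2 * (1 / (1 - lam t))}"
  have c: "1 \<le> c" "C_L t * (1 / (1 - lam t)) * C_J t' \<le> c" "C_L t * (1 / (1 - lam t)) * (3/2 * C_J t') \<le> c"
    "C_U t * (1 / (1 - lam t)) \<le> c" "C_U t * L * 2 * (1 / (1 - lam t)) \<le> c"
    unfolding c_def by (rule Max_ge; simp)+
  have "comparable c bs \<beta> u" if *: "t \<le> \<beta> / bs" "\<beta> / bs \<le> t'" "continuous_on K u" for bs \<beta> u
    unfolding E_pinf_SUP E_pp_sum comparable_def
    using ennreal_weaken_const[OF EE_le_Phi_sup[OF t *] c(2)] ennreal_weaken_const[OF sum_EE_le_Phi_int[OF t *] c(3)]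
      ennreal_weaken_const[OF Phi_sup_le_EE[OF t *(1,3)] c(4)] ennreal_weaken_const[OF Phi_int_le_EE[OF t *(1,3)] c(5)]
    by blast
  then show ?thesis using c(1) by blast
qed

lemma exponent_range:
  assumes "2 / (p + 1) < \<theta>" obtains t where "2 / (p + 1) < t" "t \<le> 1" "t \<le> \<theta>"
  using assms critical by (intro that[of "min \<theta> 1"]) auto

lemma Bpinf_continuous_version:
  assumes "2 / (p + 1) < \<beta> / bs" "u \<in> Bpinf l \<mu> p bs \<beta>"
  obtains v where "continuous_on K v" "AE x in \<mu>. u x = v x"
proof -
  obtain t where t: "2 / (p + 1) < t" "t \<le> 1" "t \<le> \<beta> / bs" using exponent_range[OF assms(1)] .
  have u: "u \<in> Lp p \<mu>" "Phi_sup bs \<beta> u < \<top>" using assms(2) by (auto simp: Bpinf_iff)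
  define M where "M = enn2real (ennreal (C_J (\<beta> / bs)) * Phi_sup bs \<beta> u)"
  have "ennreal (C_J (\<beta> / bs)) * Phi_sup bs \<beta> u < \<top>" using u(2) by (simp add: ennreal_mult_less_top)
  then have M: "ennreal (C_J (\<beta> / bs)) * Phi_sup bs \<beta> u = ennreal M" by (simp add: M_def less_top)
  have "0 \<le> \<beta> / bs" using t(1,3) critical by linarith
  then have "JJ (\<beta> / bs) u (n + 2) \<le> ennreal M" for n
    using JJ_le_Phi_sup[of u \<beta> bs "\<beta> / bs" n] u(1) M by (simp add: Lp_def)
  from continuous_version[OF t u(1) this] show ?thesis using that by (auto simp: M_def)
qed

lemma Bpp_continuous_version:
  assumes "2 / (p + 1) < \<beta> / bs" "u \<in> Bpp l \<mu> p bs \<beta>"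
  obtains v where "continuous_on K v" "AE x in \<mu>. u x = v x"
proof -
  obtain t where t: "2 / (p + 1) < t" "t \<le> 1" "t \<le> \<beta> / bs" using exponent_range[OF assms(1)] .
  have u: "u \<in> Lp p \<mu>" "Phi_int bs \<beta> u < \<top>" using assms(2) by (auto simp: Bpp_iff)
  define M where "M = enn2real (ennreal (3/2 * C_J (\<beta> / bs)) * Phi_int bs \<beta> u)"
  have "ennreal (3/2 * C_J (\<beta> / bs)) * Phi_int bs \<beta> u < \<top>" using u(2) by (simp add: ennreal_mult_less_top)
  then have M: "ennreal (3/2 * C_J (\<beta> / bs)) * Phi_int bs \<beta> u = ennreal M" by (simp add: M_def less_top)
  have t0: "0 \<le> \<beta> / bs" using t(1,3) critical by linarith
  have "JJ (\<beta> / bs) u (n + 2) \<le> ennreal M" for n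
  proof -
    have "JJ (\<beta> / bs) u (n + 2) \<le> (\<Sum>n. JJ (\<beta> / bs) u (n + 2))"
      using sum_le_suminf[of "\<lambda>n. JJ (\<beta> / bs) u (n + 2)" "{n}"] by simp
    also have "\<dots> \<le> ennreal M" using sum_JJ_le_Phi_int[of u \<beta> bs "\<beta> / bs"] u(1) t0 M by (simp add: Lp_def)
    finally show ?thesis .
  qed
  from continuous_version[OF t u(1) this] show ?thesis using that by (auto simp: M_def)
qed

text \<open>Between the energies the inclusion is immediate, a supremum being at most the sum. The
  comparison for the continuous version carries it over to the seminorms.\<close>

lemma Bpp_subset_Bpinf:
  assumes "2 / (p + 1) < \<beta> / bs" shows "Bpp l \<mu> p bs \<beta> \<subseteq> Bpinf l \<mu> p bs \<beta>"
proof
  fix u assume u: "u \<in> Bpp l \<mu> p bs \<beta>"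
  obtain v where v: "continuous_on K v" "AE x in \<mu>. u x = v x" using Bpp_continuous_version[OF assms u] .
  obtain t where t: "2 / (p + 1) < t" "t \<le> 1" "t \<le> \<beta> / bs" using exponent_range[OF assms] .
  obtain c where c: "comparable c bs \<beta> v"
    using uniform_comparison[OF t(1,2), of "\<beta> / bs"] t(3) v(1) by blast
  have "Phi_int bs \<beta> v < \<top>" using u Phi_int_cong_AE[OF v(2)] by (simp add: Bpp_iff)
  then have "E_pp l p bs \<beta> v < \<top>" using c unfolding comparable_def
    by (metis ennreal_less_top ennreal_mult_less_top order_le_less_trans)
  moreover have "E_pinf l p bs \<beta> v \<le> E_pp l p bs \<beta> v"
    unfolding E_pinf_SUP E_pp_sum
  proof (rule SUP_least)
    fix n show "EE (\<beta> / bs) v n \<le> (\<Sum>n. EE (\<beta> / bs) v n)"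
      using sum_le_suminf[of "EE (\<beta> / bs) v" "{n}"] by simp
  qed
  ultimately have "Phi_sup bs \<beta> v < \<top>" using c unfolding comparable_def
    by (metis ennreal_less_top ennreal_mult_less_top order_le_less_trans)
  then show "u \<in> Bpinf l \<mu> p bs \<beta>"
    using u Phi_sup_cong_AE[OF v(2)] by (simp add: Bpp_iff Bpinf_iff)
qed

text \<open>All \<open>Gam\<close> vanish, so \<open>point_vertex_le\<close> at level 0 bounds the
  increment from the vertex 0 by zero; any weight will do, here 1/2.\<close>

lemma zero_energy_constant:
  assumes u: "continuous_on K u" and en: "\<And>n. en u n = 0" and x: "x \<in> K"
  shows "u x = u 0"
proof -
  have half: "0 < (1/2::real)" "(1/2::real) < 1" by auto
  have Gam: "Gam u n x = 0" for n
  proof -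
    have "(\<Sum>w\<in>W n. GW u w) = 0" using en[of "Suc n"] by (simp add: en_Suc)
    then have "\<forall>w\<in>W n. GW u w = 0" using GW_nonneg finite_W by (subst (asm) sum_nonneg_eq_0_iff) auto
    then show ?thesis by (simp add: Gam_def)
  qed
  obtain w where w: "w \<in> W 0" "x \<in> box w" using in_K_iff x by blast
  have "ctr w = 0" using w(1) by (simp add: W_0 ctr_Nil)
  then have "0 \<in> verts w" by (simp add: verts_def)
  from point_vertex_le[OF half u w x this] have "ennreal (\<bar>u x - u 0\<bar> powr p) \<le> 0"
    by (simp add: Tm_def Gam)
  then show ?thesis by simp
qed

text \<open>Finite energy at \<beta> bounds the critical energy of level \<open>n + k\<close> by a
  multiple of a positive power of \<open>ph (n + k)\<close>. Critical energies increase with the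
  level, so letting \<open>k\<close> tend to infinity forces that of level \<open>n\<close> to
  vanish.\<close>

lemma supercritical_constant:
  assumes bs: "0 < bs" "bs < \<beta>" and u: "u \<in> Bpinf l \<mu> p bs \<beta>"
  shows "\<not> nonconstant \<mu> u"
proof -
  let ?\<theta> = "\<beta> / bs"
  have th: "1 < ?\<theta>" using bs by simp
  have crit: "2 / (p + 1) < ?\<theta>" using th critical by linarith
  obtain v where v: "continuous_on K v" "AE x in \<mu>. u x = v x" using Bpinf_continuous_version[OF crit u] .
  have "Phi_sup bs \<beta> v < \<top>" using u Phi_sup_cong_AE[OF v(2)] by (simp add: Bpinf_iff)
  moreover have "(SUP n. EE ?\<theta> v n) \<le> ennreal (C_L 1 * (1 / (1 - lam 1)) * C_J ?\<theta>) * Phi_sup bs \<beta> v"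
    using th by (intro EE_le_Phi_sup critical v(1)) auto
  ultimately have "(SUP n. EE ?\<theta> v n) < \<top>"
    by (metis ennreal_less_top ennreal_mult_less_top order_le_less_trans)
  then obtain M where M: "(SUP n. EE ?\<theta> v n) = ennreal M" "0 \<le> M" by (cases "SUP n. EE ?\<theta> v n") auto
  have e1_le: "2 powr (1 - p) * e1 v n \<le> M * ph (n + k) powr (?\<theta> - 1)" for n k
  proof -
    have e0: "0 \<le> e1 v (n + k)" using en_nonneg by (simp add: e1_def)
    have "EE ?\<theta> v (n + k) \<le> ennreal M" unfolding M(1)[symmetric] by (rule SUP_upper) simp
    then have "ph (n + k) powr (1 - ?\<theta>) * (2 powr (1 - p) * e1 v (n + k)) \<le> M"
      using M(2) e0 unfolding EE_scale[of ?\<theta>] EE_1 by (simp flip: ennreal_mult)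
    from mult_left_mono[OF this, of "ph (n + k) powr (?\<theta> - 1)"]
    have "(ph (n + k) powr (?\<theta> - 1) * ph (n + k) powr (1 - ?\<theta>)) * (2 powr (1 - p) * e1 v (n + k)) \<le> M * ph (n + k) powr (?\<theta> - 1)"
      by (simp add: mult_ac)
    moreover have "ph (n + k) powr (?\<theta> - 1) * ph (n + k) powr (1 - ?\<theta>) = 1"
      using ph_pos[of "n + k"] by (simp flip: powr_add)
    moreover have "2 powr (1 - p) * e1 v n \<le> 2 powr (1 - p) * e1 v (n + k)"
      by (intro mult_left_mono e1_mono) simp
    ultimately show ?thesis by (simp only: mult_1_left)
  qed
  have "(\<lambda>k. ph k) \<longlonglongrightarrow> 0"
  proof (rule real_tendsto_sandwich[OF _ _ tendsto_const])
    have "sig 1 < 1" using lam_bounds[OF critical(1)] mult_strict_mono[of "lam 1" 1 "lam 1" 1] by simp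
    then show "(\<lambda>n. sig 1 ^ n * ph 0) \<longlonglongrightarrow> 0"
      using tendsto_mult_right[OF LIMSEQ_power_zero[of "sig 1"], of "ph 0"] lam_bounds[OF critical(1)] by simp
    show "\<forall>\<^sub>F n in sequentially. ph n \<le> sig 1 ^ n * ph 0"
      using ratio_bound_ph[OF critical(1) order_refl order_refl, of 0] ph_pos by (simp add: always_eventually abs_of_pos)
    show "\<forall>\<^sub>F n in sequentially. 0 \<le> ph n" using ph_pos by (simp add: always_eventually less_imp_le)
  qed
  then have "(\<lambda>k. ph (k + n)) \<longlonglongrightarrow> 0" for n by (rule LIMSEQ_ignore_initial_segment)
  then have lim: "(\<lambda>k. M * ph (k + n) powr (?\<theta> - 1)) \<longlonglongrightarrow> M * 0 powr (?\<theta> - 1)" for n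
    using th ph_pos by (intro tendsto_intros tendsto_powr') (auto intro!: always_eventually less_imp_le)
  have "en v n = 0" for n
  proof -
    have "2 powr (1 - p) * e1 v n \<le> M * 0 powr (?\<theta> - 1)"
      by (rule LIMSEQ_le_const[OF lim[of n]]) (use e1_le[of n] in \<open>auto simp: add.commute\<close>)
    then have "e1 v n \<le> 0" by (simp add: mult_le_0_iff)
    then show ?thesis using en_nonneg[of v n] h_pos[of n] by (simp add: e1_def mult_le_0_iff)
  qed
  from zero_energy_constant[OF v(1) this] have vc: "v x = v 0" if "x \<in> K" for x using that by blast
  from v(2) AE_space have "AE x in \<mu>. u x = v 0" by eventually_elim (simp add: space_mu vc)
  then show ?thesis by (auto simp: nonconstant_def)
qed

text \<open>A smaller radius decreases \<open>dd\<close>, and the normalisation grows by a bounded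
  factor per level. So each of finitely many consecutive terms is controlled by the first
  one.\<close>

lemma JJ_step: "JJ 1 u (Suc k) \<le> ennreal (2 * L * P) * JJ 1 u k"
proof -
  have pos: "0 < ps k" "0 < ps (Suc k)" "0 < ph k" "0 < ph (Suc k)" using ps_pos ph_pos by auto
  have "ph k * ps k \<le> (P * ph (Suc k)) * (2 * L * ps (Suc k))"
    using ph_ratio[of k] ps_ratio[of k] pos P_gt_1 by (intro mult_mono) (auto simp: P_def)
  then have "ph (Suc k) powr (- 1) / ps (Suc k) \<le> 2 * L * P * (ph k powr (- 1) / ps k)"
    using pos by (simp add: powr_minus_divide field_simps)
  then have "ennreal (ph (Suc k) powr (- 1) / ps (Suc k)) \<le> ennreal (2 * L * P) * ennreal (ph k powr (- 1) / ps k)"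
    using pos L_ge3 P_gt_1 by (subst ennreal_mult[symmetric]) (auto intro: ennreal_leI)
  moreover have "dd u (4 * h (Suc k)) \<le> dd u (4 * h k)"
    using h_decseq[of k "Suc k"] by (intro dd_mono) simp
  ultimately show ?thesis unfolding JJ_def by (subst mult.assoc[symmetric]) (rule mult_mono, auto)
qed

lemma JJ_steps: "JJ 1 u (k + j) \<le> ennreal ((2 * L * P) ^ j) * JJ 1 u k"
proof (induction j)
  case (Suc j)
  have "JJ 1 u (Suc (k + j)) \<le> ennreal (2 * L * P) * (ennreal ((2 * L * P) ^ j) * JJ 1 u k)"
    by (rule order_trans[OF JJ_step mult_left_mono[OF Suc]]) simp
  also have "\<dots> = ennreal ((2 * L * P) ^ Suc j) * JJ 1 u k"
    using L_ge3 P_gt_1 by (simp add: ennreal_mult mult.assoc[symmetric])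
  finally show ?case by simp
qed simp

text \<open>The energies increase to their supremum, so for large \<open>n\<close> the level \<open>n\<close> energy is at least
  half of it; in the bound \<open>EE_le_JJ_shift\<close> the terms of index at least \<open>M\<close> amount to at
  most a quarter, and the finitely many others are comparable with the first one.\<close>

lemma weak_monotonicity:
  assumes bs: "0 < bs"
  shows "\<exists>c>0. \<forall>u. continuous_on K u \<longrightarrow> SE u < \<top> \<longrightarrow>
    Phi_sup bs bs u \<le> ennreal c * Liminf (at_right 0) (Phi l \<mu> p bs bs u)"
proof -
  note crit = critical(1)
  note lb = lam_bounds[OF crit]
  obtain c0 where c0: "1 \<le> c0" "\<And>u. continuous_on K u \<Longrightarrow> comparable c0 bs bs u"
    using uniform_comparison[OF crit order_refl, of 1] bs by (metis divide_self_if order_less_irrefl order_refl)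
  \<comment> \<open>\<open>B * X\<close> will bound every term \<open>JJ 1 u (n + 2)\<close>, where
    \<open>X\<close> is the total energy: the terms are controlled by \<open>Phi_sup\<close>, and
    that by the energy.\<close>
  define B where "B = C_J 1 * c0"
  have B: "0 \<le> B" using C_J_pos[of 1] c0 by (simp add: B_def)
  let ?q = "1 / (1 - lam 1)"
  have q: "0 < ?q" using lb by simp
  have "(\<lambda>m. C_L 1 * (lam 1 ^ m * (?q * B))) \<longlonglongrightarrow> C_L 1 * (0 * (?q * B))"
    using lb by (intro tendsto_intros LIMSEQ_power_zero) auto
  then have "\<forall>\<^sub>F m in sequentially. C_L 1 * (lam 1 ^ m * (?q * B)) < 1/4" by (intro order_tendstoD(2)) auto
  then obtain M where M: "C_L 1 * (lam 1 ^ M * (?q * B)) < 1/4" by (auto dest!: eventually_happens'[OF sequentially_bot])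
  define R where "R = 2 * L * P"
  have "1 * 1 \<le> (2 * L) * P" using L_ge3 P_gt_1 by (intro mult_mono) auto
  then have R: "1 \<le> R" by (simp add: R_def)
  define D where "D = C_L 1 * (real M * R ^ M) * C_J 1"
  have D: "0 \<le> D" using C_L_nonneg[of 1] R C_J_pos[of 1] by (simp add: D_def)
  define c where "c = c0 * (4 * D + 1)"
  have c: "0 < c" using c0 D by (simp add: c_def add_nonneg_pos)
  have "Phi_sup bs bs u \<le> ennreal c * Liminf (at_right 0) (Phi l \<mu> p bs bs u)"
    if u: "continuous_on K u" and fin: "SE u < \<top>" for u
  proof -
    obtain X where X: "SE u = ennreal X" "0 \<le> X" using fin by (cases "SE u") auto
    have cmp: "Phi_sup bs bs u \<le> ennreal c0 * SE u"
      using c0(2)[OF u] bs by (simp add: comparable_def E_pinf_SUP SE_def)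
    have um: "u \<in> borel_measurable \<mu>" by (rule continuous_measurable[OF u])
    have JB: "JJ 1 u (n + 2) \<le> ennreal (B * X)" for n
    proof -
      have "JJ 1 u (n + 2) \<le> ennreal (C_J 1) * Phi_sup bs bs u"
        using JJ_le_Phi_sup[OF um, of bs bs 1 n] bs by simp
      also have "\<dots> \<le> ennreal (C_J 1) * (ennreal c0 * ennreal X)" using cmp X by (intro mult_left_mono) auto
      also have "\<dots> = ennreal (B * X)" using C_J_pos[of 1] c0(1) X(2) by (simp add: B_def ennreal_mult mult.assoc)
      finally show ?thesis .
    qed
    have main: "ennreal X \<le> ennreal (4 * D + 1) * Phi l \<mu> p bs bs u r"
      if n: "ennreal (X / 2) \<le> EE 1 u n" and r: "2 * h (Suc n) < r" "r \<le> 2 * h n" for n r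
    proof -
      let ?a = "\<lambda>j. ennreal (lam 1 ^ j) * JJ 1 u (n + j + 2)"
      have first: "(\<Sum>j<M. ?a j) \<le> ennreal (real M * R ^ M) * JJ 1 u (n + 2)"
      proof -
        have "?a j \<le> ennreal (R ^ M) * JJ 1 u (n + 2)" if "j < M" for j
        proof -
          have "JJ 1 u (n + j + 2) \<le> ennreal (R ^ j) * JJ 1 u (n + 2)"
            using JJ_steps[of u "n + 2" j] by (simp add: R_def add.commute add.left_commute)
          then have "?a j \<le> ennreal (lam 1 ^ j) * (ennreal (R ^ j) * JJ 1 u (n + 2))" by (intro mult_left_mono) auto
          also have "\<dots> \<le> 1 * (ennreal (R ^ M) * JJ 1 u (n + 2))"
            using lb R that by (intro mult_mono ennreal_leI power_increasing) (auto simp: power_le_one)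
          finally show ?thesis by simp
        qed
        then have "(\<Sum>j<M. ?a j) \<le> (\<Sum>j<M. ennreal (R ^ M) * JJ 1 u (n + 2))" by (intro sum_mono) auto
        also have "\<dots> = ennreal (real M * R ^ M) * JJ 1 u (n + 2)"
          using R by (simp add: ennreal_mult ennreal_of_nat_eq_real_of_nat mult.assoc)
        finally show ?thesis .
      qed
      have rest: "(\<Sum>j. ?a (j + M)) \<le> ennreal (lam 1 ^ M * (?q * (B * X)))"
      proof -
        have "(\<Sum>j. ?a (j + M)) \<le> (\<Sum>j. ennreal (lam 1 ^ j) * ennreal (lam 1 ^ M * (B * X)))"
        proof (rule suminf_le)
          fix j
          have "?a (j + M) \<le> ennreal (lam 1 ^ (j + M)) * ennreal (B * X)"
            using JB[of "n + (j + M)"] by (intro mult_left_mono) auto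
          also have "\<dots> = ennreal (lam 1 ^ j) * ennreal (lam 1 ^ M * (B * X))"
            using lb B X by (simp add: power_add mult.assoc flip: ennreal_mult)
          finally show "?a (j + M) \<le> ennreal (lam 1 ^ j) * ennreal (lam 1 ^ M * (B * X))" .
        qed auto
        also have "\<dots> = ennreal ?q * ennreal (lam 1 ^ M * (B * X))"
          unfolding ennreal_suminf_multc using lb by (subst geometric_ennreal) auto
        also have "\<dots> = ennreal (lam 1 ^ M * (?q * (B * X)))"
          using q lb B X by (subst ennreal_mult[symmetric]) (auto simp: mult_ac)
        finally show ?thesis .
      qed
      have "ennreal (X / 2) \<le> ennreal (C_L 1) * (\<Sum>j. ?a j)"
        using n EE_le_JJ_shift[OF crit order_refl order_refl u, of n] by simp
      also have "(\<Sum>j. ?a j) = (\<Sum>j. ?a (j + M)) + (\<Sum>j<M. ?a j)"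
        by (rule suminf_offset) simp
      also have "ennreal (C_L 1) * ((\<Sum>j. ?a (j + M)) + (\<Sum>j<M. ?a j)) \<le>
          ennreal (C_L 1) * (ennreal (lam 1 ^ M * (?q * (B * X))) + ennreal (real M * R ^ M) * JJ 1 u (n + 2))"
        by (intro mult_left_mono add_mono first rest) simp
      also have "\<dots> = ennreal (C_L 1 * (lam 1 ^ M * (?q * B)) * X) + ennreal (C_L 1 * (real M * R ^ M)) * JJ 1 u (n + 2)"
      proof -
        have nn: "0 \<le> lam 1 ^ M * (?q * (B * X))" "0 \<le> real M * R ^ M" using q lb B X R by auto
        show ?thesis
          unfolding distrib_left mult.assoc[symmetric, of "ennreal _"] ennreal_mult[OF C_L_nonneg nn(1), symmetric]
            ennreal_mult[OF C_L_nonneg nn(2), symmetric] by (simp add: mult.assoc)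
      qed
      also have "\<dots> \<le> ennreal (X / 4) + ennreal (C_L 1 * (real M * R ^ M)) * (ennreal (C_J 1) * Phi l \<mu> p bs bs u r)"
      proof (intro add_mono mult_left_mono ennreal_leI)
        show "C_L 1 * (lam 1 ^ M * (?q * B)) * X \<le> X / 4" using mult_right_mono[OF less_imp_le[OF M] X(2)] by simp
        show "JJ 1 u (n + 2) \<le> ennreal (C_J 1) * Phi l \<mu> p bs bs u r"
          using JJ_le_Phi[OF um r, of bs bs 1] bs by (simp add: C_J_def)
      qed simp
      also have "\<dots> = ennreal (X / 4) + ennreal D * Phi l \<mu> p bs bs u r"
      proof -
        have nn: "0 \<le> C_L 1 * (real M * R ^ M)" "0 \<le> C_J 1" using C_L_nonneg R C_J_pos[of 1] by auto
        show ?thesis unfolding D_def ennreal_mult[OF nn] by (simp add: mult.assoc)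
      qed
      finally have half: "ennreal (X / 2) \<le> ennreal (X / 4) + ennreal D * Phi l \<mu> p bs bs u r" .
      \<comment> \<open>Subtracting \<open>X / 4\<close> from both sides; the case of an infinite
        right side is separate and trivial.\<close>
      have "ennreal (X / 4) \<le> ennreal D * Phi l \<mu> p bs bs u r"
      proof (cases "ennreal D * Phi l \<mu> p bs bs u r = \<top>")
        case False
        then obtain y where y: "ennreal D * Phi l \<mu> p bs bs u r = ennreal y" "0 \<le> y"
          by (cases "ennreal D * Phi l \<mu> p bs bs u r") auto
        then have "X / 2 \<le> X / 4 + y" using half X(2) by (simp add: ennreal_le_iff flip: ennreal_plus)
        then show ?thesis unfolding y by (intro ennreal_leI) simp
      qed simp
      then have "ennreal 4 * ennreal (X / 4) \<le> ennreal 4 * (ennreal D * Phi l \<mu> p bs bs u r)" by (intro mult_left_mono) auto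
      also have "\<dots> = ennreal (4 * D) * Phi l \<mu> p bs bs u r"
        using D by (subst ennreal_mult) (auto simp: mult.assoc)
      also have "\<dots> \<le> ennreal (4 * D + 1) * Phi l \<mu> p bs bs u r" by (intro mult_right_mono ennreal_leI) auto
      also have "ennreal 4 * ennreal (X / 4) = ennreal X"
        using X(2) by (subst ennreal_mult[symmetric]) auto
      finally show ?thesis .
    qed
    have "ennreal (X / c') \<le> Liminf (at_right 0) (Phi l \<mu> p bs bs u)" if c': "c' = 4 * D + 1" for c'
    proof (cases "X = 0")
      case False
      then have Xp: "0 < X" using X by simp
      \<comment> \<open>Some level exceeds half of the positive supremum, and by monotonicity so
        does every finer one, that is, the level of every small radius.\<close>
      have "ennreal (X / 2) < (SUP n. EE 1 u n)" using Xp X by (simp add: SE_def[symmetric] ennreal_less_iff)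
      then obtain N where N: "ennreal (X / 2) < EE 1 u N" by (auto simp: less_SUP_iff)
      show ?thesis
      proof (rule Liminf_bounded)
        have "\<forall>\<^sub>F r in at_right 0. 0 < r \<and> r < 2 * h N"
          using eventually_at_right_real[of 0 "2 * h N"] h_pos[of N] by simp
        then show "\<forall>\<^sub>F r in at_right 0. ennreal (X / c') \<le> Phi l \<mu> p bs bs u r"
        proof eventually_elim
          case (elim r)
          have "r \<le> 2" using elim h_decseq[of 0 N] h_0 by simp
          then obtain n where n: "2 * h (Suc n) < r" "r \<le> 2 * h n" using scale_exists[of r] elim by blast
          have "N \<le> n"
          proof (rule ccontr)
            assume "\<not> N \<le> n"
            then have "h N \<le> h (Suc n)" by (intro h_decseq) simp
            then show False using n elim by simp
          qed
          then have "EE 1 u N \<le> EE 1 u n" using EE1_mono[of u N "n - N"] by simp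
          then have "ennreal (X / 2) \<le> EE 1 u n" using N by (meson less_imp_le order_trans)
          from main[OF this n] have "ennreal (1 / c') * ennreal X \<le> Phi l \<mu> p bs bs u r"
            using D by (intro ennreal_rescale_le[of _ c' ]) (auto simp: c')
          then show ?case using X D c' by (simp flip: ennreal_mult)
        qed
      qed
    qed simp
    from this[OF refl] have "ennreal (4 * D + 1) * ennreal (X / (4 * D + 1)) \<le> ennreal (4 * D + 1) * Liminf (at_right 0) (Phi l \<mu> p bs bs u)"
      by (intro mult_left_mono) auto
    moreover have "ennreal (4 * D + 1) * ennreal (X / (4 * D + 1)) = ennreal X"
      using D X by (subst ennreal_mult[symmetric]) auto
    ultimately have "ennreal X \<le> ennreal (4 * D + 1) * Liminf (at_right 0) (Phi l \<mu> p bs bs u)" by simp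
    then have "ennreal c0 * SE u \<le> ennreal c0 * (ennreal (4 * D + 1) * Liminf (at_right 0) (Phi l \<mu> p bs bs u))"
      unfolding X(1) by (intro mult_left_mono) auto
    with cmp have "Phi_sup bs bs u \<le> ennreal c0 * (ennreal (4 * D + 1) * Liminf (at_right 0) (Phi l \<mu> p bs bs u))"
      by (rule order_trans)
    also have "\<dots> = ennreal c * Liminf (at_right 0) (Phi l \<mu> p bs bs u)"
      using c0(1) D unfolding c_def by (subst ennreal_mult) (auto simp: mult.assoc)
    finally show ?thesis .
  qed
  then show ?thesis using c by blast
qed

text \<open>Only \<beta> close to \<open>bs\<close> matter. For \<open>\<beta> / bs\<close> between
  \<open>t\<close>, the midpoint of 2 / (p + 1) and 1, and 1 the comparison constant is uniform, so
  the Besov integral inherits both bounds from \<open>E_pp\<close>.\<close>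

lemma BBM:
  assumes bs: "0 < bs"
  shows "\<exists>c>1. \<forall>u. continuous_on K u \<longrightarrow>
    ennreal (1 / c) * E_p l p u \<le> Liminf (at_left bs) (\<lambda>\<beta>. ennreal (bs - \<beta>) * E_pp l p bs \<beta> u) \<and>
    Limsup (at_left bs) (\<lambda>\<beta>. ennreal (bs - \<beta>) * E_pp l p bs \<beta> u) \<le> ennreal c * E_p l p u \<and>
    ennreal (1 / c) * Phi_sup bs bs u \<le> Liminf (at_left bs) (\<lambda>\<beta>. ennreal (bs - \<beta>) * Phi_int bs \<beta> u) \<and>
    Limsup (at_left bs) (\<lambda>\<beta>. ennreal (bs - \<beta>) * Phi_int bs \<beta> u) \<le> ennreal c * Phi_sup bs bs u"
proof -
  define t where "t = (2 / (p + 1) + 1) / 2"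
  have t: "2 / (p + 1) < t" "t \<le> 1" "t < 1" using critical(1) by (auto simp: t_def field_simps)
  obtain c0 where c0: "1 \<le> c0" "\<And>\<beta> u. t \<le> \<beta> / bs \<Longrightarrow> \<beta> / bs \<le> 1 \<Longrightarrow> continuous_on K u \<Longrightarrow> comparable c0 bs \<beta> u"
    using uniform_comparison[OF t(1,2), of 1] by metis
  define d where "d = bs / (2 * ln P)"
  have d: "0 < d" using bs P_gt_1 by (simp add: d_def)
  define k where "k = 2 powr (p - 1)"
  have k: "1 \<le> k" using p by (simp add: k_def ge_one_powr_ge_zero)
  define c where "c = 2 + k / d + c0\<^sup>2 / d + bs * A_up + c0\<^sup>2 * (bs * A_up)"
  have terms: "0 \<le> k / d" "0 \<le> c0\<^sup>2 / d" "0 \<le> bs * A_up" "0 \<le> c0\<^sup>2 * (bs * A_up)"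
    using d k bs A_up_pos by auto
  have c: "1 < c" "k / d \<le> c" "c0\<^sup>2 / d \<le> c" "bs * A_up \<le> c" "c0\<^sup>2 * (bs * A_up) \<le> c"
    using terms unfolding c_def by linarith+
  have ev: "\<forall>\<^sub>F \<beta> in at_left bs. t \<le> \<beta> / bs \<and> 0 \<le> \<beta> \<and> \<beta> < bs"
  proof -
    have "0 < t" using t(1) critical(2) by linarith
    then have "t * bs < bs" "0 \<le> t * bs" using t(3) bs by auto
    have "\<forall>\<^sub>F \<beta> in at_left bs. \<beta> \<in> {t * bs<..<bs}" by (rule eventually_at_left_real) fact
    then show ?thesis
    proof eventually_elim
      case (elim \<beta>)
      then show ?case using bs \<open>0 \<le> t * bs\<close> by (auto simp: le_divide_eq)
    qed
  qed
  have "ennreal (1 / c) * E_p l p u \<le> Liminf (at_left bs) (\<lambda>\<beta>. ennreal (bs - \<beta>) * E_pp l p bs \<beta> u) \<and>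
    Limsup (at_left bs) (\<lambda>\<beta>. ennreal (bs - \<beta>) * E_pp l p bs \<beta> u) \<le> ennreal c * E_p l p u \<and>
    ennreal (1 / c) * Phi_sup bs bs u \<le> Liminf (at_left bs) (\<lambda>\<beta>. ennreal (bs - \<beta>) * Phi_int bs \<beta> u) \<and>
    Limsup (at_left bs) (\<lambda>\<beta>. ennreal (bs - \<beta>) * Phi_int bs \<beta> u) \<le> ennreal c * Phi_sup bs bs u"
    if u: "continuous_on K u" for u
  proof -
    let ?f = "\<lambda>\<beta>. ennreal (bs - \<beta>) * E_pp l p bs \<beta> u" and ?g = "\<lambda>\<beta>. ennreal (bs - \<beta>) * Phi_int bs \<beta> u"
    have E: "E_p l p u = ennreal k * SE u" by (simp add: E_p_SE k_def)
    have "t \<le> bs / bs" using bs t by simp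
    then have S: "Phi_sup bs bs u \<le> ennreal c0 * SE u" "SE u \<le> ennreal c0 * Phi_sup bs bs u"
      using c0(2)[of bs u] bs u by (simp_all add: comparable_def E_pinf_SUP SE_def)
    have fg: "?f \<beta> \<le> ennreal c0 * ?g \<beta>" "?g \<beta> \<le> ennreal c0 * ?f \<beta>" if "t \<le> \<beta> / bs" "\<beta> < bs" for \<beta>
    proof -
      have "\<beta> / bs \<le> 1" using that bs by simp
      then have cmp: "E_pp l p bs \<beta> u \<le> ennreal c0 * Phi_int bs \<beta> u" "Phi_int bs \<beta> u \<le> ennreal c0 * E_pp l p bs \<beta> u"
        using c0(2)[OF that(1) _ u] by (simp_all add: comparable_def)
      show "?f \<beta> \<le> ennreal c0 * ?g \<beta>" "?g \<beta> \<le> ennreal c0 * ?f \<beta>"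
        unfolding mult.left_commute[of "ennreal c0"] by (intro mult_left_mono cmp zero_le)+
    qed
    \<comment> \<open>For each single level \<open>N\<close> the bound holds near \<open>bs\<close>,
      in a neighbourhood that depends on \<open>N\<close>; the supremum over \<open>N\<close> is
      taken only after the lower limit.\<close>
    have low_f: "ennreal d * SE u \<le> Liminf (at_left bs) ?f"
      unfolding SE_def SUP_mult_left_ennreal
    proof (rule SUP_least, rule Liminf_bounded)
      fix N show "\<forall>\<^sub>F \<beta> in at_left bs. ennreal d * EE 1 u N \<le> ?f \<beta>"
        using E_pp_lower_eventually[OF bs, of u N] by eventually_elim (simp add: d_def)
    qed
    have low_g: "ennreal (d / c0) * SE u \<le> Liminf (at_left bs) ?g"
      unfolding SE_def SUP_mult_left_ennreal
    proof (rule SUP_least, rule Liminf_bounded)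
      fix N show "\<forall>\<^sub>F \<beta> in at_left bs. ennreal (d / c0) * EE 1 u N \<le> ?g \<beta>"
        using E_pp_lower_eventually[OF bs, of u N] ev
      proof eventually_elim
        case (elim \<beta>)
        have "ennreal d * EE 1 u N \<le> ?f \<beta>" using elim by (simp add: d_def)
        also have "\<dots> \<le> ennreal c0 * ?g \<beta>" using fg elim by blast
        finally have "ennreal (1 / c0) * (ennreal d * EE 1 u N) \<le> ?g \<beta>"
          by (rule ennreal_rescale_le) (use c0 in auto)
        moreover have "ennreal (1 / c0) * ennreal d = ennreal (d / c0)" using c0 d by (simp flip: ennreal_mult)
        ultimately show ?case by (simp add: mult.assoc[symmetric])
      qed
    qed
    have up_f: "\<forall>\<^sub>F \<beta> in at_left bs. ?f \<beta> \<le> ennreal (bs * A_up) * SE u"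
      using ev by eventually_elim (use E_pp_upper[OF bs] in blast)
    have up_g: "\<forall>\<^sub>F \<beta> in at_left bs. ?g \<beta> \<le> ennreal c0 * (ennreal (bs * A_up) * SE u)"
      using ev up_f
    proof eventually_elim
      case (elim \<beta>)
      then show ?case using fg(2)[of \<beta>] by (meson mult_left_mono order_trans zero_le)
    qed
    have 1: "ennreal (1 / c) * E_p l p u \<le> Liminf (at_left bs) ?f"
    proof -
      have "ennreal (1 / c) * E_p l p u = ennreal (k / c) * SE u"
        unfolding E mult.assoc[symmetric] using c k by (subst ennreal_mult[symmetric]) auto
      also have "\<dots> \<le> ennreal d * SE u"
        using c(1,2) d by (intro mult_right_mono ennreal_leI) (auto simp: divide_le_eq mult.commute)
      finally show ?thesis using low_f by (rule order_trans)
    qed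
    have 2: "Limsup (at_left bs) ?f \<le> ennreal c * E_p l p u"
    proof -
      have "ennreal (bs * A_up) * SE u \<le> ennreal (c * k) * SE u"
        using c k mult_mono[of "bs * A_up" c 1 k] by (intro mult_right_mono ennreal_leI) auto
      also have "\<dots> = ennreal c * E_p l p u" unfolding E using c k by (subst ennreal_mult) (auto simp: mult.assoc)
      finally show ?thesis using Limsup_bounded[OF up_f] by (rule order_trans[rotated])
    qed
    have 3: "ennreal (1 / c) * Phi_sup bs bs u \<le> Liminf (at_left bs) ?g"
    proof -
      have "ennreal (1 / c) * Phi_sup bs bs u \<le> ennreal (1 / c) * (ennreal c0 * SE u)"
        by (intro mult_left_mono S(1)) simp
      also have "\<dots> = ennreal (c0 / c) * SE u"
        unfolding mult.assoc[symmetric] using c c0 by (subst ennreal_mult[symmetric]) auto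
      also have "\<dots> \<le> ennreal (d / c0) * SE u"
      proof (intro mult_right_mono ennreal_leI)
        have "c0\<^sup>2 \<le> c * d" using c(3) d by (simp add: divide_le_eq)
        then show "c0 / c \<le> d / c0" using c(1) c0(1) by (simp add: field_simps power2_eq_square)
      qed simp
      finally show ?thesis using low_g by (rule order_trans)
    qed
    have 4: "Limsup (at_left bs) ?g \<le> ennreal c * Phi_sup bs bs u"
    proof -
      have "ennreal c0 * (ennreal (bs * A_up) * SE u) \<le> ennreal c0 * (ennreal (bs * A_up) * (ennreal c0 * Phi_sup bs bs u))"
        by (intro mult_left_mono S(2)) auto
      also have "\<dots> = ennreal (c0\<^sup>2 * (bs * A_up)) * Phi_sup bs bs u"
      proof -
        have "ennreal (c0\<^sup>2 * (bs * A_up)) = ennreal c0 * ennreal c0 * ennreal (bs * A_up)"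
          using c0(1) terms(3) ennreal_mult[of "c0 * c0" "bs * A_up"] ennreal_mult[of c0 c0]
          by (simp add: power2_eq_square)
        then show ?thesis by (simp only: mult_ac)
      qed
      also have "\<dots> \<le> ennreal c * Phi_sup bs bs u" by (intro mult_right_mono ennreal_leI c) simp
      finally show ?thesis using Limsup_bounded[OF up_g] by (rule order_trans[rotated])
    qed
    show ?thesis using 1 2 3 4 by blast
  qed
  then show ?thesis using c(1) by blast
qed

lemma F_p_iff: "u \<in> F_p l p \<longleftrightarrow> continuous_on K u \<and> SE u < \<top>"
proof -
  have "E_p l p u < \<infinity> \<longleftrightarrow> SE u < \<top>"
    unfolding E_p_SE infinity_ennreal_def by (auto simp: ennreal_mult_less_top less_top)
  then show ?thesis by (simp add: F_p_def C_K_def)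
qed

lemma F_p_eq:
  assumes bs: "0 < bs" shows "F_p l p = cont_versions l \<mu> (Bpinf l \<mu> p bs bs)"
proof -
  obtain c0 where c0: "\<And>u. continuous_on K u \<Longrightarrow> comparable c0 bs bs u"
    using uniform_comparison[OF critical(1) order_refl, of 1] bs by (metis divide_self_if order_less_irrefl order_refl)
  have fin: "SE v < \<top> \<longleftrightarrow> Phi_sup bs bs v < \<top>" if "continuous_on K v" for v
  proof -
    have "Phi_sup bs bs v \<le> ennreal c0 * SE v" "SE v \<le> ennreal c0 * Phi_sup bs bs v"
      using c0[OF that] bs by (simp_all add: comparable_def E_pinf_SUP SE_def)
    then show ?thesis by (metis ennreal_less_top ennreal_mult_less_top order_le_less_trans)
  qed
  show ?thesis
  proof (intro set_eqI iffI)
    fix v assume "v \<in> F_p l p"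
    then have v: "continuous_on K v" "SE v < \<top>" by (auto simp: F_p_iff)
    then have "v \<in> Bpinf l \<mu> p bs bs" using fin continuous_Lp by (simp add: Bpinf_iff)
    then show "v \<in> cont_versions l \<mu> (Bpinf l \<mu> p bs bs)" using v by (auto simp: cont_versions_def C_K_def)
  next
    fix v assume "v \<in> cont_versions l \<mu> (Bpinf l \<mu> p bs bs)"
    then obtain u where u: "continuous_on K v" "u \<in> Bpinf l \<mu> p bs bs" "AE x in \<mu>. u x = v x"
      by (auto simp: cont_versions_def C_K_def)
    then have "Phi_sup bs bs v < \<top>" using Phi_sup_cong_AE[OF u(3)] by (simp add: Bpinf_iff)
    then show "v \<in> F_p l p" using u(1) fin by (simp add: F_p_iff)
  qed
qed

lemma Bpinf_nonconstant: assumes bs: "0 < bs" shows "\<exists>u\<in>Bpinf l \<mu> p bs bs. nonconstant \<mu> u"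
proof -
  obtain v where v: "continuous_on K v" "\<And>n. h n powr (1 - p) * en v n \<le> 4 * 12 powr p" "nonconstant \<mu> v"
    using finite_energy_nonconstant by blast
  have "SE v \<le> ennreal (2 powr (1 - p)) * ennreal (4 * 12 powr p)"
    unfolding SE_def EE_1 e1_def by (intro SUP_least mult_left_mono ennreal_leI v(2)) simp
  also have "\<dots> < \<top>" by (simp add: ennreal_mult_less_top)
  finally have "v \<in> F_p l p" using v(1) by (simp add: F_p_iff)
  then have "v \<in> cont_versions l \<mu> (Bpinf l \<mu> p bs bs)" using F_p_eq[OF bs] by simp
  then obtain u where u: "u \<in> Bpinf l \<mu> p bs bs" "AE x in \<mu>. u x = v x" by (auto simp: cont_versions_def)
  have "nonconstant \<mu> u"
    unfolding nonconstant_def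
  proof
    assume "\<exists>c. AE x in \<mu>. u x = c"
    then obtain c where "AE x in \<mu>. u x = c" by blast
    then have "AE x in \<mu>. v x = c" using u(2) by eventually_elim simp
    then show False using v(3) by (auto simp: nonconstant_def)
  qed
  then show ?thesis using u(1) by blast
qed

lemma comparison_all:
  assumes bs: "0 < bs" and \<beta>: "2 / (p + 1) * bs < \<beta>"
  shows "\<exists>c\<ge>1. \<forall>u\<in>C_K l.
    ennreal (1 / c) * Phi_sup bs \<beta> u \<le> E_pinf l p bs \<beta> u \<and> E_pinf l p bs \<beta> u \<le> ennreal c * Phi_sup bs \<beta> u \<and>
    ennreal (1 / c) * Phi_int bs \<beta> u \<le> E_pp l p bs \<beta> u \<and> E_pp l p bs \<beta> u \<le> ennreal c * Phi_int bs \<beta> u"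
proof -
  have "2 / (p + 1) < \<beta> / bs" using assms by (simp add: less_divide_eq)
  then obtain t where t: "2 / (p + 1) < t" "t \<le> 1" "t \<le> \<beta> / bs" using exponent_range by blast
  obtain c where c: "1 \<le> c" "\<And>u. continuous_on K u \<Longrightarrow> comparable c bs \<beta> u"
    using uniform_comparison[OF t(1,2), of "\<beta> / bs"] t(3) by blast
  show ?thesis
    using c ennreal_rescale_le[OF _ order_refl c(1)] by (intro exI[of _ c]) (auto simp: C_K_def comparable_def)
qed

lemma comparison_critical:
  assumes bs: "0 < bs"
  shows "\<exists>c\<ge>1. \<forall>u\<in>F_p l p.
    ennreal (1 / c) * Phi_sup bs bs u \<le> E_p l p u \<and> E_p l p u \<le> ennreal c * Phi_sup bs bs u"
proof -
  obtain c where c: "1 \<le> c" "\<And>u. continuous_on K u \<Longrightarrow> comparable c bs bs u"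
    using uniform_comparison[OF critical(1) order_refl, of 1] bs by (metis divide_self_if order_less_irrefl order_refl)
  \<comment> \<open>The factor between \<open>E_p\<close> and \<open>E_pinf\<close> at
    \<open>\<beta> = bs\<close>: the former is normalised by \<open>h n\<close>, the latter by
    \<open>rho l n = 2 * h n\<close>.\<close>
  define k where "k = 2 powr (p - 1)"
  have k: "1 \<le> k" using p by (simp add: k_def ge_one_powr_ge_zero)
  have kc: "c \<le> k * c" using mult_right_mono[OF k, of c] c by simp
  have kc1: "1 \<le> k * c" using kc c(1) by linarith
  have "ennreal (1 / (k * c)) * Phi_sup bs bs u \<le> E_p l p u \<and> E_p l p u \<le> ennreal (k * c) * Phi_sup bs bs u"
    if "u \<in> F_p l p" for u
  proof
    have u: "continuous_on K u" using that by (simp add: F_p_iff)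
    have S: "Phi_sup bs bs u \<le> ennreal c * SE u" "SE u \<le> ennreal c * Phi_sup bs bs u"
      using c(2)[OF u] bs by (simp_all add: comparable_def E_pinf_SUP SE_def)
    have "1 * SE u \<le> ennreal k * SE u" using k by (intro mult_right_mono) auto
    then have "ennreal c * SE u \<le> ennreal c * E_p l p u"
      unfolding E_p_SE k_def[symmetric] by (intro mult_left_mono) auto
    with S(1) have "Phi_sup bs bs u \<le> ennreal c * E_p l p u" by (rule order_trans)
    then show "ennreal (1 / (k * c)) * Phi_sup bs bs u \<le> E_p l p u"
      by (rule ennreal_rescale_le[OF _ kc kc1])
    have "E_p l p u \<le> ennreal k * (ennreal c * Phi_sup bs bs u)"
      unfolding E_p_SE k_def[symmetric] by (intro mult_left_mono S(2)) simp
    then show "E_p l p u \<le> ennreal (k * c) * Phi_sup bs bs u"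
      using k c(1) by (simp add: ennreal_mult mult.assoc)
  qed
  then show ?thesis using kc1 by blast
qed

end

theorem theorem1p4:
  fixes l :: "nat \<Rightarrow> nat" and p :: real
  assumes "vicsek_seq l" and "bdd_above (l ` {1..})"
    and "1 < p"
  shows "\<exists>\<epsilon>. 0 < \<epsilon> \<and> \<epsilon> < 1 \<and> (\<forall>\<mu> bs. vicsek_measure l \<mu> \<longrightarrow> 0 < bs \<longrightarrow>
   (\<comment> \<open>(1)\<close>
    (\<forall>\<beta>>\<epsilon> * bs.
       Bpp l \<mu> p bs \<beta> \<subseteq> Bpinf l \<mu> p bs \<beta> \<and> included_in_C l \<mu> (Bpinf l \<mu> p bs \<beta>) \<and>
       (\<exists>c\<ge>1. \<forall>u\<in>C_K l.
          ennreal (1 / c) * enn_powr (besov_pinf l \<mu> p bs \<beta> u) p \<le> E_pinf l p bs \<beta> u \<and>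
          E_pinf l p bs \<beta> u \<le> ennreal c * enn_powr (besov_pinf l \<mu> p bs \<beta> u) p \<and>
          ennreal (1 / c) * enn_powr (besov_pp l \<mu> p bs \<beta> u) p \<le> E_pp l p bs \<beta> u \<and>
          E_pp l p bs \<beta> u \<le> ennreal c * enn_powr (besov_pp l \<mu> p bs \<beta> u) p)) \<and>
    F_p l p = cont_versions l \<mu> (Bpinf l \<mu> p bs bs) \<and>
    (\<exists>c\<ge>1. \<forall>u\<in>F_p l p.
       ennreal (1 / c) * enn_powr (besov_pinf l \<mu> p bs bs u) p \<le> E_p l p u \<and>
       E_p l p u \<le> ennreal c * enn_powr (besov_pinf l \<mu> p bs bs u) p) \<and>
    \<comment> \<open>(2)\<close>
    (\<exists>u\<in>Bpinf l \<mu> p bs bs. nonconstant \<mu> u) \<and>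
    (\<forall>\<beta>\<ge>0. (\<exists>u\<in>Bpinf l \<mu> p bs \<beta>. nonconstant \<mu> u) \<longrightarrow> \<beta> \<le> bs) \<and>
    \<comment> \<open>(3)\<close>
    (\<exists>c>0. \<forall>u\<in>F_p l p.
       (SUP r\<in>{0<..diameter (vicsek l)}. Phi l \<mu> p bs bs u r)
         \<le> ennreal c * Liminf (at_right 0) (Phi l \<mu> p bs bs u)) \<and>
    \<comment> \<open>(4)\<close>
    (\<exists>c>1. \<forall>u\<in>F_p l p.
       ennreal (1 / c) * E_p l p u
         \<le> Liminf (at_left bs) (\<lambda>\<beta>. ennreal (bs - \<beta>) * E_pp l p bs \<beta> u) \<and>
       Liminf (at_left bs) (\<lambda>\<beta>. ennreal (bs - \<beta>) * E_pp l p bs \<beta> u)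
         \<le> Limsup (at_left bs) (\<lambda>\<beta>. ennreal (bs - \<beta>) * E_pp l p bs \<beta> u) \<and>
       Limsup (at_left bs) (\<lambda>\<beta>. ennreal (bs - \<beta>) * E_pp l p bs \<beta> u)
         \<le> ennreal c * E_p l p u \<and>
       ennreal (1 / c) * enn_powr (besov_pinf l \<mu> p bs bs u) p
         \<le> Liminf (at_left bs) (\<lambda>\<beta>. ennreal (bs - \<beta>) * enn_powr (besov_pp l \<mu> p bs \<beta> u) p) \<and>
       Liminf (at_left bs) (\<lambda>\<beta>. ennreal (bs - \<beta>) * enn_powr (besov_pp l \<mu> p bs \<beta> u) p)
         \<le> Limsup (at_left bs) (\<lambda>\<beta>. ennreal (bs - \<beta>) * enn_powr (besov_pp l \<mu> p bs \<beta> u) p) \<and>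
       Limsup (at_left bs) (\<lambda>\<beta>. ennreal (bs - \<beta>) * enn_powr (besov_pp l \<mu> p bs \<beta> u) p)
         \<le> ennreal c * enn_powr (besov_pinf l \<mu> p bs bs u) p)))"
proof -
  obtain b where b: "\<And>k. 1 \<le> k \<Longrightarrow> l k \<le> b" using assms(2) by (auto simp: bdd_above_def)
  \<comment> \<open>The assumed bound concerns the indices from 1 on; the maximum also covers
    \<open>l 0 = 1\<close>.\<close>
  have "l n \<le> max 1 b" for n
    using b[of n] assms(1) by (cases "n = 0") (auto simp: vicsek_seq_def le_max_iff_disj)
  then interpret vicsek_energy l p "real (max 1 b)"
    by unfold_locales (use assms in auto)
  show ?thesis
  proof (rule exI[of _ "2 / (p + 1)"], intro conjI critical allI impI)
    fix \<mu> and bs :: real assume \<mu>: "vicsek_measure l \<mu>" and bs: "0 < bs"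
    interpret vicsek_space l p "real (max 1 b)" \<mu> by unfold_locales (rule \<mu>)
    have crit: "2 / (p + 1) < \<beta> / bs" if "2 / (p + 1) * bs < \<beta>" for \<beta>
      using that bs by (simp add: less_divide_eq)
    fix \<beta> assume \<beta>: "2 / (p + 1) * bs < \<beta>"
    show "Bpp l \<mu> p bs \<beta> \<subseteq> Bpinf l \<mu> p bs \<beta>" by (rule Bpp_subset_Bpinf[OF crit[OF \<beta>]])
    show "included_in_C l \<mu> (Bpinf l \<mu> p bs \<beta>)"
      unfolding included_in_C_def C_K_def using Bpinf_continuous_version[OF crit[OF \<beta>]] by blast
  next
    fix \<mu> and bs \<beta> :: real assume \<mu>: "vicsek_measure l \<mu>" and bs: "0 < bs" and \<beta>: "2 / (p + 1) * bs < \<beta>"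
    interpret vicsek_space l p "real (max 1 b)" \<mu> by unfold_locales (rule \<mu>)
    show "\<exists>c\<ge>1. \<forall>u\<in>C_K l.
          ennreal (1 / c) * enn_powr (besov_pinf l \<mu> p bs \<beta> u) p \<le> E_pinf l p bs \<beta> u \<and>
          E_pinf l p bs \<beta> u \<le> ennreal c * enn_powr (besov_pinf l \<mu> p bs \<beta> u) p \<and>
          ennreal (1 / c) * enn_powr (besov_pp l \<mu> p bs \<beta> u) p \<le> E_pp l p bs \<beta> u \<and>
          E_pp l p bs \<beta> u \<le> ennreal c * enn_powr (besov_pp l \<mu> p bs \<beta> u) p"
      unfolding besov_pp_powr besov_pinf_powr by (rule comparison_all[OF bs \<beta>])
  next
    fix \<mu> and bs :: real assume \<mu>: "vicsek_measure l \<mu>" and bs: "0 < bs"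
    interpret vicsek_space l p "real (max 1 b)" \<mu> by unfold_locales (rule \<mu>)
    show "F_p l p = cont_versions l \<mu> (Bpinf l \<mu> p bs bs)" by (rule F_p_eq[OF bs])
    show "\<exists>c\<ge>1. \<forall>u\<in>F_p l p.
       ennreal (1 / c) * enn_powr (besov_pinf l \<mu> p bs bs u) p \<le> E_p l p u \<and>
       E_p l p u \<le> ennreal c * enn_powr (besov_pinf l \<mu> p bs bs u) p"
      unfolding besov_pinf_powr by (rule comparison_critical[OF bs])
    show "\<exists>u\<in>Bpinf l \<mu> p bs bs. nonconstant \<mu> u" by (rule Bpinf_nonconstant[OF bs])
    show "\<beta> \<le> bs" if "\<exists>u\<in>Bpinf l \<mu> p bs \<beta>. nonconstant \<mu> u" for \<beta>
      using that supercritical_constant[OF bs] not_le by blast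
    show "\<exists>c>0. \<forall>u\<in>F_p l p.
       (SUP r\<in>{0<..diameter (vicsek l)}. Phi l \<mu> p bs bs u r)
         \<le> ennreal c * Liminf (at_right 0) (Phi l \<mu> p bs bs u)"
      using weak_monotonicity[OF bs] unfolding diameter_K Phi_sup_def[symmetric] Ball_def F_p_iff by blast
    have Liminf_le: "Liminf (at_left bs) f \<le> Limsup (at_left bs) f" for f :: "real \<Rightarrow> ennreal"
      by (rule Liminf_le_Limsup) simp
    obtain c where c: "1 < c" "\<And>u. continuous_on K u \<Longrightarrow>
      ennreal (1 / c) * E_p l p u \<le> Liminf (at_left bs) (\<lambda>\<beta>. ennreal (bs - \<beta>) * E_pp l p bs \<beta> u) \<and>
      Limsup (at_left bs) (\<lambda>\<beta>. ennreal (bs - \<beta>) * E_pp l p bs \<beta> u) \<le> ennreal c * E_p l p u \<and>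
      ennreal (1 / c) * Phi_sup bs bs u \<le> Liminf (at_left bs) (\<lambda>\<beta>. ennreal (bs - \<beta>) * Phi_int bs \<beta> u) \<and>
      Limsup (at_left bs) (\<lambda>\<beta>. ennreal (bs - \<beta>) * Phi_int bs \<beta> u) \<le> ennreal c * Phi_sup bs bs u"
      using BBM[OF bs] by blast
    show "\<exists>c>1. \<forall>u\<in>F_p l p.
       ennreal (1 / c) * E_p l p u
         \<le> Liminf (at_left bs) (\<lambda>\<beta>. ennreal (bs - \<beta>) * E_pp l p bs \<beta> u) \<and>
       Liminf (at_left bs) (\<lambda>\<beta>. ennreal (bs - \<beta>) * E_pp l p bs \<beta> u)
         \<le> Limsup (at_left bs) (\<lambda>\<beta>. ennreal (bs - \<beta>) * E_pp l p bs \<beta> u) \<and>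
       Limsup (at_left bs) (\<lambda>\<beta>. ennreal (bs - \<beta>) * E_pp l p bs \<beta> u)
         \<le> ennreal c * E_p l p u \<and>
       ennreal (1 / c) * enn_powr (besov_pinf l \<mu> p bs bs u) p
         \<le> Liminf (at_left bs) (\<lambda>\<beta>. ennreal (bs - \<beta>) * enn_powr (besov_pp l \<mu> p bs \<beta> u) p) \<and>
       Liminf (at_left bs) (\<lambda>\<beta>. ennreal (bs - \<beta>) * enn_powr (besov_pp l \<mu> p bs \<beta> u) p)
         \<le> Limsup (at_left bs) (\<lambda>\<beta>. ennreal (bs - \<beta>) * enn_powr (besov_pp l \<mu> p bs \<beta> u) p) \<and>
       Limsup (at_left bs) (\<lambda>\<beta>. ennreal (bs - \<beta>) * enn_powr (besov_pp l \<mu> p bs \<beta> u) p)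
         \<le> ennreal c * enn_powr (besov_pinf l \<mu> p bs bs u) p"
      unfolding besov_pp_powr besov_pinf_powr
      using c Liminf_le by (intro exI[of _ c]) (simp add: F_p_iff)
  qed
qed

end
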